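(* Let $n\ge 2$. There is a constant $C>0$ such that the following holds. Let $u\in\mathcal{D}'(T^n)$ be a complex-valued distribution such that $$(-\Delta)^{n/4}u\in (L^1+\dot H^{-n/2})(T^n)\quad\text{and}\quad \mathcal{R}_j(-\Delta)^{n/4}u\in (L^1+\dot H^{-n/2})(T^n)\quad\text{for all } j\in\{1,\dots,n\}.$$ Then $u-\bar u\in L^2_*(T^n)$, where $\bar u$ denotes the mean of $u$ over $T^n$, and $$\|u-\bar u\|_{L^2(T^n)}\le C\left(\|(-\Delta)^{n/4}u\|_{L^1+\dot H^{-n/2}(T^n)}+\sum_{j=1}^n\|\mathcal{R}_j(-\Delta)^{n/4}u\|_{L^1+\dot H^{-n/2}(T^n)}\right).$$ The constant $C$ is independent of $u$.
   Context: $T^n=\mathbb{R}^n/(2\pi\mathbb{Z})^n$; $\mathcal{D}'(T^n)$ is the space of distributions on $T^n$, with Fourier coefficients $\hat u(m)=\frac{1}{(2\pi)^n}\langle u,e^{-i\langle m,\cdot\rangle}\rangle$, $m\in\mathbb{Z}^n$. The mean of $u$ is $\bar u=\hat u(0)$. $L^2_*(T^n)$ is the space of mean-zero functions in $L^2(T^n)$. $(-\Delta)^{n/4}$ and the Riesz transforms $\mathcal{R}_j$ are the Fourier multiplier operators on $\mathcal{D}'(T^n)$ with multipliers $|m|^{n/2}$ and $i\frac{m_j}{|m|}$ respectively (the latter being $0$ at $m=0$), with $|m|$ the Euclidean norm. $\dot H^{-n/2}(T^n)$ is the space of distributions $f=(-\Delta)^{n/4}g$ with $g\in L^2(T^n)$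 (so $\hat f(0)=0$), with norm $\|f\|_{\dot H^{-n/2}}^2=\sum_{m\ne 0}|m|^{-n}|\hat f(m)|^2$. $(L^1+\dot H^{-n/2})(T^n)$ is the space of distributions $v=g+f$ with $g\in L^1(T^n)$, $f\in\dot H^{-n/2}(T^n)$, with norm $\inf\{\|g\|_{L^1}+\|f\|_{\dot H^{-n/2}}: v=g+f\}$. *)

theory Defs
  imports "HOL-Analysis.Analysis"
begin

text \<open>
  Functions on the torus \<open>T^n = R^n / (2 pi Z)^n\<close> are \<open>2 pi\<close>-periodic functions on
  \<open>real ^ 'n\<close>, \<open>n = CARD('n)\<close>, integrated over the cube \<open>[0, 2 pi]^n\<close>.
\<close>

definition freq :: "int ^ 'n \<Rightarrow> real ^ 'n" where
  "freq m = (\<chi> i. of_int (m $ i))"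

definition torus_periodic :: "(real ^ 'n \<Rightarrow> complex) \<Rightarrow> bool" where
  "torus_periodic f \<longleftrightarrow> (\<forall>x (k :: int ^ 'n). f (x + (2 * pi) *\<^sub>R freq k) = f x)"

definition torus :: "(real ^ 'n) measure" where
  "torus = lebesgue_on (cbox 0 (\<chi> i. 2 * pi))"

definition char_fun :: "int ^ 'n \<Rightarrow> real ^ 'n \<Rightarrow> complex" where
  "char_fun m x = cis (freq m \<bullet> x)"


subsection \<open>Distributions\<close>

definition partial :: "'n \<Rightarrow> (real ^ 'n \<Rightarrow> complex) \<Rightarrow> real ^ 'n \<Rightarrow> complex" where
  "partial j f x = frechet_derivative f (at x) (axis j 1)"

definition test_funs :: "(real ^ 'n \<Rightarrow> complex) set" where
  "test_funs = {\<phi>. torus_periodic \<phi> \<and> (\<forall>js x. foldr partial js \<phi> differentiable (at x))}"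

text \<open>
  A distribution is a linear functional on the test functions that is continuous for the
  topology of uniform convergence of all derivatives. It is kept \<open>extensional\<close>, so that
  equality of distributions is equality of functions.
\<close>

definition distributions :: "((real ^ 'n \<Rightarrow> complex) \<Rightarrow> complex) set" where
  "distributions = {u \<in> extensional test_funs.
     (\<forall>\<phi>\<in>test_funs. \<forall>\<psi>\<in>test_funs. u (\<lambda>x. \<phi> x + \<psi> x) = u \<phi> + u \<psi>) \<and>
     (\<forall>c. \<forall>\<phi>\<in>test_funs. u (\<lambda>x. c * \<phi> x) = c * u \<phi>) \<and>
     (\<exists>N B. \<forall>\<phi>\<in>test_funs.
        norm (u \<phi>) \<le> B * (\<Sum>js | length js \<le> N. SUP x. norm (foldr partial js \<phi> x)))}"

definition dist_add ::
  "((real ^ 'n \<Rightarrow> complex) \<Rightarrow> complex) \<Rightarrow> ((real ^ 'n \<Rightarrow> complex) \<Rightarrow> complex) \<Rightarrow>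
   (real ^ 'n \<Rightarrow> complex) \<Rightarrow> complex" where
  "dist_add u v = (\<lambda>\<phi>\<in>test_funs. u \<phi> + v \<phi>)"

definition dist_diff ::
  "((real ^ 'n \<Rightarrow> complex) \<Rightarrow> complex) \<Rightarrow> ((real ^ 'n \<Rightarrow> complex) \<Rightarrow> complex) \<Rightarrow>
   (real ^ 'n \<Rightarrow> complex) \<Rightarrow> complex" where
  "dist_diff u v = (\<lambda>\<phi>\<in>test_funs. u \<phi> - v \<phi>)"

definition dist_of :: "(real ^ 'n \<Rightarrow> complex) \<Rightarrow> (real ^ 'n \<Rightarrow> complex) \<Rightarrow> complex" where
  "dist_of g = (\<lambda>\<phi>\<in>test_funs. \<integral>x. g x * \<phi> x \<partial>torus)"

definition fourier_coeff ::
  "((real ^ 'n \<Rightarrow> complex) \<Rightarrow> complex) \<Rightarrow> int ^ 'n \<Rightarrow> complex" where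
  "fourier_coeff u m = u (char_fun (- m)) / (2 * pi) ^ CARD('n)"

definition dist_mean :: "((real ^ 'n \<Rightarrow> complex) \<Rightarrow> complex) \<Rightarrow> complex" where
  "dist_mean u = fourier_coeff u 0"


subsection \<open>Fourier multipliers\<close>

text \<open>
  The operator with multiplier \<open>\<sigma>\<close> sends \<open>u\<close> to the sum of
  \<open>\<sigma> m * fourier_coeff u m * char_fun m\<close> over all \<open>m\<close>, convergent in the sense of distributions;
  the series below converges absolutely when \<open>\<sigma>\<close> grows at most polynomially.
\<close>

definition fourier_multiplier ::
  "(int ^ 'n \<Rightarrow> complex) \<Rightarrow> ((real ^ 'n \<Rightarrow> complex) \<Rightarrow> complex) \<Rightarrow>
   (real ^ 'n \<Rightarrow> complex) \<Rightarrow> complex" where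
  "fourier_multiplier \<sigma> u =
     (\<lambda>\<phi>\<in>test_funs. \<Sum>\<^sub>\<infinity>m. \<sigma> m * fourier_coeff u m * dist_of (char_fun m) \<phi>)"

text \<open>The operator \<open>(- \<Delta>)\<close> to the power \<open>n / 4\<close>; note that \<open>0 powr a = 0\<close>.\<close>

definition frac_laplacian ::
  "((real ^ 'n \<Rightarrow> complex) \<Rightarrow> complex) \<Rightarrow> (real ^ 'n \<Rightarrow> complex) \<Rightarrow> complex" where
  "frac_laplacian = fourier_multiplier (\<lambda>m. of_real (norm (freq m) powr (real CARD('n) / 2)))"

definition riesz ::
  "'n \<Rightarrow> ((real ^ 'n \<Rightarrow> complex) \<Rightarrow> complex) \<Rightarrow> (real ^ 'n \<Rightarrow> complex) \<Rightarrow> complex" where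
  "riesz j = fourier_multiplier
     (\<lambda>m. if m = 0 then 0 else \<i> * of_real (of_int (m $ j) / norm (freq m)))"


subsection \<open>Function spaces\<close>

definition L1_funs :: "(real ^ 'n \<Rightarrow> complex) set" where
  "L1_funs = {g. torus_periodic g \<and> integrable torus g}"

definition L1_norm :: "(real ^ 'n \<Rightarrow> complex) \<Rightarrow> real" where
  "L1_norm g = (\<integral>x. norm (g x) \<partial>torus)"

definition L2_funs :: "(real ^ 'n \<Rightarrow> complex) set" where
  "L2_funs = {g. torus_periodic g \<and> g \<in> borel_measurable torus \<and>
                 integrable torus (\<lambda>x. (norm (g x))\<^sup>2)}"

definition L2_norm :: "(real ^ 'n \<Rightarrow> complex) \<Rightarrow> real" where
  "L2_norm g = sqrt (\<integral>x. (norm (g x))\<^sup>2 \<partial>torus)"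

definition L2_mean_zero :: "(real ^ 'n \<Rightarrow> complex) set" where
  "L2_mean_zero = {g \<in> L2_funs. (\<integral>x. g x \<partial>torus) = 0}"

text \<open>The homogeneous Sobolev space of order \<open>- n / 2\<close>.\<close>

definition H_neg :: "((real ^ 'n \<Rightarrow> complex) \<Rightarrow> complex) set" where
  "H_neg = {frac_laplacian (dist_of g) | g. g \<in> L2_funs}"

definition H_neg_norm :: "((real ^ 'n \<Rightarrow> complex) \<Rightarrow> complex) \<Rightarrow> real" where
  "H_neg_norm f =
     sqrt (\<Sum>\<^sub>\<infinity>m\<in>- {0}. norm (freq m) powr (- real CARD('n)) * (norm (fourier_coeff f m))\<^sup>2)"

definition L1_plus_H :: "((real ^ 'n \<Rightarrow> complex) \<Rightarrow> complex) set" where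
  "L1_plus_H = {dist_add (dist_of g) f | g f. g \<in> L1_funs \<and> f \<in> H_neg}"

definition L1_plus_H_norm :: "((real ^ 'n \<Rightarrow> complex) \<Rightarrow> complex) \<Rightarrow> real" where
  "L1_plus_H_norm v =
     Inf {L1_norm g + H_neg_norm f | g f. g \<in> L1_funs \<and> f \<in> H_neg \<and> v = dist_add (dist_of g) f}"

end

theory Submission
  imports Defs
begin

text \<open>
  Write \<open>a\<close> for the coefficients of \<open>v = (- \<Delta>)^(n/4) u\<close> and \<open>b\<^sub>j = \<i> m\<^sub>j / |m| a\<close> for those of its Riesz
  transforms. Since the multipliers \<open>m\<^sub>j / |m|\<close> have squares summing to one,
  \<open>\<Sum> |m| S(m) |a|\<^sup>2 = \<i> \<Sum>\<^sub>j \<Sum> m\<^sub>j S(m) a cnj b\<^sub>j\<close> for every weight \<open>S\<close>. Splitting \<open>a\<close> and \<open>b\<^sub>j\<close> into their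
  \<open>L\<^sup>1\<close> and negative Sobolev parts, every term containing a Sobolev part is absorbed by
  Cauchy-Schwarz, while the \<open>L\<^sup>1\<close>-\<open>L\<^sup>1\<close> term is controlled by the sup norm of the kernel with
  coefficients \<open>m\<^sub>j S(m)\<close>. For \<open>S(m)\<close> of size \<open>|m|^(-n-1)\<close> this kernel is odd and homogeneous of degree
  zero, hence bounded, although the even kernel with coefficients \<open>|m|^(-n)\<close> has a logarithmic
  singularity. To get explicit bounds, \<open>S\<close> is a sum over dyadic \<open>t = 2^(-k)\<close> of
  \<open>t^(n+1) (1 - t)^|m|\<^sub>1\<close>, whose kernels are products of one-dimensional Poisson kernels;
  truncating the dyadic sum also supplies the finiteness needed for absorption.
\<close>

subsection \<open>Integration over the torus\<close>

text \<open>The obstacle is that Fourier coefficients of an \<open>L^1\<close> function are merely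
  bounded, so the sum of \<open>|m|^(-n) |a|^2\<close> escapes by a logarithm. The Riesz transforms
  move one factor \<open>m_j\<close> onto the kernel. At scale \<open>t\<close> the kernel is then
  \<open>t^(n+1)\<close> times \<open>n - 1\<close> Poisson kernels, each at most
  \<open>2 / t\<close>, and one derivative of a Poisson kernel in \<open>z_j\<close>. The powers of
  \<open>t\<close> cancel down to \<open>t^2\<close> times this derivative, which vanishes at
  \<open>z_j = 0\<close>; with \<open>s = |sin (z_j / 2)|\<close> the result has size
  \<open>min (t / s) (s / t)\<close>, and its sum over dyadic \<open>t\<close> is bounded uniformly
  in \<open>s\<close>. All frequency sums are also cut to finite boxes, so the quantity to be
  absorbed is a real number from the outset. The box is chosen after the dyadic truncation, because
  the remainder of a cut Poisson sum is not uniformly small in \<open>t\<close>. The estimate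
  produces square-summable coefficients, hence an \<open>L^2\<close> function. Identifying it with
  \<open>u\<close> minus its mean requires that a distribution be determined by its Fourier
  coefficients; the Fejer kernels serve this purpose.\<close>

lemma freq_0 [simp]: "freq 0 = 0"
  by (simp add: freq_def vec_eq_iff)

lemma freq_minus [simp]: "freq (- m) = - freq m"
  by (simp add: freq_def vec_eq_iff)

lemma freq_add: "freq (m + k) = freq m + freq k"
  by (simp add: freq_def vec_eq_iff)

lemma freq_nth [simp]: "freq m $ i = of_int (m $ i)"
  by (simp add: freq_def)

lemma freq_eq_0_iff [simp]: "freq m = 0 \<longleftrightarrow> m = 0"
  by (simp add: freq_def vec_eq_iff)

lemma freq_axis: "freq (axis j k) = of_int k *\<^sub>R axis j 1"
  by (auto simp: freq_def vec_eq_iff axis_def)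

lemma torus_integrable_continuous:
  fixes f :: "real ^ 'n \<Rightarrow> 'b::euclidean_space"
  assumes "continuous_on UNIV f"
  shows "integrable torus f"
  unfolding torus_def by (rule continuous_imp_integrable) (rule continuous_on_subset[OF assms], simp)

lemma torus_integral_eq:
  fixes f :: "real ^ 'n \<Rightarrow> 'b::euclidean_space"
  assumes "continuous_on UNIV f"
  shows "(\<integral>x. f x \<partial>torus) = integral (cbox 0 (\<chi> i. 2 * pi)) f"
  using torus_integrable_continuous[OF assms] unfolding torus_def
  by (rule lebesgue_integral_eq_integral) simp

lemma measure_torus: "measure torus (space (torus :: (real ^ 'n) measure)) = (2 * pi) ^ CARD('n)"
proof -
  have "(0 :: real ^ 'n) \<in> cbox 0 (\<chi> i. 2 * pi)"
    by (simp add: mem_box_cart)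
  hence "cbox 0 (\<chi> i. 2 * pi) \<noteq> ({} :: (real ^ 'n) set)"
    by blast
  hence "measure lborel (cbox 0 (\<chi> i. 2 * pi) :: (real ^ 'n) set) = (2 * pi) ^ CARD('n)"
    by (simp add: content_cbox_cart)
  thus ?thesis
    by (simp add: torus_def measure_restrict_space)
qed

lemma finite_measure_torus: "finite_measure torus"
  unfolding torus_def by (intro finite_measure_lebesgue_on) auto

lemma torus_periodic_axis:
  assumes "torus_periodic h"
  shows "h (x + (2 * pi) *\<^sub>R axis j 1) = h x"
  using assms unfolding torus_periodic_def
  by (metis freq_axis of_int_1 scaleR_one)

text \<open>Cut the shifted cube by the hyperplane where the \<open>j\<close>-th coordinate is
  \<open>2 * pi\<close>, and move the protruding slab back by one period; the two pieces reassemble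
  to the original cube. This gives both the orthogonality of characters and integration by
  parts.\<close>

lemma torus_integral_translate:
  fixes h :: "real ^ 'n \<Rightarrow> complex"
  assumes cont: "continuous_on UNIV h" and per: "torus_periodic h" and s: "0 \<le> s" "s \<le> 2 * pi"
  shows "(\<integral>x. h (x + s *\<^sub>R axis j 1) \<partial>torus) = (\<integral>x. h x \<partial>torus)"
proof -
  define P c p :: "real ^ 'n" where "P = (\<chi> i. 2 * pi)" and "c = s *\<^sub>R axis j 1"
    and "p = (2 * pi) *\<^sub>R axis j 1"
  have B: "axis j 1 \<in> (Basis :: (real ^ 'n) set)"
    by (simp add: axis_in_Basis_iff)
  have int: "h integrable_on cbox a b" for a b
    by (rule integrable_continuous) (rule continuous_on_subset[OF cont], simp)
  have nth: "c $ i = (if i = j then s else 0)" "p $ i = (if i = j then 2 * pi else 0)" "P $ i = 2 * pi" for i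
    by (auto simp: c_def p_def P_def axis_def)
  have in_j: "x \<bullet> axis j 1 = x $ j" for x :: "real ^ 'n"
    by (simp add: inner_axis)
  have "(\<integral>x. h (x + c) \<partial>torus) = integral (cbox 0 P) (\<lambda>x. h (x + c))"
    unfolding P_def
    by (rule torus_integral_eq) (rule continuous_on_compose2[OF cont], auto intro!: continuous_intros)
  also have "\<dots> = integral (cbox c (P + c)) h"
    using integral_shift_cbox[of c c "P + c" h] by simp
  also have "\<dots> = integral (cbox c (P + c) \<inter> {x. x \<bullet> axis j 1 \<le> 2 * pi}) h
                + integral (cbox c (P + c) \<inter> {x. x \<bullet> axis j 1 \<ge> 2 * pi}) h"
    by (rule integral_split[OF int B])
  also have "cbox c (P + c) \<inter> {x. x \<bullet> axis j 1 \<le> 2 * pi} = cbox c P"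
    unfolding in_j using s by (auto simp: mem_box_cart nth; smt (verit))
  also have "cbox c (P + c) \<inter> {x. x \<bullet> axis j 1 \<ge> 2 * pi} = cbox p (P + c)"
    unfolding in_j using s by (auto simp: mem_box_cart nth split: if_splits; smt (verit))
  also have "integral (cbox p (P + c)) h = integral (cbox 0 (P + c - p)) (\<lambda>x. h (x + p))"
    using integral_shift_cbox[of p p "P + c" h] by simp
  also have "(\<lambda>x. h (x + p)) = h"
    unfolding p_def using torus_periodic_axis[OF per] by auto
  also have "integral (cbox c P) h + integral (cbox 0 (P + c - p)) h = integral (cbox 0 P) h"
  proof -
    have "integral (cbox 0 P) h = integral (cbox 0 P \<inter> {x. x \<bullet> axis j 1 \<le> s}) h
                + integral (cbox 0 P \<inter> {x. x \<bullet> axis j 1 \<ge> s}) h"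
      by (rule integral_split[OF int B])
    also have "cbox 0 P \<inter> {x. x \<bullet> axis j 1 \<le> s} = cbox 0 (P + c - p)"
      unfolding in_j using s by (auto simp: mem_box_cart nth split: if_splits; smt (verit))
    also have "cbox 0 P \<inter> {x. x \<bullet> axis j 1 \<ge> s} = cbox c P"
      unfolding in_j using s by (auto simp: mem_box_cart nth split: if_splits; smt (verit))
    finally show ?thesis by simp
  qed
  also have "\<dots> = (\<integral>x. h x \<partial>torus)"
    unfolding P_def by (rule torus_integral_eq[OF cont, symmetric])
  finally show ?thesis by (simp add: c_def)
qed

subsection \<open>Characters\<close>

lemma char_fun_0 [simp]: "char_fun 0 x = 1"
  by (simp add: char_fun_def)

lemma norm_char_fun [simp]: "norm (char_fun m x) = 1"
  by (simp add: char_fun_def)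

lemma char_fun_add: "char_fun (m + k) x = char_fun m x * char_fun k x"
  by (simp add: char_fun_def freq_add inner_add_left cis_mult)

lemma char_fun_cnj: "cnj (char_fun m x) = char_fun (- m) x"
  by (simp add: char_fun_def cis_cnj)

lemma char_fun_add_right: "char_fun m (x + y) = char_fun m x * char_fun m y"
  by (simp add: char_fun_def inner_add_right cis_mult)

lemma char_fun_minus_right: "char_fun m (- x) = char_fun (- m) x"
  by (simp add: char_fun_def)

lemma char_fun_diff_right: "char_fun m (x - y) = char_fun m x * char_fun (- m) y"
  using char_fun_add_right[of m x "- y"] by (simp add: char_fun_minus_right)

lemma char_fun_prod: "char_fun m x = (\<Prod>i\<in>UNIV. cis (of_int (m $ i) * x $ i))"
proof -
  have "(\<Prod>i\<in>A. cis (g i)) = cis (\<Sum>i\<in>A. g i)" if "finite A" for A :: "'a set" and g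
    using that by (induction rule: finite_induct) (auto simp: cis_mult)
  thus ?thesis
    by (simp add: char_fun_def inner_vec_def)
qed

lemma continuous_on_char_fun [continuous_intros]:
  "continuous_on A f \<Longrightarrow> continuous_on A (\<lambda>x. char_fun m (f x))"
  unfolding char_fun_def by (intro continuous_intros)

lemma torus_periodic_char_fun: "torus_periodic (char_fun m)"
  unfolding torus_periodic_def
proof (intro allI)
  fix x and k :: "int ^ 'a"
  have "freq m \<bullet> ((2 * pi) *\<^sub>R freq k) = 2 * pi * of_int (\<Sum>i\<in>UNIV. m $ i * k $ i)"
    by (simp add: inner_vec_def sum_distrib_left mult_ac)
  hence "char_fun m ((2 * pi) *\<^sub>R freq k) = 1"
    unfolding char_fun_def by (metis Ints_of_int cis_multiple_2pi)
  thus "char_fun m (x + (2 * pi) *\<^sub>R freq k) = char_fun m x"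
    by (simp add: char_fun_add_right)
qed

text \<open>If \<open>m $ j\<close> is nonzero, a shift by half a wavelength
  \<open>pi / |m $ j|\<close> along axis \<open>j\<close> changes the sign of the character, while
  translation invariance preserves the integral.\<close>

lemma integral_char_fun:
  "(\<integral>x. char_fun m x \<partial>torus) = (if m = 0 then (2 * pi) ^ CARD('n) else 0)"
  for m :: "int ^ 'n"
proof (cases "m = 0")
  case True
  thus ?thesis by (simp add: measure_torus scaleR_conv_of_real power_mult_distrib)
next
  case False
  then obtain j where j: "m $ j \<noteq> 0"
    by (auto simp: vec_eq_iff)
  define s where "s = pi / \<bar>real_of_int (m $ j)\<bar>"
  have "\<bar>real_of_int (m $ j)\<bar> \<ge> 1"
    using j by (metis of_int_1_le_iff of_int_abs zabs_less_one_iff not_less)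
  hence s: "0 \<le> s" "s \<le> 2 * pi"
    unfolding s_def by (auto simp: field_simps intro: order_trans[of _ "2 * pi * 1"])
  have "real_of_int (m $ j) * s = pi \<or> real_of_int (m $ j) * s = - pi"
    unfolding s_def using j by (auto simp: abs_if)
  hence "cis (real_of_int (m $ j) * s) = - 1"
    by (auto simp: complex_eq_iff)
  hence "char_fun m (s *\<^sub>R axis j 1) = - 1"
    by (simp add: char_fun_def inner_axis mult.commute)
  hence "(\<integral>x. char_fun m (x + s *\<^sub>R axis j 1) \<partial>torus) = - (\<integral>x. char_fun m x \<partial>torus)"
    by (simp add: char_fun_add_right)
  moreover have "(\<integral>x. char_fun m (x + s *\<^sub>R axis j 1) \<partial>torus) = (\<integral>x. char_fun m x \<partial>torus)"
    by (rule torus_integral_translate[OF _ torus_periodic_char_fun s])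
      (intro continuous_intros)
  ultimately show ?thesis using False by simp
qed

subsection \<open>A bounded kernel\<close>

text \<open>Cubes rather than Euclidean balls, so that sums of products over them factor into
  one-dimensional sums.\<close>

definition fbox :: "nat \<Rightarrow> (int ^ 'n) set" where
  "fbox L = {m. \<forall>i. m $ i \<in> {- int L..int L}}"

text \<open>The \<open>l^1\<close> norm is chosen because \<open>r ^ norm1 m\<close> is a product
  over the coordinates of \<open>m\<close>.\<close>

definition norm1 :: "int ^ 'n \<Rightarrow> nat" where
  "norm1 m = (\<Sum>i\<in>UNIV. nat \<bar>m $ i\<bar>)"

text \<open>The finite distributive law, transported from extensional functions to vectors. It
  factors kernels over \<open>fbox\<close> and counts points of cubes.\<close>

lemma prod_sum_vec:
  fixes f :: "'n::finite \<Rightarrow> 'b \<Rightarrow> 'c::comm_semiring_1"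
  assumes "finite A"
  shows "(\<Sum>m | \<forall>i. m $ i \<in> A. \<Prod>i\<in>UNIV. f i (m $ i)) = (\<Prod>i\<in>UNIV. \<Sum>k\<in>A. f i k)"
proof -
  have "(\<Prod>i\<in>UNIV. \<Sum>k\<in>A. f i k) = (\<Sum>g\<in>UNIV \<rightarrow>\<^sub>E A. \<Prod>i\<in>UNIV. f i (g i))"
    by (rule prod_sum_PiE) (use assms in auto)
  also have "\<dots> = (\<Sum>m | \<forall>i. m $ i \<in> A. \<Prod>i\<in>UNIV. f i (m $ i))"
    by (rule sum.reindex_bij_witness[of _ "vec_nth" "vec_lambda"]) auto
  finally show ?thesis ..
qed

lemma finite_vec_set:
  assumes "finite A"
  shows "finite {m :: 'b ^ 'n. \<forall>i. m $ i \<in> A}"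
proof -
  have "{m :: 'b ^ 'n. \<forall>i. m $ i \<in> A} \<subseteq> vec_lambda ` (UNIV \<rightarrow>\<^sub>E A)"
  proof
    fix m :: "'b ^ 'n" assume "m \<in> {m. \<forall>i. m $ i \<in> A}"
    thus "m \<in> vec_lambda ` (UNIV \<rightarrow>\<^sub>E A)"
      by (intro image_eqI[where x = "vec_nth m"]) auto
  qed
  thus ?thesis
    by (rule finite_subset) (use assms in \<open>auto intro!: finite_imageI finite_PiE\<close>)
qed

lemma finite_fbox [simp]: "finite (fbox L :: (int ^ 'n) set)"
  unfolding fbox_def by (rule finite_vec_set) simp

lemma fbox_mono:
  assumes "L \<le> L'"
  shows "fbox L \<subseteq> fbox L'"
proof -
  have "{- int L..int L} \<subseteq> {- int L'..int L'}"
    using assms by auto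
  thus ?thesis
    unfolding fbox_def by blast
qed

lemma norm1_ge: "nat \<bar>m $ i\<bar> \<le> norm1 m"
  unfolding norm1_def by (rule member_le_sum) auto

lemma finite_subset_fbox:
  assumes "finite F"
  obtains L where "F \<subseteq> fbox L"
proof
  show "F \<subseteq> fbox (Max (insert 0 (norm1 ` F)))"
  proof
    fix m assume "m \<in> F"
    hence "norm1 m \<le> Max (insert 0 (norm1 ` F))"
      using assms by (intro Max_ge) auto
    hence "nat \<bar>m $ i\<bar> \<le> Max (insert 0 (norm1 ` F))" for i
      using norm1_ge order_trans by blast
    hence "\<bar>m $ i\<bar> \<le> int (Max (insert 0 (norm1 ` F)))" for i
      by (simp add: nat_le_iff)
    thus "m \<in> fbox (Max (insert 0 (norm1 ` F)))"
      unfolding fbox_def atLeastAtMost_iff mem_Collect_eq by (smt (verit))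
  qed
qed

section \<open>One-dimensional Poisson sums and their derivatives\<close>

lemma sum_symmetric_interval:
  fixes f :: "int \<Rightarrow> 'a::comm_monoid_add"
  shows "(\<Sum>k\<in>{- int L..int L}. f k) = f 0 + (\<Sum>k=1..L. f (int k) + f (- int k))"
proof (induction L)
  case (Suc L)
  have "{- int (Suc L)..int (Suc L)} = insert (int (Suc L)) (insert (- int (Suc L)) {- int L..int L})"
    by auto
  thus ?case
    using Suc by (simp add: add_ac)
qed simp

text \<open>No oscillation is used: the truncated Poisson kernel is dominated by its value at
  \<open>x = 0\<close>, a geometric sum bounded independently of \<open>L\<close>.\<close>

lemma poisson_sum_bound:
  assumes "0 \<le> r" "r < 1"
  shows "norm (\<Sum>k\<in>{- int L..int L}. of_real (r ^ nat \<bar>k\<bar>) * cis (of_int k * x)) \<le> 2 / (1 - r)"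
proof -
  have "norm (\<Sum>k\<in>{- int L..int L}. of_real (r ^ nat \<bar>k\<bar>) * cis (of_int k * x)) \<le> (\<Sum>k\<in>{- int L..int L}. r ^ nat \<bar>k\<bar>)"
    using assms by (intro order_trans[OF norm_sum] sum_mono) (simp add: norm_mult norm_power)
  also have "\<dots> = 1 + 2 * (\<Sum>k=1..L. r ^ k)"
    by (simp add: sum_symmetric_interval sum_distrib_left)
  also have "\<dots> \<le> 2 * (1 + (\<Sum>k=1..L. r ^ k))"
    by simp
  also have "1 + (\<Sum>k=1..L. r ^ k) = (\<Sum>k<Suc L. r ^ k)"
    by (subst sum.lessThan_Suc_shift) (simp add: sum.atLeast1_atMost_eq)
  also have "\<dots> \<le> 1 / (1 - r)"
    using assms by (subst sum_gp_strict) (auto intro!: divide_right_mono)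
  finally show ?thesis by simp
qed

text \<open>The differentiated finite geometric sum, cleared of denominators so that induction
  applies in any commutative ring. The last two terms are the truncation remainder.\<close>

lemma sum_of_nat_power:
  fixes w :: "'a::comm_ring_1"
  shows "(1 - w) ^ 2 * (\<Sum>k=1..L. of_nat k * w ^ k) = w - of_nat (L + 1) * w ^ (L + 1) + of_nat L * w ^ (L + 2)"
  by (induction L) (simp_all add: algebra_simps power2_eq_square)

lemma norm_one_minus_cis_sq:
  "(norm (1 - of_real r * cis x)) ^ 2 = (1 - r) ^ 2 + 4 * r * sin (x / 2) ^ 2"
proof -
  have cos: "cos x = 1 - 2 * sin (x / 2) ^ 2"
    using cos_double_sin[of "x / 2"] by simp
  have "(norm (1 - of_real r * cis x)) ^ 2 = 1 - 2 * r * cos x + r ^ 2 * (cos x ^ 2 + sin x ^ 2)"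
    unfolding cmod_power2 by (simp add: power2_eq_square algebra_simps del: sin_cos_squared_add sin_cos_squared_add2 sin_cos_squared_add3)
  hence "(norm (1 - of_real r * cis x)) ^ 2 = 1 - 2 * r * cos x + r ^ 2"
    by simp
  thus ?thesis
    unfolding cos by (simp add: power2_eq_square algebra_simps)
qed

text \<open>\<open>w / (1 - w) ^ 2\<close> is the sum of all \<open>k * w ^ k\<close>, so its
  imaginary part is \<open>- 1 / 2\<close> times the derivative of the Poisson kernel
  \<open>(1 - r ^ 2) / |1 - w| ^ 2\<close>. The factor \<open>sin x\<close> carries the cancellation
  at the origin.\<close>

lemma Im_conjugate_poisson:
  "Im (of_real r * cis x / (1 - of_real r * cis x) ^ 2)
     = r * (1 - r ^ 2) * sin x / (norm (1 - of_real r * cis x)) ^ 4"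
proof -
  define w where "w = of_real r * cis x"
  have "b / a ^ 2 = b * cnj a ^ 2 / of_real (norm a ^ 4)" for a b :: complex
  proof (cases "a = 0")
    case False
    have "of_real (norm a ^ 4) = (a * cnj a) ^ 2"
      by (simp add: complex_norm_square[symmetric])
    thus ?thesis using False by (simp add: power_mult_distrib)
  qed simp
  hence "w / (1 - w) ^ 2 = w * cnj (1 - w) ^ 2 / of_real (norm (1 - w) ^ 4)" .
  moreover have "Im (w * cnj (1 - w) ^ 2) = r * (1 - r ^ 2 * (cos x ^ 2 + sin x ^ 2)) * sin x"
    unfolding w_def
    by (simp add: power2_eq_square algebra_simps del: sin_cos_squared_add sin_cos_squared_add2 sin_cos_squared_add3)
  ultimately show ?thesis
    by (simp add: w_def Im_divide_of_real del: of_real_power)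
qed

text \<open>With \<open>s = |sin (x / 2)|\<close> the numerator is at most \<open>4 * t * s\<close>,
  and \<open>D = |1 - w| ^ 2\<close> dominates both \<open>t ^ 2\<close> and \<open>s ^ 2\<close>.
  Bounding \<open>D ^ 2\<close> below by \<open>t ^ 4\<close> gives the estimate near the origin,
  and by \<open>t ^ 2 * s ^ 2\<close> the one away from it.\<close>

lemma Im_conjugate_poisson_bound:
  assumes t: "0 < t" "t \<le> 1 / 2" and "sin (x / 2) \<noteq> 0"
  defines "w \<equiv> of_real (1 - t) * cis x"
  shows "t ^ 2 * \<bar>Im (w / (1 - w) ^ 2)\<bar> \<le> 4 * min (t / \<bar>sin (x / 2)\<bar>) (\<bar>sin (x / 2)\<bar> / t)"
proof -
  define s where "s = \<bar>sin (x / 2)\<bar>"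
  have s: "s > 0" using assms by (simp add: s_def)
  define D where "D = norm (1 - w) ^ 2"
  \<comment> \<open>The half-angle formula contributes \<open>4 * (1 - t) * s ^ 2\<close>, and
    \<open>t \<le> 1 / 2\<close> makes the factor \<open>4 * (1 - t)\<close> at least one.\<close>
  have D: "D \<ge> t ^ 2 + s ^ 2"
  proof -
    have "1 * s ^ 2 \<le> (4 * (1 - t)) * s ^ 2"
      using t by (intro mult_right_mono) auto
    thus ?thesis
      unfolding D_def w_def norm_one_minus_cis_sq by (simp add: s_def)
  qed
  have D0: "D > 0" using D s by (smt (verit) zero_less_power zero_le_power2)
  have sin: "\<bar>sin x\<bar> \<le> 2 * s"
    using sin_double[of "x / 2"] by (simp add: abs_mult s_def mult_left_le)
  have "\<bar>Im (w / (1 - w) ^ 2)\<bar> = (1 - t) * (1 - (1 - t) ^ 2) * \<bar>sin x\<bar> / D ^ 2"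
  proof -
    have "(1 - t) ^ 2 \<le> 1" using t by (simp add: power_le_one)
    moreover have "norm (1 - w) ^ 4 = D ^ 2" by (simp add: D_def)
    ultimately show ?thesis
      unfolding w_def Im_conjugate_poisson using t by (simp add: abs_mult)
  qed
  also have "\<dots> \<le> 1 * (2 * t) * (2 * s) / D ^ 2"
    using t s sin
    by (intro divide_right_mono mult_mono mult_nonneg_nonneg)
       (auto simp: power2_eq_square algebra_simps power_le_one)
  finally have main: "\<bar>Im (w / (1 - w) ^ 2)\<bar> \<le> 4 * t * s / D ^ 2" by simp
  have 1: "t ^ 2 * (4 * t * s / D ^ 2) \<le> 4 * (s / t)"
  proof -
    have "t ^ 2 * t ^ 2 \<le> D * D"
      using D D0 by (intro mult_mono) (auto intro: order_trans[of _ "t^2 + s^2"])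
    hence "(4 * s) * (t ^ 2 * t ^ 2) \<le> (4 * s) * (D * D)"
      using s by (intro mult_left_mono) auto
    thus ?thesis
      using t D0 by (simp add: field_simps power2_eq_square)
  qed
  have 2: "t ^ 2 * (4 * t * s / D ^ 2) \<le> 4 * (t / s)"
  proof -
    have "t ^ 2 * s ^ 2 \<le> D * D"
      using D D0 by (intro mult_mono) (auto intro: order_trans[of _ "t^2 + s^2"])
    hence "(4 * t) * (t ^ 2 * s ^ 2) \<le> (4 * t) * (D * D)"
      using t by (intro mult_left_mono) auto
    thus ?thesis
      using s D0 by (simp add: field_simps power2_eq_square)
  qed
  have "t ^ 2 * \<bar>Im (w / (1 - w) ^ 2)\<bar> \<le> t ^ 2 * (4 * t * s / D ^ 2)"
    using main by (intro mult_left_mono) auto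
  thus ?thesis using 1 2 by (simp add: s_def min_def)
qed

text \<open>Pairing \<open>k\<close> with \<open>- k\<close> gives \<open>S - cnj S\<close>, that is
  \<open>2 * \<i> * Im S\<close>, where \<open>S\<close> is a partial sum of the series for
  \<open>w / (1 - w) ^ 2\<close>. The remainder vanishes as \<open>L\<close> grows for fixed
  \<open>r\<close>, but not uniformly as \<open>r\<close> tends to one.\<close>

lemma conjugate_poisson_sum_bound:
  assumes r: "0 \<le> r" "r < 1"
  defines "w x \<equiv> of_real r * cis x"
  shows "norm (\<Sum>k\<in>{- int L..int L}. of_int k * of_real (r ^ nat \<bar>k\<bar>) * cis (of_int k * x))
           \<le> 2 * \<bar>Im (w x / (1 - w x) ^ 2)\<bar> + 4 * (real L + 1) * r ^ L / (1 - r) ^ 2"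
proof -
  have Im_diff: "2 * \<bar>Im (a - b)\<bar> \<le> 2 * \<bar>Im a\<bar> + 2 * norm b" for a b
  proof -
    have "\<bar>Im a - Im b\<bar> \<le> \<bar>Im a\<bar> + norm b"
      by (rule order_trans[OF abs_triangle_ineq4 add_left_mono[OF abs_Im_le_cmod]])
    thus ?thesis by simp
  qed
  define S where "S = (\<Sum>k=1..L. of_nat k * w x ^ k)"
  have nw: "norm (w x) = r" using r by (simp add: w_def norm_mult)
  have nw1: "1 - r \<le> norm (1 - w x)"
    using norm_triangle_ineq2[of 1 "w x"] nw by simp
  have pw: "w x ^ k = of_real (r ^ k) * cis (of_nat k * x)" for k
    unfolding w_def power_mult_distrib Complex.DeMoivre by simp
  have "(\<Sum>k\<in>{- int L..int L}. of_int k * of_real (r ^ nat \<bar>k\<bar>) * cis (of_int k * x)) = S - cnj S"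
    unfolding sum_symmetric_interval S_def pw
    by (simp add: sum_subtractf[symmetric] cis_cnj sum_negf[symmetric] algebra_simps)
  hence "norm (\<Sum>k\<in>{- int L..int L}. of_int k * of_real (r ^ nat \<bar>k\<bar>) * cis (of_int k * x)) = 2 * \<bar>Im S\<bar>"
    by (simp add: complex_diff_cnj norm_mult)
  also have "S = w x / (1 - w x) ^ 2 - (of_nat (L + 1) * w x ^ (L + 1) - of_nat L * w x ^ (L + 2)) / (1 - w x) ^ 2"
  proof -
    have "1 - w x \<noteq> 0" using nw1 r by auto
    thus ?thesis
      using sum_of_nat_power[of "w x" L] unfolding S_def by (simp add: field_simps)
  qed
  also have "2 * \<bar>Im (w x / (1 - w x) ^ 2 - (of_nat (L + 1) * w x ^ (L + 1) - of_nat L * w x ^ (L + 2)) / (1 - w x) ^ 2)\<bar>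
     \<le> 2 * \<bar>Im (w x / (1 - w x) ^ 2)\<bar> + 2 * norm ((of_nat (L + 1) * w x ^ (L + 1) - of_nat L * w x ^ (L + 2)) / (1 - w x) ^ 2)"
    by (rule Im_diff)
  also have "norm ((of_nat (L + 1) * w x ^ (L + 1) - of_nat L * w x ^ (L + 2)) / (1 - w x) ^ 2)
     \<le> (2 * (real L + 1) * r ^ L) / (1 - r) ^ 2"
    unfolding norm_divide
  proof (rule frac_le)
    have "norm (of_nat (L + 1) * w x ^ (L + 1) - of_nat L * w x ^ (L + 2)) \<le> real (L + 1) * r ^ (L + 1) + real L * r ^ (L + 2)"
      by (rule order_trans[OF norm_triangle_ineq4]) (simp only: norm_mult norm_power nw norm_of_nat order_refl)
    also have "\<dots> \<le> real (L + 1) * r ^ L + real (L + 1) * r ^ L"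
      using r by (intro add_mono mult_mono power_decreasing) auto
    finally show "norm (of_nat (L + 1) * w x ^ (L + 1) - of_nat L * w x ^ (L + 2)) \<le> 2 * (real L + 1) * r ^ L"
      by (simp add: algebra_simps)
    show "(1 - r) ^ 2 \<le> norm ((1 - w x) ^ 2)"
      unfolding norm_power using nw1 r by (intro power_mono) auto
  qed (use r in auto)
  finally show ?thesis by (simp add: algebra_simps add_divide_distrib)
qed

text \<open>Telescoping: \<open>min y (1/y)\<close> is dominated by \<open>6 * (\<Phi> (2 * y) - \<Phi> y)\<close> for \<open>\<Phi> y = y / (1 + y)\<close>.\<close>

lemma sum_min_dyadic_le:
  fixes c :: real
  assumes c: "c > 0"
  shows "(\<Sum>k=1..K. min (c / 2 ^ k) (2 ^ k / c)) \<le> 6"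
proof -
  define \<Phi> :: "real \<Rightarrow> real" where "\<Phi> y = y / (1 + y)" for y
  have step: "min y (1 / y) \<le> 6 * (\<Phi> (2 * y) - \<Phi> y)" if "y > 0" for y
  proof -
    have eq: "\<Phi> (2 * y) - \<Phi> y = y / ((1 + 2 * y) * (1 + y))"
      using that by (simp add: \<Phi>_def field_simps)
    show ?thesis
    proof (cases "y \<le> 1")
      case True
      have "(1 + 2 * y) * (1 + y) \<le> 3 * 2"
        using True that by (intro mult_mono) auto
      hence "y * ((1 + 2 * y) * (1 + y)) \<le> y * 6"
        using that by (intro mult_left_mono) auto
      hence "y \<le> 6 * (y / ((1 + 2 * y) * (1 + y)))"
        using that by (simp add: pos_le_divide_eq)
      thus ?thesis unfolding eq by linarith
    next
      case False
      have "(1 + 2 * y) * (1 + y) \<le> (3 * y) * (2 * y)"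
        using False by (intro mult_mono) auto
      hence "1 / y \<le> 6 * (y / ((1 + 2 * y) * (1 + y)))"
        using that by (simp add: pos_le_divide_eq pos_divide_le_eq mult_ac)
      thus ?thesis unfolding eq by linarith
    qed
  qed
  have "(\<Sum>k=1..K. min (c / 2 ^ k) (2 ^ k / c)) \<le> (\<Sum>k=1..K. 6 * (\<Phi> (c / 2 ^ (k - 1)) - \<Phi> (c / 2 ^ k)))"
  proof (rule sum_mono)
    fix k assume "k \<in> {1..K}"
    hence "2 * (c / 2 ^ k) = c / 2 ^ (k - 1)"
      by (cases k) auto
    thus "min (c / 2 ^ k) (2 ^ k / c) \<le> 6 * (\<Phi> (c / 2 ^ (k - 1)) - \<Phi> (c / 2 ^ k))"
      using step[of "c / 2 ^ k"] c by simp
  qed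
  also have "\<dots> = 6 * (\<Phi> c - \<Phi> (c / 2 ^ K))"
    by (induction K) (auto simp: algebra_simps)
  also have "\<dots> \<le> 6"
  proof -
    have "\<Phi> c \<le> 1" "\<Phi> (c / 2 ^ K) \<ge> 0"
      using c by (auto simp: \<Phi>_def field_simps)
    thus ?thesis by simp
  qed
  finally show ?thesis .
qed


text \<open>A dyadic Riemann sum for the Beta integral of \<open>t ^ n * (1 - t) ^ N\<close> over
  the unit interval, with \<open>n\<close> the dimension and \<open>N = norm1 m\<close>; that
  integral behaves like \<open>N ^ (- n - 1)\<close>. Starting at \<open>k = 1\<close> keeps every
  \<open>t\<close> at most \<open>1 / 2\<close>.\<close>

definition dyadic_weight :: "nat \<Rightarrow> int ^ 'n \<Rightarrow> real" where
  "dyadic_weight K m = (\<Sum>k=1..K. (1 / 2 ^ k) ^ (CARD('n) + 1) * (1 - 1 / 2 ^ k) ^ norm1 m)"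

lemma dyadic_weight_nonneg: "dyadic_weight K m \<ge> 0"
  unfolding dyadic_weight_def by (intro sum_nonneg mult_nonneg_nonneg zero_le_power) auto

lemma real_norm1: "real (norm1 m) = (\<Sum>i\<in>UNIV. \<bar>freq m $ i\<bar>)"
  by (simp add: norm1_def)

lemma norm_freq_le_norm1: "norm (freq m) \<le> real (norm1 m)"
  unfolding real_norm1 by (rule norm_le_l1_cart)

lemma norm1_le_norm_freq: "real (norm1 m) \<le> real CARD('n) * norm (freq m)" for m :: "int ^ 'n"
  unfolding real_norm1 using sum_bounded_above[of UNIV "\<lambda>i. \<bar>freq m $ i\<bar>" "norm (freq m)"]
  by (simp add: component_le_norm_cart del: freq_nth)

lemma norm1_pos: "m \<noteq> 0 \<Longrightarrow> norm1 m \<ge> 1"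
  using norm_freq_le_norm1[of m] by (cases "norm1 m") auto

text \<open>A single term of the exponential series, all of whose terms are nonnegative.\<close>

lemma power_le_fact_exp:
  fixes y :: real
  assumes "y \<ge> 0"
  shows "y ^ p \<le> fact p * exp y"
proof -
  have "(\<Sum>i\<in>{p}. y ^ i /\<^sub>R fact i) \<le> (\<Sum>i. y ^ i /\<^sub>R fact i)"
    by (rule sum_le_suminf) (use assms summable_exp_generic[of y] in auto)
  thus ?thesis
    unfolding exp_def by (simp add: field_simps)
qed

text \<open>In the variable \<open>y = M * t\<close>, with \<open>M = norm1 m\<close>, a rescaled
  summand is at most \<open>y ^ (n + 1) * exp (- y)\<close>. Comparing with the exponential-series
  terms of order \<open>n + 2\<close> and \<open>n\<close> gives decay like \<open>1 / y\<close> and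
  like \<open>y\<close> respectively, so the dyadic sum is bounded independently of \<open>M\<close>
  and \<open>K\<close>.\<close>

lemma dyadic_weight_upper:
  fixes m :: "int ^ 'n"
  assumes "m \<noteq> 0"
  shows "norm (freq m) ^ (CARD('n) + 1) * dyadic_weight K m \<le> 6 * fact (CARD('n) + 2)"
proof -
  let ?n = "CARD('n)"
  define M where "M = real (norm1 m)"
  have M: "M \<ge> 1" using norm1_pos[OF assms] by (simp add: M_def)
  have summand: "M ^ (?n + 1) * ((1 / 2 ^ k) ^ (?n + 1) * (1 - 1 / 2 ^ k) ^ norm1 m)
      \<le> fact (?n + 2) * min (M / 2 ^ k) (2 ^ k / M)" for k
  proof -
    define t :: real where "t = 1 / 2 ^ k"
    define y where "y = M * t"
    have t: "0 < t" "t \<le> 1" by (auto simp: t_def)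
    have y: "y > 0" using t M by (simp add: y_def)
    have "(1 - t) ^ norm1 m \<le> exp (- t) ^ norm1 m"
      using t exp_ge_add_one_self[of "- t"] by (intro power_mono) auto
    also have "\<dots> = exp (- y)"
      by (simp add: y_def M_def exp_of_nat_mult[symmetric])
    finally have e: "(1 - t) ^ norm1 m \<le> exp (- y)" .
    have "M ^ (?n + 1) * (t ^ (?n + 1) * (1 - t) ^ norm1 m) = y ^ (?n + 1) * (1 - t) ^ norm1 m"
      by (simp add: y_def power_mult_distrib)
    also have "\<dots> \<le> y ^ (?n + 1) * exp (- y)"
      using e y by (intro mult_left_mono) auto
    also have "\<dots> \<le> fact (?n + 2) * min y (1 / y)"
    proof -
      have "y ^ (?n + 2) * exp (- y) \<le> fact (?n + 2)"
        using power_le_fact_exp[of y "?n + 2"] y by (simp add: exp_minus field_simps)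
      hence 1: "y ^ (?n + 1) * exp (- y) \<le> fact (?n + 2) * (1 / y)"
        using y by (simp add: field_simps)
      have "y ^ ?n * exp (- y) \<le> fact ?n"
        using power_le_fact_exp[of y ?n] y by (simp add: exp_minus field_simps)
      also have "(fact ?n :: real) \<le> fact (?n + 2)"
        by (rule fact_mono) simp
      finally have "y * (y ^ ?n * exp (- y)) \<le> y * fact (?n + 2)"
        using y by (intro mult_left_mono) auto
      hence 2: "y ^ (?n + 1) * exp (- y) \<le> fact (?n + 2) * y"
        by (simp add: mult_ac)
      show ?thesis using 1 2 by (simp add: min_def)
    qed
    finally show ?thesis by (simp add: t_def y_def)
  qed
  have "norm (freq m) ^ (?n + 1) * dyadic_weight K m \<le> M ^ (?n + 1) * dyadic_weight K m"
    using norm_freq_le_norm1[of m] unfolding M_def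
    by (intro mult_right_mono power_mono dyadic_weight_nonneg) auto
  also have "\<dots> \<le> (\<Sum>k=1..K. fact (?n + 2) * min (M / 2 ^ k) (2 ^ k / M))"
    unfolding dyadic_weight_def sum_distrib_left by (rule sum_mono) (rule summand)
  also have "\<dots> = fact (?n + 2) * (\<Sum>k=1..K. min (M / 2 ^ k) (2 ^ k / M))"
    by (simp add: sum_distrib_left)
  also have "\<dots> \<le> fact (?n + 2) * 6"
    using M by (intro mult_left_mono sum_min_dyadic_le) auto
  finally show ?thesis by simp
qed

text \<open>One scale suffices: take \<open>t = 1 / 2 ^ k\<close> with
  \<open>2 * M \<le> 2 ^ k \<le> 4 * M\<close>. Bernoulli's inequality then keeps
  \<open>(1 - t) ^ M\<close> above \<open>1 / 2\<close>. In the constant, \<open>2\<close> comes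
  from Bernoulli, \<open>4\<close> from the size of \<open>t\<close>, and \<open>CARD('n)\<close>
  from comparing \<open>norm1\<close> with the Euclidean norm.\<close>

lemma dyadic_weight_lower:
  fixes m :: "int ^ 'n"
  assumes "m \<noteq> 0" and K: "K \<ge> 4 * norm1 m"
  shows "norm (freq m) ^ (CARD('n) + 1) * dyadic_weight K m \<ge> 1 / (2 * (4 * CARD('n)) ^ (CARD('n) + 1))"
proof -
  let ?n = "CARD('n)"
  define M where "M = norm1 m"
  have M: "M \<ge> 1" using norm1_pos[OF assms(1)] by (simp add: M_def)
  obtain k where k: "2 * M \<le> 2 ^ k" "2 ^ k \<le> 4 * M"
  proof -
    define k where "k = (LEAST k. 2 * M \<le> 2 ^ k)"
    have "2 * M \<le> 2 ^ (2 * M)" by (simp add: less_imp_le)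
    hence 1: "2 * M \<le> 2 ^ k" unfolding k_def by (rule LeastI)
    then obtain k' where k': "k = Suc k'" using M by (cases k) auto
    have "\<not> 2 * M \<le> 2 ^ k'"
      using not_less_Least[of k' "\<lambda>k. 2 * M \<le> 2 ^ k"] k' unfolding k_def[symmetric] by simp
    hence "2 ^ k \<le> 4 * M" unfolding k' by simp
    with 1 show ?thesis by (rule that)
  qed
  define t :: real where "t = 1 / 2 ^ k"
  \<comment> \<open>The hypothesis on \<open>K\<close> enters only here: it guarantees that the
    chosen scale survives the truncation, through
    \<open>k < 2 ^ k \<le> 4 * M \<le> K\<close>.\<close>
  have "k < 2 ^ k" by simp
  also have "\<dots> \<le> K" using k K by (simp add: M_def)
  finally have kK: "k \<in> {1..K}" using k M by (cases k) auto
  have k': "2 * real M \<le> 2 ^ k" "2 ^ k \<le> 4 * real M"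
    using k by (metis of_nat_le_iff of_nat_mult of_nat_numeral of_nat_power)+
  have tM: "t * real M \<le> 1 / 2" "t \<ge> 1 / (4 * real M)"
    using k' M by (auto simp: t_def field_simps)
  have "1 / 2 \<le> 1 + real M * (- t)"
    using tM by (simp add: mult.commute)
  also have "\<dots> \<le> (1 - t) ^ M"
    using Bernoulli_inequality[of "- t" M] by (simp add: t_def)
  finally have half: "(1 - t) ^ M \<ge> 1 / 2" .
  have "(1 / (4 * real M)) ^ (?n + 1) * (1 / 2) \<le> t ^ (?n + 1) * (1 - t) ^ M"
    using tM half by (intro mult_mono power_mono) (auto simp: t_def)
  also have "\<dots> \<le> dyadic_weight K m"
    unfolding dyadic_weight_def t_def M_def
    by (rule member_le_sum[OF kK]) (auto intro!: mult_nonneg_nonneg)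
  finally have w: "(1 / (4 * real M)) ^ (?n + 1) * (1 / 2) \<le> dyadic_weight K m" .
  have N: "norm (freq m) > 0" using assms by simp
  have "1 / (2 * (4 * real ?n) ^ (?n + 1)) = norm (freq m) ^ (?n + 1) * ((1 / (4 * (real ?n * norm (freq m)))) ^ (?n + 1) * (1 / 2))"
    using N by (simp add: power_divide power_mult_distrib)
  also have "\<dots> \<le> norm (freq m) ^ (?n + 1) * ((1 / (4 * real M)) ^ (?n + 1) * (1 / 2))"
    using norm1_le_norm_freq[of m] M N unfolding M_def
    by (intro mult_left_mono mult_right_mono power_mono divide_left_mono) auto
  also have "\<dots> \<le> norm (freq m) ^ (?n + 1) * dyadic_weight K m"
    using w by (intro mult_left_mono) auto
  finally show ?thesis by simp
qed

text \<open>The order of the quantifiers matters: \<open>B\<close> is uniform in the dyadic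
  truncation \<open>K\<close>, whereas the box size \<open>L0\<close> may depend on it. In the
  constant, each of the \<open>n - 1\<close> Poisson factors gives a \<open>2\<close>, and
  \<open>54 = 8 * 6 + 6\<close> collects the dyadic sum of the derivative factor and that of the
  truncation error.\<close>

lemma kernel_bounded:
  "\<exists>B\<ge>0. \<forall>(j :: 'n) K. \<exists>L0. \<forall>L\<ge>L0. \<forall>z.
     norm (\<Sum>m\<in>fbox L. of_real (of_int (m $ j) * dyadic_weight K m) * char_fun m (z :: real ^ 'n)) \<le> B"
proof (rule exI[of _ "2 ^ (CARD('n) - 1) * 54"], intro conjI allI)
  let ?n = "CARD('n)"
  show "0 \<le> (2 :: real) ^ (?n - 1) * 54" by simp
  fix j :: 'n and K :: nat
  \<comment> \<open>\<open>E k L\<close> is the remainder of cutting the \<open>j\<close>-th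
    one-dimensional sum at scale \<open>2 ^ (- k)\<close>. Only finitely many scales occur, so one
    \<open>L0\<close> makes all remainders less than one.\<close>
  define E :: "nat \<Rightarrow> nat \<Rightarrow> real" where
    "E k L = 4 * (real L + 1) * (1 - 1 / 2 ^ k) ^ L / (1 / 2 ^ k) ^ 2" for k L
  have lim: "E k \<longlonglongrightarrow> 0" for k
  proof -
    have r: "norm (1 - 1 / 2 ^ k :: real) < 1"
    proof -
      have "(1 :: real) \<le> 2 ^ k" by simp
      hence "0 < (1 / 2 ^ k :: real)" "(1 / 2 ^ k :: real) \<le> 1" by (auto simp: field_simps)
      thus ?thesis unfolding real_norm_def by linarith
    qed
    have "(\<lambda>L. 4 * (real L * (1 - 1 / 2 ^ k) ^ L + (1 - 1 / 2 ^ k) ^ L) / (1 / 2 ^ k) ^ 2) \<longlonglongrightarrow> 4 * (0 + 0) / (1 / 2 ^ k) ^ 2"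
      using r by (intro tendsto_intros powser_times_n_limit_0 LIMSEQ_power_zero) auto
    thus ?thesis unfolding E_def by (simp add: algebra_simps)
  qed
  have "eventually (\<lambda>L. \<forall>k\<in>{1..K}. E k L < 1) sequentially"
    using lim by (intro eventually_ball_finite ballI order_tendstoD) auto
  then obtain L0 where L0: "\<And>L k. L \<ge> L0 \<Longrightarrow> k \<in> {1..K} \<Longrightarrow> E k L < 1"
    unfolding eventually_sequentially by blast
  have "norm (\<Sum>m\<in>fbox L. of_real (of_int (m $ j) * dyadic_weight K m) * char_fun m z) \<le> 2 ^ (?n - 1) * 54"
    if L: "L \<ge> L0" for L and z :: "real ^ 'n"
  proof -
    define a where "a k i l = (if i = j then of_int l else 1) * of_real ((1 - 1 / 2 ^ k) ^ nat \<bar>l\<bar>) * cis (of_int l * z $ i)"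
      for k :: nat and i l
    have a_prod: "of_int (m $ j) * of_real ((1 - 1 / 2 ^ k) ^ norm1 m) * char_fun m z = (\<Prod>i\<in>UNIV. a k i (m $ i))" for k m
    proof -
      have "(\<Prod>i\<in>UNIV. a k i (m $ i)) = (\<Prod>i\<in>UNIV. if i = j then of_int (m $ i) else 1)
          * of_real (\<Prod>i\<in>UNIV. (1 - 1 / 2 ^ k) ^ nat \<bar>m $ i\<bar>) * (\<Prod>i\<in>UNIV. cis (of_int (m $ i) * z $ i))"
        unfolding a_def prod.distrib by simp
      also have "(\<Prod>i\<in>UNIV. if i = j then of_int (m $ i) else 1) = of_int (m $ j)"
        by simp
      also have "(\<Prod>i\<in>UNIV. (1 - 1 / 2 ^ k) ^ nat \<bar>m $ i\<bar>) = (1 - 1 / 2 ^ k) ^ norm1 m"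
        unfolding norm1_def by (simp add: power_sum)
      finally show ?thesis by (simp add: char_fun_prod)
    qed
    have "(\<Sum>m\<in>fbox L. of_real (of_int (m $ j) * dyadic_weight K m) * char_fun m z)
        = (\<Sum>m\<in>fbox L. \<Sum>k=1..K. of_real ((1 / 2 ^ k) ^ (?n + 1)) * (\<Prod>i\<in>UNIV. a k i (m $ i)))"
      unfolding a_prod[symmetric] dyadic_weight_def
      by (intro sum.cong refl) (simp add: sum_distrib_left sum_distrib_right mult_ac)
    also have "\<dots> = (\<Sum>k=1..K. of_real ((1 / 2 ^ k) ^ (?n + 1)) * (\<Sum>m\<in>fbox L. \<Prod>i\<in>UNIV. a k i (m $ i)))"
      by (subst sum.swap) (simp add: sum_distrib_left)
    also have "\<dots> = (\<Sum>k=1..K. of_real ((1 / 2 ^ k) ^ (?n + 1)) * (\<Prod>i\<in>UNIV. \<Sum>l\<in>{- int L..int L}. a k i l))"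
      unfolding fbox_def by (subst prod_sum_vec) simp_all
    finally have eq: "(\<Sum>m\<in>fbox L. of_real (of_int (m $ j) * dyadic_weight K m) * char_fun m z) = \<dots>" .
    \<comment> \<open>When the sine vanishes the derivative term is zero, and any positive value
      would serve; \<open>1\<close> is a dummy that keeps \<open>c > 0\<close>.\<close>
    define c where "c = (if sin (z $ j / 2) = 0 then 1 else 1 / \<bar>sin (z $ j / 2)\<bar>)"
    have c: "c > 0" by (simp add: c_def)
    have bound: "norm (of_real ((1 / 2 ^ k) ^ (?n + 1)) * (\<Prod>i\<in>UNIV. \<Sum>l\<in>{- int L..int L}. a k i l))
        \<le> 2 ^ (?n - 1) * (8 * min (c / 2 ^ k) (2 ^ k / c) + min (1 / 2 ^ k) (2 ^ k / 1))" if k: "k \<in> {1..K}" for k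
    proof -
      define t :: real where "t = 1 / 2 ^ k"
      have "(2 :: real) ^ 1 \<le> 2 ^ k" using k by (intro power_increasing) auto
      hence t: "0 < t" "t \<le> 1 / 2" by (auto simp: t_def field_simps)
      define I where "I = \<bar>Im (of_real (1 - t) * cis (z $ j) / (1 - of_real (1 - t) * cis (z $ j)) ^ 2)\<bar>"
      have I: "t ^ 2 * I \<le> 4 * min (c / 2 ^ k) (2 ^ k / c)"
      proof (cases "sin (z $ j / 2) = 0")
        case True
        hence "sin (z $ j) = 0" using sin_double[of "z $ j / 2"] by simp
        hence "I = 0" unfolding I_def Im_conjugate_poisson by simp
        thus ?thesis using c by simp
      next
        case False
        show ?thesis
          using Im_conjugate_poisson_bound[OF t False] False unfolding I_def c_def t_def
          by (simp add: mult.commute divide_simps)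
      qed
      have "norm (\<Sum>l\<in>{- int L..int L}. a k j l) \<le> 2 * I + E k L"
        using conjugate_poisson_sum_bound[of "1 - t" "z $ j" L] t
        unfolding a_def I_def E_def t_def[symmetric] by simp
      hence nj: "norm (\<Sum>l\<in>{- int L..int L}. a k j l) \<le> 2 * I + 1"
        using L0[OF L k] by simp
      have ni: "norm (\<Sum>l\<in>{- int L..int L}. a k i l) \<le> 2 / t" if "i \<noteq> j" for i
        using poisson_sum_bound[where r = "1 - t" and L = L and x = "z $ i"] t that
        unfolding a_def t_def[symmetric] by simp
      have "norm (\<Prod>i\<in>UNIV. \<Sum>l\<in>{- int L..int L}. a k i l)
          = norm (\<Sum>l\<in>{- int L..int L}. a k j l) * (\<Prod>i\<in>UNIV - {j}. norm (\<Sum>l\<in>{- int L..int L}. a k i l))"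
        by (simp add: prod_norm[symmetric] prod.remove[of UNIV j] norm_mult)
      also have "\<dots> \<le> (2 * I + 1) * (\<Prod>i\<in>UNIV - {j}. 2 / t)"
        using nj ni by (intro mult_mono prod_mono prod_nonneg) (auto simp: I_def)
      also have "\<dots> = (2 * I + 1) * (2 / t) ^ (?n - 1)"
        by simp
      finally have "norm (of_real (t ^ (?n + 1)) * (\<Prod>i\<in>UNIV. \<Sum>l\<in>{- int L..int L}. a k i l))
          \<le> t ^ (?n + 1) * ((2 * I + 1) * (2 / t) ^ (?n - 1))"
        using t by (simp add: norm_mult norm_power)
      \<comment> \<open>The \<open>n - 1\<close> factors \<open>2 / t\<close> consume
        \<open>n - 1\<close> of the \<open>n + 1\<close> powers of \<open>t\<close>; the remaining
        \<open>t ^ 2\<close> is what the derivative term requires.\<close>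
      also have "\<dots> = 2 ^ (?n - 1) * (2 * (t ^ 2 * I) + t ^ 2)"
      proof -
        obtain p where p: "?n = Suc p" using zero_less_card_finite[where 'a='n] by (cases "?n") auto
        show ?thesis unfolding p using t by (simp add: power_divide field_simps power2_eq_square)
      qed
      also have "\<dots> \<le> 2 ^ (?n - 1) * (8 * min (c / 2 ^ k) (2 ^ k / c) + t)"
      proof -
        have "t ^ 2 \<le> t" using t by (simp add: power2_eq_square mult_left_le)
        thus ?thesis using I by (intro mult_left_mono) auto
      qed
      finally have f: "norm (of_real (t ^ (?n + 1)) * (\<Prod>i\<in>UNIV. \<Sum>l\<in>{- int L..int L}. a k i l))
          \<le> 2 ^ (?n - 1) * (8 * min (c / 2 ^ k) (2 ^ k / c) + t)" .
      \<comment> \<open>Writing \<open>t\<close> as a minimum lets the error terms be summed by the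
        same dyadic lemma, with \<open>c = 1\<close>.\<close>
      have t_min: "min (1 / 2 ^ k) (2 ^ k / 1) = t"
        using order_trans[of "1 / 2 ^ k" "1 :: real" "2 ^ k"] by (simp add: t_def min_def)
      show ?thesis
        using f unfolding t_min unfolding t_def .
    qed
    have "norm (\<Sum>k=1..K. of_real ((1 / 2 ^ k) ^ (?n + 1)) * (\<Prod>i\<in>UNIV. \<Sum>l\<in>{- int L..int L}. a k i l))
      \<le> (\<Sum>k=1..K. 2 ^ (?n - 1) * (8 * min (c / 2 ^ k) (2 ^ k / c) + min (1 / 2 ^ k) (2 ^ k / 1)))"
      by (rule order_trans[OF norm_sum sum_mono[OF bound]])
    also have "\<dots> = 2 ^ (?n - 1) * (8 * (\<Sum>k=1..K. min (c / 2 ^ k) (2 ^ k / c)) + (\<Sum>k=1..K. min (1 / 2 ^ k) (2 ^ k / 1)))"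
      by (simp add: sum.distrib sum_distrib_left[symmetric])
    also have "\<dots> \<le> 2 ^ (?n - 1) * (8 * 6 + 6)"
      by (intro mult_left_mono add_mono sum_min_dyadic_le c) auto
    finally show ?thesis unfolding eq by simp
  qed
  thus "\<exists>L0. \<forall>L\<ge>L0. \<forall>z. norm (\<Sum>m\<in>fbox L. of_real (of_int (m $ j) * dyadic_weight K m) * char_fun m z) \<le> 2 ^ (?n - 1) * 54"
    by blast
qed

subsection \<open>Test functions\<close>

lemma test_funs_periodic: "\<phi> \<in> test_funs \<Longrightarrow> torus_periodic \<phi>"
  by (simp add: test_funs_def)

lemma test_funs_differentiable: "\<phi> \<in> test_funs \<Longrightarrow> foldr partial js \<phi> differentiable (at x)"
  by (simp add: test_funs_def)

lemma test_funs_continuous: "\<phi> \<in> test_funs \<Longrightarrow> continuous_on UNIV \<phi>"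
  using test_funs_differentiable[of \<phi> "[]"]
  by (auto intro!: continuous_at_imp_continuous_on differentiable_imp_continuous_within)

lemma partial_eq:
  assumes "(f has_derivative f') (at x)"
  shows "partial j f x = f' (axis j 1)"
  using frechet_derivative_at[OF assms] by (simp add: partial_def)

lemma torus_periodic_partial:
  fixes f :: "real ^ 'n \<Rightarrow> complex"
  assumes "torus_periodic f" and diff: "\<And>x. f differentiable (at x)"
  shows "torus_periodic (partial j f)"
  unfolding torus_periodic_def
proof (intro allI)
  fix x and k :: "int ^ 'n"
  let ?p = "(2 * pi) *\<^sub>R freq k"
  have "(f has_derivative frechet_derivative f (at (x + ?p))) (at (x + ?p))"
    by (rule iffD1[OF frechet_derivative_works diff])
  hence "((\<lambda>y. f (y + ?p)) has_derivative frechet_derivative f (at (x + ?p))) (at x)"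
    by (rule has_derivative_compose[rotated]) (auto intro!: derivative_eq_intros)
  also have "(\<lambda>y. f (y + ?p)) = f"
    using assms(1) by (auto simp: torus_periodic_def)
  finally show "partial j f (x + ?p) = partial j f x"
    by (simp add: partial_eq) (simp add: partial_def)
qed

lemma partial_test_funs:
  assumes "\<phi> \<in> test_funs"
  shows "partial j \<phi> \<in> test_funs"
  unfolding test_funs_def
proof (intro CollectI conjI allI)
  show "torus_periodic (partial j \<phi>)"
    using assms test_funs_differentiable[OF assms, of "[]"]
    by (intro torus_periodic_partial test_funs_periodic) auto
  show "foldr partial js (partial j \<phi>) differentiable at x" for js x
    \<comment> \<open>\<open>foldr\<close> applies the last list element first, so the derivative
      already taken is appended at the end.\<close>
    using test_funs_differentiable[OF assms, of "js @ [j]" x] by simp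
qed

lemma foldr_partial_test_funs: "\<phi> \<in> test_funs \<Longrightarrow> foldr partial js \<phi> \<in> test_funs"
  by (induction js) (auto intro: partial_test_funs)

lemma test_funs_has_derivative:
  assumes "\<phi> \<in> test_funs"
  shows "(\<phi> has_derivative frechet_derivative \<phi> (at x)) (at x)"
  using test_funs_differentiable[OF assms, of "[]" x] frechet_derivative_works by auto

lemma partial_add:
  assumes "\<phi> \<in> test_funs" "\<psi> \<in> test_funs"
  shows "partial j (\<lambda>x. \<phi> x + \<psi> x) = (\<lambda>x. partial j \<phi> x + partial j \<psi> x)"
  by (intro ext) (simp add: partial_eq[OF has_derivative_add[OF assms[THEN test_funs_has_derivative]]], simp add: partial_def)

lemma partial_cmult:
  assumes "\<phi> \<in> test_funs"
  shows "partial j (\<lambda>x. c * \<phi> x) = (\<lambda>x. c * partial j \<phi> x)"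
  by (intro ext) (simp add: partial_eq[OF has_derivative_mult_right[OF test_funs_has_derivative[OF assms]]], simp add: partial_def)

lemma foldr_partial_add:
  assumes "\<phi> \<in> test_funs" "\<psi> \<in> test_funs"
  shows "foldr partial js (\<lambda>x. \<phi> x + \<psi> x) = (\<lambda>x. foldr partial js \<phi> x + foldr partial js \<psi> x)"
  by (induction js) (simp_all add: partial_add foldr_partial_test_funs assms)

lemma foldr_partial_cmult:
  assumes "\<phi> \<in> test_funs"
  shows "foldr partial js (\<lambda>x. c * \<phi> x) = (\<lambda>x. c * foldr partial js \<phi> x)"
  by (induction js) (simp_all add: partial_cmult foldr_partial_test_funs assms)

lemma test_funs_add:
  assumes "\<phi> \<in> test_funs" "\<psi> \<in> test_funs"
  shows "(\<lambda>x. \<phi> x + \<psi> x) \<in> test_funs"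
  unfolding test_funs_def using assms
  by (auto simp: foldr_partial_add torus_periodic_def test_funs_differentiable
      dest!: test_funs_periodic intro!: differentiable_add)

lemma test_funs_cmult:
  assumes "\<phi> \<in> test_funs"
  shows "(\<lambda>x. c * \<phi> x) \<in> test_funs"
  unfolding test_funs_def using assms
  by (auto simp: foldr_partial_cmult torus_periodic_def test_funs_differentiable
      dest!: test_funs_periodic intro!: differentiable_mult)

lemma has_derivative_char_fun:
  "(char_fun m has_derivative (\<lambda>h. of_real (freq m \<bullet> h) * (\<i> * char_fun m x))) (at x)"
  unfolding char_fun_def scaleR_conv_of_real[symmetric]
  by (auto intro!: derivative_eq_intros)

lemma foldr_partial_char_fun:
  "foldr partial js (char_fun m) = (\<lambda>x. (\<Prod>j\<leftarrow>js. \<i> * of_int (m $ j)) * char_fun m x)"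
proof (induction js)
  case (Cons j js)
  have "partial j (\<lambda>x. c * char_fun m x) x = \<i> * of_int (m $ j) * (c * char_fun m x)" for c x
    using partial_eq[OF has_derivative_mult_right[OF has_derivative_char_fun[of m x], of c], of j]
    by (simp add: inner_axis mult_ac)
  thus ?case
    by (simp add: Cons fun_eq_iff mult.assoc)
qed simp

lemma char_fun_test_funs [simp]: "char_fun m \<in> test_funs"
  unfolding test_funs_def
proof (intro CollectI conjI allI)
  fix js x
  show "foldr partial js (char_fun m) differentiable at x"
    unfolding foldr_partial_char_fun
    using has_derivative_mult_right[OF has_derivative_char_fun[of m x]] differentiableI by blast
qed (rule torus_periodic_char_fun)

text \<open>By translation invariance the integral of \<open>h\<close> shifted by \<open>s\<close>
  along axis \<open>j\<close> does not depend on \<open>s\<close>. Differentiating under the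
  integral sign at \<open>s = 0\<close> gives the claim; the derivative is one-sided, because
  invariance is available for \<open>s\<close> in \<open>{0..2 * pi}\<close>.\<close>

lemma integral_partial_eq_0:
  fixes h :: "real ^ 'n \<Rightarrow> complex"
  assumes per: "torus_periodic h" and diff: "\<And>x. h differentiable (at x)"
    and cont': "continuous_on UNIV (partial j h)"
  shows "(\<integral>x. partial j h x \<partial>torus) = 0"
proof -
  let ?Q = "cbox 0 (\<chi> i. 2 * pi) :: (real ^ 'n) set"
  let ?e = "axis j 1 :: real ^ 'n"
  have cont: "continuous_on UNIV h"
    using diff by (auto intro!: continuous_at_imp_continuous_on differentiable_imp_continuous_within)
  have shift: "continuous_on A (\<lambda>x. h (x + s *\<^sub>R ?e))" for A s
    by (rule continuous_on_compose2[OF cont]) (auto intro!: continuous_intros)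
  have deriv: "((\<lambda>s. h (x + s *\<^sub>R ?e)) has_vector_derivative partial j h (x + s *\<^sub>R ?e)) (at s within {0..2 * pi})" for x s
  proof -
    let ?D = "frechet_derivative h (at (x + s *\<^sub>R ?e))"
    have D: "(h has_derivative ?D) (at (x + s *\<^sub>R ?e))"
      by (rule iffD1[OF frechet_derivative_works diff])
    have "((\<lambda>s. h (x + s *\<^sub>R ?e)) has_derivative (\<lambda>r. ?D (r *\<^sub>R ?e))) (at s within {0..2 * pi})"
      by (rule has_derivative_compose[where f = "\<lambda>s. x + s *\<^sub>R ?e" and f' = "\<lambda>r. r *\<^sub>R ?e", OF _ D])
        (auto intro!: derivative_eq_intros)
    moreover have "?D (r *\<^sub>R ?e) = r *\<^sub>R partial j h (x + s *\<^sub>R ?e)" for r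
      unfolding partial_def using linear_cmul[OF has_derivative_linear[OF D]] by simp
    ultimately show ?thesis
      unfolding has_vector_derivative_def by simp
  qed
  have "((\<lambda>s. integral ?Q (\<lambda>x. h (x + s *\<^sub>R ?e))) has_vector_derivative
      integral ?Q (\<lambda>x. partial j h (x + 0 *\<^sub>R ?e))) (at 0 within {0..2 * pi})"
  proof (rule leibniz_rule_vector_derivative)
    show "continuous_on ({0..2 * pi} \<times> ?Q) (\<lambda>(s, x). partial j h (x + s *\<^sub>R ?e))"
      unfolding case_prod_beta
      by (rule continuous_on_compose2[OF cont']) (auto intro!: continuous_intros)
  qed (use deriv shift in \<open>auto intro: integrable_continuous\<close>)
  moreover have "((\<lambda>s. integral ?Q (\<lambda>x. h (x + s *\<^sub>R ?e))) has_vector_derivative 0) (at 0 within {0..2 * pi})"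
  proof (rule has_vector_derivative_transform[where f = "\<lambda>_. \<integral>x. h x \<partial>torus"])
    fix s assume "s \<in> {0..2 * pi}"
    thus "integral ?Q (\<lambda>x. h (x + s *\<^sub>R ?e)) = (\<integral>x. h x \<partial>torus)"
      using torus_integral_translate[OF cont per, of s j] by (simp add: torus_integral_eq[OF shift])
  qed auto
  ultimately have "integral ?Q (partial j h) = 0"
    using vector_derivative_unique_within_closed_interval[of 0 "2 * pi" 0] by auto
  thus ?thesis
    by (simp add: torus_integral_eq[OF cont'])
qed

subsection \<open>Fourier coefficients\<close>

lemma integrable_mult_continuous:
  fixes g k :: "real ^ 'n \<Rightarrow> complex"
  assumes "integrable torus g" and k: "continuous_on UNIV k" and "\<And>x. norm (k x) \<le> B"
  shows "integrable torus (\<lambda>x. g x * k x)"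
proof (rule Bochner_Integration.integrable_bound)
  show "integrable torus (\<lambda>x. B * norm (g x))"
    using assms(1) by simp
  show "(\<lambda>x. g x * k x) \<in> borel_measurable torus"
    using assms(1) torus_integrable_continuous[OF k] by simp
  have "norm (g x) * norm (k x) \<le> \<bar>B\<bar> * norm (g x)" for x
    using mult_right_mono[OF order_trans[OF assms(3)[of x] abs_ge_self[of B]], of "norm (g x)"]
    by (simp add: mult.commute)
  thus "AE x in torus. norm (g x * k x) \<le> norm (B * norm (g x))"
    by (simp add: norm_mult abs_mult)
qed

lemma integrable_mult_char_fun:
  "integrable torus g \<Longrightarrow> integrable torus (\<lambda>x. g x * char_fun m x)"
  by (rule integrable_mult_continuous[where B = 1]) (auto intro!: continuous_intros)

lemma norm_integral_mult_le:
  fixes g k :: "real ^ 'n \<Rightarrow> complex"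
  assumes "integrable torus g" and k: "continuous_on UNIV k" and "\<And>x. norm (k x) \<le> B"
  shows "norm (\<integral>x. g x * k x \<partial>torus) \<le> B * (\<integral>x. norm (g x) \<partial>torus)"
proof -
  have "norm (\<integral>x. g x * k x \<partial>torus) \<le> (\<integral>x. norm (g x * k x) \<partial>torus)"
    by (rule integral_norm_bound)
  also have "\<dots> \<le> (\<integral>x. B * norm (g x) \<partial>torus)"
    using assms by (intro integral_mono integrable_norm integrable_mult_continuous)
      (auto simp: norm_mult mult.commute[of B] intro: mult_left_mono)
  finally show ?thesis by simp
qed

lemma dist_of_char_fun: "dist_of g (char_fun m) = (\<integral>x. g x * char_fun m x \<partial>torus)"
  by (simp add: dist_of_def)

lemma fourier_coeff_dist_of:
  "fourier_coeff (dist_of g) m = (\<integral>x. g x * char_fun (- m) x \<partial>torus) / (2 * pi) ^ CARD('n)"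
  for m :: "int ^ 'n"
  by (simp add: fourier_coeff_def dist_of_char_fun)

lemma fourier_coeff_dist_add:
  "fourier_coeff (dist_add u v) m = fourier_coeff u m + fourier_coeff v m"
  by (simp add: fourier_coeff_def dist_add_def add_divide_distrib)

lemma dist_of_char_fun_char_fun:
  "dist_of (char_fun m) (char_fun k) = (if k = - m then (2 * pi) ^ CARD('n) else 0)"
  for m k :: "int ^ 'n"
  unfolding dist_of_char_fun
  using integral_char_fun[of "m + k"] by (simp add: char_fun_add[symmetric] add_eq_0_iff)

text \<open>Tested on a character, the series has a single nonzero term by orthogonality, so its
  convergence is not an issue.\<close>

lemma fourier_coeff_multiplier:
  "fourier_coeff (fourier_multiplier \<sigma> u) k = \<sigma> k * fourier_coeff u k" for k :: "int ^ 'n"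
proof -
  have "fourier_multiplier \<sigma> u (char_fun (- k))
      = (\<Sum>\<^sub>\<infinity>m. \<sigma> m * fourier_coeff u m * dist_of (char_fun m) (char_fun (- k)))"
    by (simp add: fourier_multiplier_def)
  also have "\<dots> = (\<Sum>\<^sub>\<infinity>m\<in>{k}. \<sigma> m * fourier_coeff u m * dist_of (char_fun m) (char_fun (- k)))"
    by (rule infsum_cong_neutral) (auto simp: dist_of_char_fun_char_fun)
  also have "\<dots> = \<sigma> k * fourier_coeff u k * (2 * pi) ^ CARD('n)"
    by (simp add: dist_of_char_fun_char_fun)
  finally show ?thesis
    by (simp add: fourier_coeff_def)
qed

lemma norm_bilinear_fourier_le:
  fixes g h :: "real ^ 'n \<Rightarrow> complex"
  assumes g: "integrable torus g" and h: "integrable torus h" and F: "finite F"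
    and B: "\<And>z. norm (\<Sum>m\<in>F. c m * char_fun m z) \<le> B"
  shows "norm (\<Sum>m\<in>F. c m * fourier_coeff (dist_of g) m * cnj (fourier_coeff (dist_of h) m))
           \<le> B * (L1_norm g * L1_norm h)"
proof -
  let ?V = "(2 * pi) ^ CARD('n) :: real"
  have V: "?V \<ge> 1"
    using pi_gt3 by (intro one_le_power) auto
  have L1: "L1_norm g \<ge> 0" "L1_norm h \<ge> 0"
    by (auto simp: L1_norm_def)
  have B0: "B \<ge> 0"
    using order_trans[OF norm_ge_zero B] .
  define P where "P x = (\<Sum>m\<in>F. c m * cnj (fourier_coeff (dist_of h) m) * char_fun (- m) x)" for x
  have hc: "integrable torus (\<lambda>x. cnj (h x))"
    using h by simp
  have cnj_coeff: "cnj (fourier_coeff (dist_of h) m) = (\<integral>y. cnj (h y) * char_fun m y \<partial>torus) / ?V" for m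
  proof -
    have "(\<integral>y. cnj (h y * char_fun (- m) y) \<partial>torus) = cnj (\<integral>y. h y * char_fun (- m) y \<partial>torus)"
      by (rule Bochner_Integration.integral_cnj)
    thus ?thesis
      by (simp add: fourier_coeff_dist_of char_fun_cnj)
  qed
  have P: "norm (P x) \<le> B * L1_norm h" for x
  proof -
    have "of_real ?V * P x = (\<Sum>m\<in>F. \<integral>y. cnj (h y) * char_fun m y * (c m * char_fun (- m) x) \<partial>torus)"
      unfolding P_def sum_distrib_left cnj_coeff
      by (intro sum.cong refl) simp
    also have "\<dots> = (\<integral>y. (\<Sum>m\<in>F. cnj (h y) * char_fun m y * (c m * char_fun (- m) x)) \<partial>torus)"
      by (intro Bochner_Integration.integral_sum[symmetric] integrable_mult_left integrable_mult_char_fun[OF hc])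
    also have "\<dots> = (\<integral>y. cnj (h y) * (\<Sum>m\<in>F. c m * char_fun m (y - x)) \<partial>torus)"
      by (simp add: sum_distrib_left char_fun_diff_right mult_ac)
    also have "norm \<dots> \<le> B * L1_norm h"
    proof -
      have "continuous_on UNIV (\<lambda>y. \<Sum>m\<in>F. c m * char_fun m (y - x))"
        by (intro continuous_intros)
      from norm_integral_mult_le[OF hc this B] show ?thesis
        by (simp add: L1_norm_def)
    qed
    finally have "?V * norm (P x) \<le> B * L1_norm h"
      by (simp add: norm_mult norm_power)
    moreover have "1 * norm (P x) \<le> ?V * norm (P x)"
      using V by (intro mult_right_mono) auto
    ultimately show ?thesis by linarith
  qed
  have "of_real ?V * (\<Sum>m\<in>F. c m * fourier_coeff (dist_of g) m * cnj (fourier_coeff (dist_of h) m))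
      = (\<Sum>m\<in>F. \<integral>x. g x * char_fun (- m) x * (c m * cnj (fourier_coeff (dist_of h) m)) \<partial>torus)"
    unfolding sum_distrib_left fourier_coeff_dist_of[of g]
    by (intro sum.cong refl) simp
  also have "\<dots> = (\<integral>x. (\<Sum>m\<in>F. g x * char_fun (- m) x * (c m * cnj (fourier_coeff (dist_of h) m))) \<partial>torus)"
    by (intro Bochner_Integration.integral_sum[symmetric] integrable_mult_left integrable_mult_char_fun[OF g])
  also have "\<dots> = (\<integral>x. g x * P x \<partial>torus)"
    unfolding P_def by (simp add: sum_distrib_left mult_ac)
  also have "norm \<dots> \<le> (B * L1_norm h) * L1_norm g"
    unfolding L1_norm_def[of g] by (rule norm_integral_mult_le[OF g _ P]) (auto simp: P_def intro!: continuous_intros)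
  finally have "?V * norm (\<Sum>m\<in>F. c m * fourier_coeff (dist_of g) m * cnj (fourier_coeff (dist_of h) m)) \<le> B * (L1_norm g * L1_norm h)"
    by (simp add: norm_mult norm_power mult_ac)
  moreover have "1 * norm (\<Sum>m\<in>F. c m * fourier_coeff (dist_of g) m * cnj (fourier_coeff (dist_of h) m))
      \<le> ?V * norm (\<Sum>m\<in>F. c m * fourier_coeff (dist_of g) m * cnj (fourier_coeff (dist_of h) m))"
    using V by (intro mult_right_mono) auto
  ultimately show ?thesis by linarith
qed

subsection \<open>Square-integrable functions\<close>

definition trig_poly :: "(int ^ 'n) set \<Rightarrow> (int ^ 'n \<Rightarrow> complex) \<Rightarrow> real ^ 'n \<Rightarrow> complex" where
  "trig_poly F a x = (\<Sum>m\<in>F. a m * char_fun m x)"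

lemma continuous_on_trig_poly [continuous_intros]:
  "continuous_on A f \<Longrightarrow> continuous_on A (\<lambda>x. trig_poly F a (f x))"
  unfolding trig_poly_def by (intro continuous_intros)

lemma torus_periodic_trig_poly: "torus_periodic (trig_poly F a)"
proof -
  have "char_fun m (x + (2 * pi) *\<^sub>R freq k) = char_fun m x" for m x and k :: "int ^ 'a"
    using torus_periodic_char_fun[of m] by (simp add: torus_periodic_def)
  thus ?thesis
    by (simp add: torus_periodic_def trig_poly_def)
qed

lemma norm_trig_poly_le: "norm (trig_poly F a x) \<le> (\<Sum>m\<in>F. norm (a m))"
  unfolding trig_poly_def by (rule order_trans[OF norm_sum]) (simp add: norm_mult)

lemma integral_trig_poly_char_fun:
  fixes a :: "int ^ 'n \<Rightarrow> complex"
  assumes F: "finite F"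
  shows "(\<integral>x. trig_poly F a x * char_fun (- m) x \<partial>torus) = (if m \<in> F then (2 * pi) ^ CARD('n) * a m else 0)"
proof -
  have "(\<integral>x. trig_poly F a x * char_fun (- m) x \<partial>torus) = (\<integral>x. (\<Sum>k\<in>F. a k * char_fun (k - m) x) \<partial>torus)"
    using char_fun_add[of _ "- m"] by (simp add: trig_poly_def sum_distrib_right mult.assoc)
  also have "\<dots> = (\<Sum>k\<in>F. \<integral>x. a k * char_fun (k - m) x \<partial>torus)"
    by (rule Bochner_Integration.integral_sum) (auto intro!: torus_integrable_continuous continuous_intros)
  also have "\<dots> = (\<Sum>k\<in>F. if k = m then (2 * pi) ^ CARD('n) * a m else 0)"
    by (intro sum.cong) (simp_all add: integral_char_fun)
  also have "\<dots> = (if m \<in> F then (2 * pi) ^ CARD('n) * a m else 0)"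
    using F by simp
  finally show ?thesis .
qed

lemma integral_norm_trig_poly_sq:
  fixes a :: "int ^ 'n \<Rightarrow> complex"
  assumes "finite F"
  shows "(\<integral>x. (norm (trig_poly F a x))\<^sup>2 \<partial>torus) = (2 * pi) ^ CARD('n) * (\<Sum>m\<in>F. (norm (a m))\<^sup>2)"
proof -
  have "complex_of_real (\<integral>x. (norm (trig_poly F a x))\<^sup>2 \<partial>torus) = (\<integral>x. trig_poly F a x * cnj (trig_poly F a x) \<partial>torus)"
    by (simp add: complex_norm_square[symmetric] flip: integral_complex_of_real)
  also have "\<dots> = (\<integral>x. (\<Sum>m\<in>F. cnj (a m) * (trig_poly F a x * char_fun (- m) x)) \<partial>torus)"
    unfolding trig_poly_def[of F a] cnj_sum
    by (simp add: sum_distrib_left char_fun_cnj mult_ac)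
  also have "\<dots> = (\<Sum>m\<in>F. \<integral>x. cnj (a m) * (trig_poly F a x * char_fun (- m) x) \<partial>torus)"
    by (rule Bochner_Integration.integral_sum) (auto intro!: torus_integrable_continuous continuous_intros)
  also have "\<dots> = (\<Sum>m\<in>F. (2 * pi) ^ CARD('n) * (a m * cnj (a m)))"
    using assms by (intro sum.cong) (simp_all add: integral_trig_poly_char_fun)
  also have "\<dots> = complex_of_real ((2 * pi) ^ CARD('n) * (\<Sum>m\<in>F. (norm (a m))\<^sup>2))"
    by (simp add: complex_norm_square[symmetric] sum_distrib_left)
  finally show ?thesis
    unfolding of_real_eq_iff .
qed

lemma L2_funs_integrable:
  fixes g :: "real ^ 'n \<Rightarrow> complex"
  assumes "g \<in> L2_funs"
  shows "integrable torus g"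
proof (rule Bochner_Integration.integrable_bound)
  interpret finite_measure "torus :: (real ^ 'n) measure" by (rule finite_measure_torus)
  show "integrable torus (\<lambda>x. 1 + (norm (g x))\<^sup>2)"
    using assms by (auto simp: L2_funs_def)
  show "g \<in> borel_measurable torus"
    using assms by (simp add: L2_funs_def)
  have "norm (g x) \<le> 1 + (norm (g x))\<^sup>2" for x
  proof -
    have "0 \<le> (norm (g x) - 1)\<^sup>2 + (norm (g x))\<^sup>2 + 1"
      by simp
    thus ?thesis
      by (simp add: power2_eq_square algebra_simps)
  qed
  thus "AE x in torus. norm (g x) \<le> norm (1 + (norm (g x))\<^sup>2)"
    by simp
qed

text \<open>Expand the nonnegative integral of \<open>|g - P|^2\<close> with \<open>P\<close> the
  Fourier sum of \<open>g\<close> over \<open>F\<close>. The inner product of \<open>g\<close> with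
  \<open>P\<close> and the squared norm of \<open>P\<close> have the same value
  \<open>?V * S\<close>.\<close>

lemma bessel_inequality:
  fixes g :: "real ^ 'n \<Rightarrow> complex"
  assumes g: "g \<in> L2_funs" and F: "finite F"
  shows "(2 * pi) ^ CARD('n) * (\<Sum>m\<in>F. (norm (fourier_coeff (dist_of g) m))\<^sup>2) \<le> (\<integral>x. (norm (g x))\<^sup>2 \<partial>torus)"
proof -
  let ?V = "(2 * pi) ^ CARD('n) :: real"
  define a where "a = fourier_coeff (dist_of g)"
  define P where "P = trig_poly F a"
  define S where "S = (\<Sum>m\<in>F. (norm (a m))\<^sup>2)"
  have gi: "integrable torus g" by (rule L2_funs_integrable[OF g])
  have g2: "integrable torus (\<lambda>x. (norm (g x))\<^sup>2)" using g by (simp add: L2_funs_def)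
  have gP: "integrable torus (\<lambda>x. g x * cnj (P x))"
    unfolding P_def using gi norm_trig_poly_le[of F a]
    by (intro integrable_mult_continuous) (auto intro!: continuous_intros)
  have P2: "integrable torus (\<lambda>x. (norm (P x))\<^sup>2)"
    unfolding P_def by (intro torus_integrable_continuous continuous_intros)
  have "(\<integral>x. g x * cnj (P x) \<partial>torus) = (\<integral>x. (\<Sum>m\<in>F. cnj (a m) * (g x * char_fun (- m) x)) \<partial>torus)"
    unfolding P_def trig_poly_def cnj_sum by (simp add: sum_distrib_left char_fun_cnj mult_ac)
  also have "\<dots> = (\<Sum>m\<in>F. \<integral>x. cnj (a m) * (g x * char_fun (- m) x) \<partial>torus)"
    by (rule Bochner_Integration.integral_sum) (auto intro!: integrable_mult_char_fun gi)
  also have "\<dots> = (\<Sum>m\<in>F. ?V * (a m * cnj (a m)))"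
    by (intro sum.cong) (simp_all add: a_def fourier_coeff_dist_of)
  also have "\<dots> = complex_of_real (?V * S)"
    by (simp add: S_def complex_norm_square[symmetric] sum_distrib_left)
  finally have gP_int: "(\<integral>x. g x * cnj (P x) \<partial>torus) = complex_of_real (?V * S)" .
  have pw: "0 \<le> (norm (g x))\<^sup>2 - 2 * Re (g x * cnj (P x)) + (norm (P x))\<^sup>2" for x
  proof -
    have norm_sq: "(norm (a - b))\<^sup>2 = (norm a)\<^sup>2 - 2 * Re (a * cnj b) + (norm b)\<^sup>2" for a b :: complex
    proof -
      obtain p q r s where "a = Complex p q" "b = Complex r s"
        by (meson complex.exhaust)
      thus ?thesis
        by (simp add: cmod_power2 power2_diff algebra_simps)
    qed
    show ?thesis
      unfolding norm_sq[symmetric] by (rule zero_le_power2)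
  qed
  have "0 \<le> (\<integral>x. (norm (g x))\<^sup>2 - 2 * Re (g x * cnj (P x)) + (norm (P x))\<^sup>2 \<partial>torus)"
    by (rule Bochner_Integration.integral_nonneg) (rule pw)
  also have "\<dots> = (\<integral>x. (norm (g x))\<^sup>2 \<partial>torus) - 2 * Re (\<integral>x. g x * cnj (P x) \<partial>torus) + (\<integral>x. (norm (P x))\<^sup>2 \<partial>torus)"
  proof -
    have "integrable torus (\<lambda>x. 2 * Re (g x * cnj (P x)))"
      using gP by (intro integrable_mult_right integrable_Re)
    moreover have "(\<integral>x. 2 * Re (g x * cnj (P x)) \<partial>torus) = 2 * Re (\<integral>x. g x * cnj (P x) \<partial>torus)"
      unfolding integral_Re[OF gP, symmetric] by (rule integral_mult_right_zero)
    ultimately show ?thesis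
      using g2 P2 by (simp only: Bochner_Integration.integral_add Bochner_Integration.integral_diff Bochner_Integration.integrable_diff)
  qed
  also have "(\<integral>x. (norm (P x))\<^sup>2 \<partial>torus) = ?V * S"
    unfolding P_def S_def by (rule integral_norm_trig_poly_sq[OF F])
  finally have "?V * S \<le> (\<integral>x. (norm (g x))\<^sup>2 \<partial>torus)"
    unfolding gP_int Re_complex_of_real by linarith
  thus ?thesis by (simp add: S_def a_def)
qed

text \<open>Along boxes with geometrically small tails the partial sums are absolutely summable in \<open>L\<^sup>1\<close>;
  Fatou's lemma then puts the limit in \<open>L\<^sup>2\<close>.\<close>

lemma riesz_fischer:
  fixes c :: "int ^ 'n \<Rightarrow> complex"
  assumes A: "\<And>F. finite F \<Longrightarrow> (\<Sum>m\<in>F. (norm (c m))\<^sup>2) \<le> A"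
  obtains w where "w \<in> L2_funs" and "\<And>m. fourier_coeff (dist_of w) m = c m"
    and "L2_norm w \<le> sqrt ((2 * pi) ^ CARD('n) * A)"
proof -
  let ?V = "(2 * pi) ^ CARD('n) :: real"
  interpret finite_measure "torus :: (real ^ 'n) measure" by (rule finite_measure_torus)
  have V: "?V > 0" by simp
  define g where "g L = (\<Sum>m\<in>fbox L. (norm (c m))\<^sup>2)" for L
  have gA: "g L \<le> A" for L unfolding g_def by (rule A) simp
  have bdd: "bdd_above (range g)" using gA by (auto simp: bdd_above_def)
  have g_mono: "L \<le> L' \<Longrightarrow> g L \<le> g L'" for L L'
    unfolding g_def by (intro sum_mono2 fbox_mono) auto
  define T where "T = (SUP L. g L)"
  have gT: "g L \<le> T" for L unfolding T_def by (rule cSUP_upper[OF _ bdd]) simp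
  have "\<exists>L. T - (1 / 4) ^ k < g L" for k
    using less_cSUP_iff[OF _ bdd, of "T - (1 / 4) ^ k"] by (auto simp: T_def[symmetric])
  then obtain b where b: "T - (1 / 4) ^ k < g (b k)" for k by metis
  \<comment> \<open>The cumulative sum makes the radii increasing and at least \<open>b k\<close>;
    the summand \<open>k\<close> makes the boxes exhaust all frequencies.\<close>
  define l where "l k = k + (\<Sum>i\<le>k. b i)" for k
  have l_mono: "l k \<le> l (Suc k)" for k by (simp add: l_def)
  have "b k \<le> l k" for k
    unfolding l_def using member_le_sum[of k "{..k}" b] by simp
  hence tail: "T - (1 / 4) ^ k < g (l k)" for k
    using b[of k] g_mono[of "b k" "l k"] by (meson less_le_trans)
  define S where "S k = trig_poly (fbox (l k)) c" for k
  define D where "D k = trig_poly (fbox (l (Suc k)) - fbox (l k)) c" for k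
  have SD: "S (Suc k) x = S k x + D k x" for k x
    unfolding S_def D_def trig_poly_def
    using sum.subset_diff[OF fbox_mono[OF l_mono[of k]], of "\<lambda>m. c m * char_fun m x"] by simp
  have S_sum: "S k x = S 0 x + (\<Sum>i<k. D i x)" for k x
    by (induction k) (simp_all add: SD)
  have D_cont: "continuous_on UNIV (D k)" and S_cont: "continuous_on UNIV (S k)" for k
    unfolding D_def S_def by (intro continuous_intros)+
  have D2: "(\<integral>x. (norm (D k x))\<^sup>2 \<partial>torus) \<le> ?V * (1 / 4) ^ k" for k
  proof -
    have "(\<Sum>m\<in>fbox (l (Suc k)) - fbox (l k). (norm (c m))\<^sup>2) = g (l (Suc k)) - g (l k)"
      unfolding g_def using sum.subset_diff[OF fbox_mono[OF l_mono[of k]], of "\<lambda>m. (norm (c m))\<^sup>2"] by simp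
    also have "\<dots> \<le> (1 / 4) ^ k"
      using tail[of k] gT[of "l (Suc k)"] by simp
    finally show ?thesis
      unfolding D_def by (subst integral_norm_trig_poly_sq) (auto intro: mult_left_mono)
  qed
  have D1: "(\<integral>x. norm (D k x) \<partial>torus) \<le> ?V * (1 / 2) ^ k" for k
  proof -
    \<comment> \<open>An arithmetic-geometric mean inequality whose weight \<open>2 ^ k\<close>
      balances the squared \<open>L^2\<close> bound \<open>(1 / 4) ^ k\<close> against the constant:
      each half integrates to at most \<open>?V * (1 / 2) ^ k / 2\<close>.\<close>
    have "norm (D k x) \<le> 2 ^ k / 2 * (norm (D k x))\<^sup>2 + (1 / 2) ^ k / 2" for x
    proof -
      have "0 \<le> (2 ^ k * norm (D k x) - 1)\<^sup>2" by simp
      hence "2 ^ k * (2 * norm (D k x)) \<le> 2 ^ k * (2 ^ k * (norm (D k x))\<^sup>2 + (1 / 2) ^ k)"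
        by (simp add: power2_eq_square algebra_simps power_divide)
      thus ?thesis by simp
    qed
    hence "(\<integral>x. norm (D k x) \<partial>torus) \<le> (\<integral>x. 2 ^ k / 2 * (norm (D k x))\<^sup>2 + (1 / 2) ^ k / 2 \<partial>torus)"
      by (intro integral_mono torus_integrable_continuous continuous_intros
          continuous_on_compose2[OF D_cont]) auto
    also have "\<dots> = 2 ^ k / 2 * (\<integral>x. (norm (D k x))\<^sup>2 \<partial>torus) + ?V * ((1 / 2) ^ k / 2)"
      by (subst Bochner_Integration.integral_add)
        (auto intro!: torus_integrable_continuous continuous_intros continuous_on_compose2[OF D_cont] simp: measure_torus)
    also have "\<dots> \<le> 2 ^ k / 2 * (?V * (1 / 4) ^ k) + ?V * ((1 / 2) ^ k / 2)"
      using D2[of k] by (intro add_right_mono mult_left_mono) auto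
    also have "2 ^ k / 2 * (?V * (1 / 4) ^ k) = ?V * ((1 / 2) ^ k / 2)"
    proof -
      have "(4 :: real) ^ k = 2 ^ k * 2 ^ k" by (simp add: power_mult_distrib[symmetric])
      thus ?thesis by (simp add: power_divide)
    qed
    also have "?V * ((1 / 2) ^ k / 2) + ?V * ((1 / 2) ^ k / 2) = ?V * (1 / 2) ^ k"
      unfolding distrib_left[symmetric] field_sum_of_halves ..
    finally show ?thesis .
  qed
  have D_summable: "summable (\<lambda>k. \<integral>x. norm (D k x) \<partial>torus)"
  proof (rule summable_comparison_test)
    show "summable (\<lambda>k. ?V * (1 / 2) ^ k)"
      by (intro summable_mult summable_geometric) simp
    show "\<exists>N. \<forall>n\<ge>N. norm (\<integral>x. norm (D n x) \<partial>torus) \<le> ?V * (1 / 2) ^ n"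
      using D1 by simp
  qed
  have D_int: "integrable torus (D k)" and S_int: "integrable torus (S k)" for k
    by (rule torus_integrable_continuous[OF D_cont], rule torus_integrable_continuous[OF S_cont])
  have [measurable]: "D k \<in> borel_measurable torus" "S k \<in> borel_measurable torus" for k
    using D_int S_int by auto
  have AE_sum: "AE x in torus. summable (\<lambda>k. norm (D k x))"
  proof -
    have "(\<integral>\<^sup>+x. (\<Sum>k. ennreal (norm (D k x))) \<partial>torus) = (\<Sum>k. \<integral>\<^sup>+x. ennreal (norm (D k x)) \<partial>torus)"
      by (rule nn_integral_suminf) simp
    also have "\<dots> = (\<Sum>k. ennreal (\<integral>x. norm (D k x) \<partial>torus))"
      by (intro suminf_cong nn_integral_eq_integral) (auto intro: D_int)
    also have "\<dots> = ennreal (\<Sum>k. \<integral>x. norm (D k x) \<partial>torus)"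
      by (rule suminf_ennreal2[OF _ D_summable]) simp
    finally have "(\<integral>\<^sup>+x. (\<Sum>k. ennreal (norm (D k x))) \<partial>torus) \<noteq> \<infinity>"
      by simp
    hence "AE x in torus. (\<Sum>k. ennreal (norm (D k x))) \<noteq> \<infinity>"
      by (intro nn_integral_PInf_AE) auto
    thus ?thesis
      by (rule AE_mp) (auto intro!: AE_I2 summable_suminf_not_top)
  qed
  define w where "w x = S 0 x + (\<Sum>k. D k x)" for x
  have w_int: "integrable torus w"
    unfolding w_def using AE_sum D_summable D_int S_int
    by (intro Bochner_Integration.integrable_add integrable_suminf)
  have [measurable]: "w \<in> borel_measurable torus"
    using w_int by simp
  have lim: "AE x in torus. (\<lambda>k. S k x) \<longlonglongrightarrow> w x"
    using AE_sum
  proof (rule AE_mp, intro AE_I2 impI)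
    fix x assume "summable (\<lambda>k. norm (D k x))"
    hence "(\<lambda>k. \<Sum>i<k. D i x) \<longlonglongrightarrow> (\<Sum>i. D i x)"
      by (rule summable_LIMSEQ[OF summable_norm_cancel])
    hence "(\<lambda>k. S 0 x + (\<Sum>i<k. D i x)) \<longlonglongrightarrow> w x"
      unfolding w_def by (intro tendsto_intros)
    thus "(\<lambda>k. S k x) \<longlonglongrightarrow> w x"
      by (simp only: S_sum[symmetric])
  qed
  have S2: "(\<integral>\<^sup>+x. ennreal ((norm (S k x))\<^sup>2) \<partial>torus) \<le> ennreal (?V * A)" for k
  proof -
    have "(\<integral>\<^sup>+x. ennreal ((norm (S k x))\<^sup>2) \<partial>torus) = ennreal (\<integral>x. (norm (S k x))\<^sup>2 \<partial>torus)"
      by (intro nn_integral_eq_integral torus_integrable_continuous continuous_intros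
          continuous_on_compose2[OF S_cont]) auto
    also have "(\<integral>x. (norm (S k x))\<^sup>2 \<partial>torus) = ?V * g (l k)"
      unfolding S_def g_def by (rule integral_norm_trig_poly_sq) simp
    also have "ennreal \<dots> \<le> ennreal (?V * A)"
      using V gA by (intro ennreal_leI mult_left_mono) auto
    finally show ?thesis .
  qed
  have w2: "(\<integral>\<^sup>+x. ennreal ((norm (w x))\<^sup>2) \<partial>torus) \<le> ennreal (?V * A)"
  proof -
    have "(\<integral>\<^sup>+x. ennreal ((norm (w x))\<^sup>2) \<partial>torus) = (\<integral>\<^sup>+x. liminf (\<lambda>k. ennreal ((norm (S k x))\<^sup>2)) \<partial>torus)"
    proof (rule nn_integral_cong_AE, rule AE_mp[OF lim], intro AE_I2 impI)
      fix x assume "(\<lambda>k. S k x) \<longlonglongrightarrow> w x"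
      hence "(\<lambda>k. ennreal ((norm (S k x))\<^sup>2)) \<longlonglongrightarrow> ennreal ((norm (w x))\<^sup>2)"
        by (intro tendsto_ennrealI tendsto_intros)
      thus "ennreal ((norm (w x))\<^sup>2) = liminf (\<lambda>k. ennreal ((norm (S k x))\<^sup>2))"
        by (intro lim_imp_Liminf[symmetric]) auto
    qed
    also have "\<dots> \<le> liminf (\<lambda>k. \<integral>\<^sup>+x. ennreal ((norm (S k x))\<^sup>2) \<partial>torus)"
      by (rule nn_integral_liminf) simp
    also have "\<dots> \<le> liminf (\<lambda>k. ennreal (?V * A))"
      by (intro Liminf_mono always_eventually allI S2)
    finally show ?thesis by (simp add: Liminf_const)
  qed
  have w2_int: "integrable torus (\<lambda>x. (norm (w x))\<^sup>2)"
  proof (rule integrableI_bounded)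
    show "(\<integral>\<^sup>+x. ennreal (norm ((norm (w x))\<^sup>2)) \<partial>torus) < \<infinity>"
      using le_less_trans[OF w2 ennreal_less_top] by simp
  qed measurable
  have A0: "A \<ge> 0" using A[of "{}"] by simp
  have "ennreal (\<integral>x. (norm (w x))\<^sup>2 \<partial>torus) \<le> ennreal (?V * A)"
    using w2 nn_integral_eq_integral[OF w2_int] by simp
  hence w2_le: "(\<integral>x. (norm (w x))\<^sup>2 \<partial>torus) \<le> ?V * A"
    using A0 V by (subst (asm) ennreal_le_iff) auto
  show thesis
  proof (rule that[of w])
    \<comment> \<open>Periodicity holds at every point, including those where the series diverges:
      the summands agree termwise at translated points, so \<open>suminf\<close> takes the same
      value there.\<close>
    have "torus_periodic (S 0)" "\<And>k. torus_periodic (D k)"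
      unfolding S_def D_def by (rule torus_periodic_trig_poly)+
    hence "torus_periodic w"
      unfolding torus_periodic_def w_def by simp
    thus "w \<in> L2_funs"
      using w2_int by (simp add: L2_funs_def)
    show "L2_norm w \<le> sqrt (?V * A)"
      unfolding L2_norm_def using w2_le by simp
    show "fourier_coeff (dist_of w) m = c m" for m
    proof -
      have Dm: "integrable torus (\<lambda>x. D k x * char_fun (- m) x)" for k
        by (rule integrable_mult_char_fun[OF D_int])
      have AE': "AE x in torus. summable (\<lambda>k. norm (D k x * char_fun (- m) x))"
        using AE_sum by (simp add: norm_mult)
      have sm': "summable (\<lambda>k. \<integral>x. norm (D k x * char_fun (- m) x) \<partial>torus)"
        using D_summable by (simp add: norm_mult)
      have "(\<lambda>k. \<integral>x. D k x * char_fun (- m) x \<partial>torus) sums (\<integral>x. (\<Sum>k. D k x * char_fun (- m) x) \<partial>torus)"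
        by (rule sums_integral[OF Dm AE' sm'])
      hence "(\<lambda>k. (\<integral>x. S 0 x * char_fun (- m) x \<partial>torus) + (\<Sum>i<k. \<integral>x. D i x * char_fun (- m) x \<partial>torus))
          \<longlonglongrightarrow> (\<integral>x. S 0 x * char_fun (- m) x \<partial>torus) + (\<integral>x. (\<Sum>k. D k x * char_fun (- m) x) \<partial>torus)"
        unfolding sums_def by (intro tendsto_intros)
      also have "(\<integral>x. S 0 x * char_fun (- m) x \<partial>torus) + (\<integral>x. (\<Sum>k. D k x * char_fun (- m) x) \<partial>torus)
          = (\<integral>x. S 0 x * char_fun (- m) x + (\<Sum>k. D k x * char_fun (- m) x) \<partial>torus)"
        by (intro Bochner_Integration.integral_add[symmetric] integrable_mult_char_fun S_int integrable_suminf Dm AE' sm')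
      also have "\<dots> = (\<integral>x. w x * char_fun (- m) x \<partial>torus)"
      proof (rule integral_cong_AE)
        show "AE x in torus. S 0 x * char_fun (- m) x + (\<Sum>k. D k x * char_fun (- m) x) = w x * char_fun (- m) x"
          using AE_sum
        proof (rule AE_mp, intro AE_I2 impI)
          fix x assume "summable (\<lambda>k. norm (D k x))"
          hence "(\<Sum>k. D k x * char_fun (- m) x) = (\<Sum>k. D k x) * char_fun (- m) x"
            by (rule suminf_mult2[OF summable_norm_cancel, symmetric])
          thus "S 0 x * char_fun (- m) x + (\<Sum>k. D k x * char_fun (- m) x) = w x * char_fun (- m) x"
            by (simp add: w_def algebra_simps)
        qed
        show "(\<lambda>x. S 0 x * char_fun (- m) x + (\<Sum>k. D k x * char_fun (- m) x)) \<in> borel_measurable torus"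
          by (intro borel_measurable_integrable Bochner_Integration.integrable_add integrable_mult_char_fun S_int integrable_suminf Dm AE' sm')
        show "(\<lambda>x. w x * char_fun (- m) x) \<in> borel_measurable torus"
          by (intro borel_measurable_integrable integrable_mult_char_fun w_int)
      qed
      finally have L: "(\<lambda>k. (\<integral>x. S 0 x * char_fun (- m) x \<partial>torus) + (\<Sum>i<k. \<integral>x. D i x * char_fun (- m) x \<partial>torus))
          \<longlonglongrightarrow> (\<integral>x. w x * char_fun (- m) x \<partial>torus)" .
      have eq: "(\<integral>x. S 0 x * char_fun (- m) x \<partial>torus) + (\<Sum>i<k. \<integral>x. D i x * char_fun (- m) x \<partial>torus)
          = (\<integral>x. S k x * char_fun (- m) x \<partial>torus)" for k
      proof (induction k)
        case (Suc k)
        have "(\<integral>x. S (Suc k) x * char_fun (- m) x \<partial>torus) = (\<integral>x. S k x * char_fun (- m) x \<partial>torus) + (\<integral>x. D k x * char_fun (- m) x \<partial>torus)"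
          unfolding SD distrib_right
          by (intro Bochner_Integration.integral_add integrable_mult_char_fun S_int D_int)
        thus ?case using Suc by simp
      qed simp
      obtain L0 where L0: "{m} \<subseteq> fbox L0"
        using finite_subset_fbox[of "{m}"] by blast
      \<comment> \<open>Once the boxes contain \<open>m\<close>, the coefficient of
        \<open>S k\<close> no longer changes, which identifies the limit obtained above.\<close>
      have "(\<integral>x. S k x * char_fun (- m) x \<partial>torus) = ?V * c m" if "k \<ge> L0" for k
      proof -
        have "L0 \<le> l k" using that by (simp add: l_def)
        hence "m \<in> fbox (l k)" using L0 fbox_mono[of L0 "l k"] by blast
        thus ?thesis unfolding S_def by (simp add: integral_trig_poly_char_fun)
      qed
      hence "(\<lambda>k. \<integral>x. S k x * char_fun (- m) x \<partial>torus) \<longlonglongrightarrow> ?V * c m"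
        by (intro tendsto_eventually) (auto simp: eventually_sequentially)
      hence "(\<integral>x. w x * char_fun (- m) x \<partial>torus) = ?V * c m"
        using L unfolding eq by (rule LIMSEQ_unique[symmetric])
      thus ?thesis by (simp add: fourier_coeff_dist_of)
    qed
  qed
qed

subsection \<open>Density of trigonometric polynomials\<close>

lemma round_2pi: "\<exists>k :: int. \<bar>a - 2 * pi * of_int k\<bar> \<le> pi"
proof
  have "a - 2 * pi * of_int (round (a / (2 * pi))) = 2 * pi * (a / (2 * pi) - of_int (round (a / (2 * pi))))"
    by (simp add: right_diff_distrib)
  hence "\<bar>a - 2 * pi * of_int (round (a / (2 * pi)))\<bar> = 2 * pi * \<bar>of_int (round (a / (2 * pi))) - a / (2 * pi)\<bar>"
    by (simp add: abs_mult abs_minus_commute)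
  also have "\<dots> \<le> 2 * pi * (1 / 2)"
    by (intro mult_left_mono of_int_round_abs_le) simp
  finally show "\<bar>a - 2 * pi * of_int (round (a / (2 * pi)))\<bar> \<le> pi" by simp
qed

lemma reduce_mod_2pi:
  fixes x :: "real ^ 'n"
  obtains k :: "int ^ 'n" where "\<And>i. \<bar>(x - (2 * pi) *\<^sub>R freq k) $ i\<bar> \<le> pi"
proof -
  have "\<exists>\<kappa> :: 'n \<Rightarrow> int. \<forall>i. \<bar>x $ i - 2 * pi * of_int (\<kappa> i)\<bar> \<le> pi"
    by (intro choice allI round_2pi)
  then obtain \<kappa> :: "'n \<Rightarrow> int" where "\<And>i. \<bar>x $ i - 2 * pi * of_int (\<kappa> i)\<bar> \<le> pi"
    by blast
  thus ?thesis
    using that[of "\<chi> i. \<kappa> i"] by simp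
qed

lemma torus_periodic_diff:
  "torus_periodic f \<Longrightarrow> f (x - (2 * pi) *\<^sub>R freq k) = f x"
  unfolding torus_periodic_def by (metis diff_add_cancel)

text \<open>The Korovkin-type inequality that reduces uniform approximation to two moments of the kernel.\<close>

lemma periodic_modulus:
  fixes \<psi> :: "real ^ 'n \<Rightarrow> complex"
  assumes cont: "continuous_on UNIV \<psi>" and per: "torus_periodic \<psi>" and \<epsilon>: "\<epsilon> > 0"
  obtains C where "C \<ge> 0" "\<And>x y. norm (\<psi> x - \<psi> y) \<le> \<epsilon> + C * (\<Sum>i\<in>UNIV. 1 - cos (x $ i - y $ i))"
proof -
  \<comment> \<open>Large enough for any \<open>x\<close> with coordinates in
    \<open>[- pi, pi]\<close> together with any \<open>y\<close> that differs from it by at most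
    \<open>pi\<close> in each coordinate.\<close>
  define K :: "(real ^ 'n) set" where "K = cbox (\<chi> i. - (2 * pi)) (\<chi> i. 2 * pi)"
  have contK: "continuous_on K \<psi>" by (rule continuous_on_subset[OF cont]) simp
  have compact: "compact K" by (simp add: K_def)
  obtain M where M: "\<And>x. x \<in> K \<Longrightarrow> norm (\<psi> x) \<le> M"
    using compact_imp_bounded[OF compact_continuous_image[OF contK compact]]
    by (auto simp: bounded_iff)
  have "0 \<in> K"
    by (simp add: K_def mem_box_cart)
  hence M0: "M \<ge> 0"
    by (rule order_trans[OF norm_ge_zero M])
  obtain \<delta> where \<delta>: "\<delta> > 0" "\<And>x y. x \<in> K \<Longrightarrow> y \<in> K \<Longrightarrow> dist y x < \<delta> \<Longrightarrow> dist (\<psi> y) (\<psi> x) < \<epsilon>"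
    using compact_uniformly_continuous[OF contK compact, unfolded uniformly_continuous_on_def, rule_format, OF \<epsilon>]
    by blast
  \<comment> \<open>The bound \<open>pi\<close> keeps the argument where the cosine decreases;
    \<open>\<delta> / CARD('n)\<close> makes the sum of the coordinate differences less than
    \<open>\<delta>\<close>.\<close>
  define \<eta> where "\<eta> = min pi (\<delta> / CARD('n))"
  have \<eta>: "0 < \<eta>" "\<eta> \<le> pi" using \<delta> by (auto simp: \<eta>_def)
  define c0 where "c0 = 1 - cos \<eta>"
  have c0: "c0 > 0"
    using cos_monotone_0_pi[of 0 \<eta>] \<eta> by (simp add: c0_def)
  have main: "norm (\<psi> x - \<psi> y) \<le> \<epsilon> + 2 * M / c0 * (\<Sum>i\<in>UNIV. 1 - cos (x $ i - y $ i))"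
    if x: "\<And>i. \<bar>x $ i\<bar> \<le> pi" and xy: "\<And>i. \<bar>x $ i - y $ i\<bar> \<le> pi" for x y
  proof -
    have "- (2 * pi) \<le> x $ i \<and> x $ i \<le> 2 * pi \<and> - (2 * pi) \<le> y $ i \<and> y $ i \<le> 2 * pi" for i
      using x[of i] xy[of i] pi_gt_zero by linarith
    hence inK: "x \<in> K" "y \<in> K"
      unfolding K_def mem_box_cart by simp_all
    show ?thesis
    proof (cases "\<exists>i. \<bar>x $ i - y $ i\<bar> \<ge> \<eta>")
      case True
      then obtain i where i: "\<bar>x $ i - y $ i\<bar> \<ge> \<eta>" by blast
      have "cos \<bar>x $ i - y $ i\<bar> \<le> cos \<eta>"
        using i \<eta> xy[of i] by (intro cos_monotone_0_pi_le) auto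
      hence "c0 \<le> 1 - cos (x $ i - y $ i)" by (simp add: c0_def)
      also have "\<dots> \<le> (\<Sum>i\<in>UNIV. 1 - cos (x $ i - y $ i))"
        by (rule member_le_sum) auto
      finally have "2 * M / c0 * c0 \<le> 2 * M / c0 * (\<Sum>i\<in>UNIV. 1 - cos (x $ i - y $ i))"
        using M0 c0 by (intro mult_left_mono) auto
      moreover have "norm (\<psi> x - \<psi> y) \<le> M + M"
        using norm_triangle_ineq4[of "\<psi> x" "\<psi> y"] M[OF inK(1)] M[OF inK(2)] by linarith
      ultimately show ?thesis using c0 \<epsilon> by simp
    next
      case False
      have "dist x y \<le> (\<Sum>i\<in>UNIV. \<bar>(x - y) $ i\<bar>)"
        unfolding dist_norm by (rule norm_le_l1_cart)
      also have "\<dots> < (\<Sum>i\<in>(UNIV :: 'n set). \<delta> / CARD('n))"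
        using False by (intro sum_strict_mono) (auto simp: \<eta>_def not_le)
      also have "\<dots> = \<delta>" by simp
      finally have "norm (\<psi> x - \<psi> y) < \<epsilon>"
        using \<delta>(2)[OF inK(2) inK(1)] by (simp add: dist_norm)
      moreover have "0 \<le> 2 * M / c0 * (\<Sum>i\<in>UNIV. 1 - cos (x $ i - y $ i))"
        using M0 c0 by (intro mult_nonneg_nonneg sum_nonneg) auto
      ultimately show ?thesis by linarith
    qed
  qed
  show ?thesis
  proof (rule that[of "2 * M / c0"])
    fix x y :: "real ^ 'n"
    obtain k :: "int ^ 'n" where k: "\<And>i. \<bar>(x - (2 * pi) *\<^sub>R freq k) $ i\<bar> \<le> pi"
      using reduce_mod_2pi by blast
    define x' where "x' = x - (2 * pi) *\<^sub>R freq k"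
    \<comment> \<open>The difference \<open>y - x'\<close> is reduced, not \<open>y\<close> itself:
      it is the difference that must have coordinates in \<open>[- pi, pi]\<close>.\<close>
    obtain l :: "int ^ 'n" where l: "\<And>i. \<bar>(y - x' - (2 * pi) *\<^sub>R freq l) $ i\<bar> \<le> pi"
      using reduce_mod_2pi by blast
    define y' where "y' = y - (2 * pi) *\<^sub>R freq l"
    have "norm (\<psi> x' - \<psi> y') \<le> \<epsilon> + 2 * M / c0 * (\<Sum>i\<in>UNIV. 1 - cos (x' $ i - y' $ i))"
    proof (rule main)
      show "\<bar>x' $ i\<bar> \<le> pi" for i using k by (simp add: x'_def)
      show "\<bar>x' $ i - y' $ i\<bar> \<le> pi" for i
        using l[of i] by (simp add: y'_def abs_minus_commute algebra_simps)
    qed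
    moreover have "cos (x' $ i - y' $ i) = cos (x $ i - y $ i)" for i
    proof -
      have "x $ i - y $ i = x' $ i - y' $ i + 2 * pi * of_int (k $ i - l $ i)"
        by (simp add: x'_def y'_def algebra_simps)
      thus ?thesis
        by (simp add: cos_add sin_int_2pin cos_int_2pin del: of_int_diff)
    qed
    ultimately show "norm (\<psi> x - \<psi> y) \<le> \<epsilon> + 2 * M / c0 * (\<Sum>i\<in>UNIV. 1 - cos (x $ i - y $ i))"
      unfolding x'_def y'_def by (simp add: torus_periodic_diff[OF per])
  qed (use M0 c0 in auto)
qed

section \<open>Fejer kernels and uniform approximation\<close>

definition cube :: "nat \<Rightarrow> (int ^ 'n) set" where
  "cube N = {m. \<forall>i. m $ i \<in> {0..<int N}}"

lemma finite_cube [simp]: "finite (cube N)"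
  unfolding cube_def by (rule finite_vec_set) simp

lemma card_cube: "card (cube N :: (int ^ 'n) set) = N ^ CARD('n)"
  using prod_sum_vec[of "{0..<int N}" "\<lambda>(_::'n) _. 1 :: nat"] by (simp add: cube_def)

text \<open>Divided by \<open>N ^ CARD('n)\<close>, this count is the Fejer multiplier at a unit
  frequency. The shift loses one face of the cube, a fraction \<open>1 / N\<close>.\<close>

lemma card_cube_shift:
  fixes j :: "'n::finite"
  assumes N: "N > 0"
  shows "card {m \<in> cube N. m + axis j 1 \<in> cube N} = (N - 1) * N ^ (CARD('n) - 1)"
proof -
  define f :: "'n \<Rightarrow> int \<Rightarrow> nat" where "f i k = (if i = j \<and> k = int N - 1 then 0 else 1)" for i k
  have *: "m + axis j 1 \<in> cube N \<longleftrightarrow> m $ j \<noteq> int N - 1" if "m \<in> cube N" for m :: "int ^ 'n"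
  proof
    assume "m + axis j 1 \<in> cube N"
    hence "m $ j + 1 < int N" by (auto simp: cube_def dest!: spec[of _ j])
    thus "m $ j \<noteq> int N - 1" by simp
  next
    assume ne: "m $ j \<noteq> int N - 1"
    have "0 \<le> (m + axis j 1) $ i \<and> (m + axis j 1) $ i < int N" for i
    proof -
      have "0 \<le> m $ i \<and> m $ i < int N" using that by (simp add: cube_def)
      thus ?thesis using ne by (cases "i = j") (auto simp: axis_def)
    qed
    thus "m + axis j 1 \<in> cube N" by (simp add: cube_def)
  qed
  have prod_f: "(\<Prod>i\<in>UNIV. f i (m $ i)) = (if m $ j \<noteq> int N - 1 then 1 else 0)" for m :: "int ^ 'n"
    by (simp add: prod.remove[of UNIV j] f_def)
  have "card {m \<in> cube N. m + axis j 1 \<in> cube N} = card {m \<in> cube N. m $ j \<noteq> int N - 1}"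
    using * by (intro arg_cong[where f = card]) blast
  also have "\<dots> = (\<Sum>m\<in>cube N. if m $ j \<noteq> int N - 1 then 1 else 0)"
    by (simp add: sum.If_cases Int_def)
  also have "\<dots> = (\<Sum>m | \<forall>i. m $ i \<in> {0..<int N}. \<Prod>i\<in>UNIV. f i (m $ i))"
    unfolding prod_f cube_def ..
  also have "\<dots> = (\<Prod>i\<in>UNIV. \<Sum>k\<in>{0..<int N}. f i k)"
    by (rule prod_sum_vec) simp
  also have "\<dots> = (\<Sum>k\<in>{0..<int N}. f j k) * (\<Prod>i\<in>UNIV - {j}. \<Sum>k\<in>{0..<int N}. f i k)"
    by (simp add: prod.remove[of UNIV j])
  also have "(\<Sum>k\<in>{0..<int N}. f j k) = N - 1"
  proof -
    have "(\<Sum>k\<in>{0..<int N}. f j k) = card ({0..<int N} - {int N - 1})"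
      by (simp add: f_def sum.If_cases Diff_eq Collect_neg_eq[symmetric])
    also have "\<dots> = N - 1" using N by (subst card_Diff_singleton) auto
    finally show ?thesis .
  qed
  also have "(\<Prod>i\<in>UNIV - {j}. \<Sum>k\<in>{0..<int N}. f i k) = N ^ (CARD('n) - 1)"
    by (simp add: f_def)
  finally show ?thesis .
qed

text \<open>The product of one-dimensional Fejer kernels, written as a squared modulus so that
  nonnegativity is immediate. Only differences of points of \<open>cube N\<close> enter, hence the
  one-sided cube.\<close>

definition fejer :: "nat \<Rightarrow> real ^ 'n \<Rightarrow> real" where
  "fejer N z = (norm (trig_poly (cube N) (\<lambda>_. 1) z))\<^sup>2 / real N ^ CARD('n)"

text \<open>Summing over pairs replaces the triangular weights by multiplicities. It is a function
  of coefficients, so that commuting with derivatives becomes a comparison of coefficients.\<close>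

definition fejer_sum :: "nat \<Rightarrow> (int ^ 'n \<Rightarrow> complex) \<Rightarrow> real ^ 'n \<Rightarrow> complex" where
  "fejer_sum N a x = (\<Sum>(k, l)\<in>cube N \<times> cube N. a (k - l) / of_nat N ^ CARD('n) * char_fun (k - l) x)"

lemma fejer_nonneg: "fejer N z \<ge> 0"
  by (simp add: fejer_def)

lemma continuous_on_fejer [continuous_intros]:
  "continuous_on A f \<Longrightarrow> continuous_on A (\<lambda>x. fejer N (f x))"
  unfolding fejer_def divide_inverse by (intro continuous_intros)

lemma fejer_eq:
  "complex_of_real (fejer N z) = (\<Sum>(k, l)\<in>cube N \<times> cube N. char_fun (k - l) z / of_nat N ^ CARD('n))"
  for z :: "real ^ 'n"
proof -
  have "complex_of_real ((norm (trig_poly (cube N) (\<lambda>_. 1) z))\<^sup>2)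
      = (\<Sum>k\<in>cube N. char_fun k z) * (\<Sum>l\<in>cube N. char_fun (- l) z)"
    by (simp only: complex_norm_square) (simp add: trig_poly_def char_fun_cnj)
  also have "\<dots> = (\<Sum>(k, l)\<in>cube N \<times> cube N. char_fun (k - l) z)"
    using char_fun_add[of _ "- _" z] by (simp add: sum_product sum.cartesian_product)
  finally show ?thesis
    by (simp add: fejer_def sum_divide_distrib case_prod_beta)
qed

lemma integral_mult_fejer:
  fixes g :: "real ^ 'n \<Rightarrow> complex"
  assumes g: "integrable torus g"
  shows "(\<integral>y. g y * of_real (fejer N (x - y)) \<partial>torus) = (2 * pi) ^ CARD('n) * fejer_sum N (fourier_coeff (dist_of g)) x"
proof -
  let ?N = "of_nat N ^ CARD('n) :: complex"
  have "(\<integral>y. g y * of_real (fejer N (x - y)) \<partial>torus)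
      = (\<integral>y. (\<Sum>p\<in>cube N \<times> cube N. g y * char_fun (- (fst p - snd p)) y * (char_fun (fst p - snd p) x / ?N)) \<partial>torus)"
    unfolding fejer_eq by (simp add: sum_distrib_left case_prod_beta char_fun_diff_right mult_ac)
  also have "\<dots> = (\<Sum>p\<in>cube N \<times> cube N. \<integral>y. g y * char_fun (- (fst p - snd p)) y * (char_fun (fst p - snd p) x / ?N) \<partial>torus)"
    by (intro Bochner_Integration.integral_sum integrable_mult_left integrable_mult_char_fun[OF g])
  also have "\<dots> = (\<Sum>p\<in>cube N \<times> cube N. (\<integral>y. g y * char_fun (- (fst p - snd p)) y \<partial>torus) * (char_fun (fst p - snd p) x / ?N))"
    by simp
  also have "\<dots> = (2 * pi) ^ CARD('n) * fejer_sum N (fourier_coeff (dist_of g)) x"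
    unfolding fejer_sum_def fourier_coeff_dist_of sum_distrib_left
    by (intro sum.cong) (auto simp: case_prod_beta)
  finally show ?thesis .
qed

lemma fejer_sum_char_fun:
  fixes m :: "int ^ 'n"
  assumes "N > 0"
  shows "fejer_sum N (fourier_coeff (dist_of (char_fun m))) x
    = of_nat (card {k \<in> cube N. k + m \<in> cube N}) / of_nat N ^ CARD('n) * char_fun m x"
proof -
  let ?N = "of_nat N ^ CARD('n) :: complex"
  have coeff: "fourier_coeff (dist_of (char_fun m)) k = (if k = m then 1 else 0)" for k
    unfolding fourier_coeff_def dist_of_char_fun_char_fun by simp
  have "fejer_sum N (fourier_coeff (dist_of (char_fun m))) x
      = (\<Sum>l\<in>cube N. \<Sum>k\<in>cube N. if k = l + m then char_fun m x / ?N else 0)"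
    unfolding fejer_sum_def coeff
    by (subst sum.cartesian_product[symmetric], subst sum.swap, intro sum.cong refl) auto
  also have "\<dots> = (\<Sum>l\<in>cube N. if l + m \<in> cube N then char_fun m x / ?N else 0)"
    by simp
  also have "\<dots> = of_nat (card {k \<in> cube N. k + m \<in> cube N}) * (char_fun m x / ?N)"
    by (simp add: sum.If_cases Int_def)
  finally show ?thesis by simp
qed

text \<open>Both integrals are read off from the multipliers of the kernel, \<open>1\<close> at
  frequency zero and \<open>1 - 1 / N\<close> at a unit frequency; their difference is the decay
  used in the Korovkin argument.\<close>

lemma fejer_moments:
  fixes x :: "real ^ 'n"
  assumes N: "N > 0"
  shows "(\<integral>y. fejer N (x - y) \<partial>torus) = (2 * pi) ^ CARD('n)"
    and "(\<integral>y. (1 - cos (x $ i - y $ i)) * fejer N (x - y) \<partial>torus) = (2 * pi) ^ CARD('n) / real N"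
proof -
  let ?V = "(2 * pi) ^ CARD('n) :: real"
  obtain p where p: "CARD('n) = Suc p"
    using zero_less_card_finite[where 'a = 'n] by (cases "CARD('n)") auto
  have char: "(\<integral>y. char_fun m y * of_real (fejer N (x - y)) \<partial>torus)
      = ?V * (of_nat (card {k \<in> cube N. k + m \<in> cube N}) / of_nat N ^ CARD('n) * char_fun m x)" for m :: "int ^ 'n"
    using N by (subst integral_mult_fejer)
      (auto simp: fejer_sum_char_fun intro!: torus_integrable_continuous continuous_intros)
  have "complex_of_real (\<integral>y. fejer N (x - y) \<partial>torus) = ?V"
    using char[of 0] N by (simp add: card_cube)
  thus 1: "(\<integral>y. fejer N (x - y) \<partial>torus) = ?V"
    unfolding of_real_eq_iff .
  define m :: "int ^ 'n" where "m = - axis i 1"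
  have inj: "card {k \<in> cube N. k + m \<in> cube N} = card {k \<in> cube N. k + axis i 1 \<in> cube N}"
    by (rule bij_betw_same_card[of "\<lambda>k. k + m"], rule bij_betw_byWitness[where f' = "\<lambda>k. k - m"]) (auto simp: m_def)
  have "(\<integral>y. char_fun (- m) (x - y) * of_real (fejer N (x - y)) \<partial>torus)
      = char_fun (- m) x * (\<integral>y. char_fun m y * of_real (fejer N (x - y)) \<partial>torus)"
    by (simp add: char_fun_diff_right mult.assoc)
  also have "\<dots> = ?V * (of_nat ((N - 1) * N ^ (CARD('n) - 1)) / of_nat N ^ CARD('n)) * (char_fun (- m) x * char_fun m x)"
    unfolding char inj card_cube_shift[OF N] by simp
  also have "char_fun (- m) x * char_fun m x = 1"
    by (simp flip: char_fun_add)
  also have "real ((N - 1) * N ^ (CARD('n) - 1)) / real N ^ CARD('n) = 1 - 1 / real N"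
    using N unfolding p by (simp add: of_nat_diff field_simps)
  finally have char_m: "(\<integral>y. char_fun (- m) (x - y) * of_real (fejer N (x - y)) \<partial>torus) = of_real (?V * (1 - 1 / real N))"
    by (simp only: mult_1_right)
  have Re_char: "Re (char_fun (- m) z * of_real t) = cos (z $ i) * t" for z t
    by (simp add: char_fun_def m_def freq_axis inner_commute[of _ z] inner_axis)
  have "(\<integral>y. Re (char_fun (- m) (x - y) * of_real (fejer N (x - y))) \<partial>torus)
      = Re (\<integral>y. char_fun (- m) (x - y) * of_real (fejer N (x - y)) \<partial>torus)"
    by (intro integral_Re torus_integrable_continuous continuous_intros)
  hence 2: "(\<integral>y. cos (x $ i - y $ i) * fejer N (x - y) \<partial>torus) = ?V * (1 - 1 / real N)"
    unfolding Re_char char_m Re_complex_of_real vector_minus_component .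
  have "(\<integral>y. (1 - cos (x $ i - y $ i)) * fejer N (x - y) \<partial>torus)
      = (\<integral>y. fejer N (x - y) \<partial>torus) - (\<integral>y. cos (x $ i - y $ i) * fejer N (x - y) \<partial>torus)"
    by (subst Bochner_Integration.integral_diff[symmetric])
      (auto intro!: torus_integrable_continuous continuous_intros simp: algebra_simps)
  thus "(\<integral>y. (1 - cos (x $ i - y $ i)) * fejer N (x - y) \<partial>torus) = ?V / real N"
    unfolding 1 2 by (simp add: algebra_simps)
qed

text \<open>As the kernel has total mass \<open>?V\<close>, the error is an average of
  \<open>\<psi> x - \<psi> y\<close>. Integrating the modulus inequality against the nonnegative
  kernel leaves \<open>\<epsilon> / 2\<close> plus a multiple of \<open>1 / N\<close>, uniformly in
  \<open>x\<close>.\<close>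

lemma fejer_sum_uniform:
  fixes \<psi> :: "real ^ 'n \<Rightarrow> complex"
  assumes cont: "continuous_on UNIV \<psi>" and per: "torus_periodic \<psi>" and \<epsilon>: "\<epsilon> > 0"
  shows "\<forall>\<^sub>F N in sequentially. \<forall>x. norm (\<psi> x - fejer_sum N (fourier_coeff (dist_of \<psi>)) x) \<le> \<epsilon>"
proof -
  let ?V = "(2 * pi) ^ CARD('n) :: real"
  obtain C where C: "C \<ge> 0" "\<And>x y. norm (\<psi> x - \<psi> y) \<le> \<epsilon> / 2 + C * (\<Sum>i\<in>UNIV. 1 - cos (x $ i - y $ i))"
    using periodic_modulus[OF cont per, of "\<epsilon> / 2"] \<epsilon> by auto
  have bound: "norm (\<psi> x - fejer_sum N (fourier_coeff (dist_of \<psi>)) x) \<le> \<epsilon> / 2 + C * CARD('n) / N" if N: "N > 0" for N x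
  proof -
    note ci = torus_integrable_continuous continuous_intros continuous_on_compose2[OF cont]
    have "of_real ?V * (\<psi> x - fejer_sum N (fourier_coeff (dist_of \<psi>)) x)
        = \<psi> x * of_real (\<integral>y. fejer N (x - y) \<partial>torus) - (\<integral>y. \<psi> y * of_real (fejer N (x - y)) \<partial>torus)"
      using N by (simp add: fejer_moments integral_mult_fejer torus_integrable_continuous[OF cont] algebra_simps)
    also have "\<dots> = (\<integral>y. (\<psi> x - \<psi> y) * of_real (fejer N (x - y)) \<partial>torus)"
      unfolding left_diff_distrib
      by (subst Bochner_Integration.integral_diff) (auto intro!: ci)
    also have "norm \<dots> \<le> (\<integral>y. norm ((\<psi> x - \<psi> y) * of_real (fejer N (x - y))) \<partial>torus)"
      by (rule integral_norm_bound)
    also have "\<dots> \<le> (\<integral>y. \<epsilon> / 2 * fejer N (x - y) + (\<Sum>i\<in>UNIV. C * ((1 - cos (x $ i - y $ i)) * fejer N (x - y))) \<partial>torus)"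
    proof (rule integral_mono)
      fix y
      have "norm (\<psi> x - \<psi> y) * fejer N (x - y) \<le> (\<epsilon> / 2 + C * (\<Sum>i\<in>UNIV. 1 - cos (x $ i - y $ i))) * fejer N (x - y)"
        by (intro mult_right_mono C fejer_nonneg)
      thus "norm ((\<psi> x - \<psi> y) * of_real (fejer N (x - y))) \<le> \<epsilon> / 2 * fejer N (x - y) + (\<Sum>i\<in>UNIV. C * ((1 - cos (x $ i - y $ i)) * fejer N (x - y)))"
        by (simp add: norm_mult fejer_nonneg distrib_right sum_distrib_left sum_distrib_right mult.assoc)
    qed (auto intro!: ci)
    also have "\<dots> = \<epsilon> / 2 * (\<integral>y. fejer N (x - y) \<partial>torus) + (\<Sum>i\<in>UNIV. C * (\<integral>y. (1 - cos (x $ i - y $ i)) * fejer N (x - y) \<partial>torus))"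
      by (subst Bochner_Integration.integral_add, (auto intro!: ci)[2], subst Bochner_Integration.integral_sum)
        (auto intro!: ci)
    also have "\<dots> = ?V * (\<epsilon> / 2 + C * CARD('n) / N)"
      unfolding fejer_moments[OF N] by (simp add: algebra_simps)
    finally have "?V * norm (\<psi> x - fejer_sum N (fourier_coeff (dist_of \<psi>)) x) \<le> ?V * (\<epsilon> / 2 + C * CARD('n) / N)"
      by (simp add: norm_mult norm_power)
    thus ?thesis by (subst (asm) mult_le_cancel_left_pos) simp_all
  qed
  have "(\<lambda>N. C * CARD('n) / real N) \<longlonglongrightarrow> 0"
    by (intro tendsto_divide_0[OF tendsto_const] filterlim_real_sequentially[THEN filterlim_at_top_imp_at_infinity])
  hence "\<forall>\<^sub>F N in sequentially. C * CARD('n) / real N < \<epsilon> / 2"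
    by (rule order_tendstoD(2)) (use \<epsilon> in simp)
  thus ?thesis
    using eventually_gt_at_top[of 0]
  proof eventually_elim
    case (elim N)
    show ?case
    proof
      fix x show "norm (\<psi> x - fejer_sum N (fourier_coeff (dist_of \<psi>)) x) \<le> \<epsilon>"
        using bound[of N x] elim by linarith
    qed
  qed
qed

text \<open>The modulus inequality with \<open>y = 0\<close> suffices, since each
  \<open>1 - cos\<close> is at most \<open>2\<close>.\<close>

lemma periodic_bounded:
  fixes \<psi> :: "real ^ 'n \<Rightarrow> complex"
  assumes "continuous_on UNIV \<psi>" "torus_periodic \<psi>"
  obtains B where "\<And>x. norm (\<psi> x) \<le> B"
proof -
  obtain C where C: "C \<ge> 0" "\<And>x y. norm (\<psi> x - \<psi> y) \<le> 1 + C * (\<Sum>i\<in>UNIV. 1 - cos (x $ i - y $ i))"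
    using periodic_modulus[OF assms, of 1] by auto
  have "norm (\<psi> x) \<le> norm (\<psi> 0) + (1 + C * (\<Sum>i\<in>(UNIV :: 'n set). 2))" for x
  proof -
    have "1 - cos t \<le> 2" for t :: real
      using cos_ge_minus_one[of t] by linarith
    hence "(\<Sum>i\<in>UNIV. 1 - cos (x $ i - 0 $ i)) \<le> (\<Sum>i\<in>(UNIV :: 'n set). 2)"
      by (intro sum_mono)
    hence "norm (\<psi> x - \<psi> 0) \<le> 1 + C * (\<Sum>i\<in>(UNIV :: 'n set). 2)"
      by (intro order_trans[OF C(2)] add_left_mono mult_left_mono C(1))
    thus ?thesis
      using norm_triangle_sub[of "\<psi> x" "\<psi> 0"] by linarith
  qed
  thus ?thesis by (rule that)
qed

section \<open>Fejer means of test functions and uniqueness of Fourier coefficients\<close>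

lemma test_funs_sum:
  assumes "finite I" "\<And>i. i \<in> I \<Longrightarrow> \<phi> i \<in> test_funs"
  shows "(\<lambda>x. \<Sum>i\<in>I. \<phi> i x) \<in> test_funs"
  using assms
proof (induction rule: finite_induct)
  case empty
  show ?case
    using test_funs_cmult[OF char_fun_test_funs[of 0], of 0] by simp
qed (simp add: test_funs_add)

lemma foldr_partial_sum:
  assumes "finite I" "\<And>i. i \<in> I \<Longrightarrow> \<phi> i \<in> test_funs"
  shows "foldr partial js (\<lambda>x. \<Sum>i\<in>I. \<phi> i x) = (\<lambda>x. \<Sum>i\<in>I. foldr partial js (\<phi> i) x)"
  using assms
proof (induction rule: finite_induct)
  case empty
  show ?case
    using foldr_partial_cmult[OF char_fun_test_funs[of 0], of js 0] by simp
qed (simp add: foldr_partial_add test_funs_sum)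

lemma fejer_sum_test_funs: "fejer_sum N a \<in> test_funs"
  unfolding fejer_sum_def case_prod_beta
  by (intro test_funs_sum test_funs_cmult) auto

text \<open>Integration by parts: the derivative of the periodic function
  \<open>\<psi> x * char_fun (- m) x\<close> integrates to zero, and the product rule does the
  rest.\<close>

lemma fourier_coeff_partial:
  assumes \<psi>: "\<psi> \<in> test_funs"
  shows "fourier_coeff (dist_of (partial j \<psi>)) m = \<i> * of_int (m $ j) * fourier_coeff (dist_of \<psi>) m"
proof -
  let ?h = "\<lambda>x. \<psi> x * char_fun (- m) x"
  have deriv: "(?h has_derivative (\<lambda>h. \<psi> x * (of_real (freq (- m) \<bullet> h) * (\<i> * char_fun (- m) x))
      + frechet_derivative \<psi> (at x) h * char_fun (- m) x)) (at x)" for x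
    by (intro has_derivative_mult test_funs_has_derivative \<psi> has_derivative_char_fun)
  have "partial j ?h x = partial j \<psi> x * char_fun (- m) x - \<i> * of_int (m $ j) * (\<psi> x * char_fun (- m) x)" for x
    unfolding partial_eq[OF deriv] by (simp add: inner_axis partial_def algebra_simps)
  hence part: "partial j ?h = (\<lambda>x. partial j \<psi> x * char_fun (- m) x - \<i> * of_int (m $ j) * (\<psi> x * char_fun (- m) x))"
    by blast
  have c: "continuous_on UNIV \<psi>" "continuous_on UNIV (partial j \<psi>)"
    using test_funs_continuous \<psi> partial_test_funs by blast+
  have int: "integrable torus (\<lambda>x. partial j \<psi> x * char_fun (- m) x)" "integrable torus (\<lambda>x. \<psi> x * char_fun (- m) x)"
    by (intro integrable_mult_char_fun torus_integrable_continuous c)+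
  have "torus_periodic ?h"
    using test_funs_periodic[OF \<psi>] torus_periodic_char_fun[of "- m"] by (simp add: torus_periodic_def)
  moreover have "?h differentiable (at x)" for x
    using deriv differentiableI by blast
  moreover have "continuous_on UNIV (partial j ?h)"
    unfolding part by (intro continuous_intros c)
  ultimately have "(\<integral>x. partial j ?h x \<partial>torus) = 0"
    by (rule integral_partial_eq_0)
  hence "(\<integral>x. partial j \<psi> x * char_fun (- m) x \<partial>torus) = \<i> * of_int (m $ j) * (\<integral>x. \<psi> x * char_fun (- m) x \<partial>torus)"
    unfolding part using int by simp
  thus ?thesis
    by (simp add: fourier_coeff_dist_of)
qed

text \<open>Differentiation multiplies each coefficient by the same factor before and after
  averaging. Uniform approximation of every derivative thus reduces to uniform approximation of one
  continuous function at a time.\<close>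

lemma foldr_partial_fejer_sum:
  assumes \<psi>: "\<psi> \<in> test_funs"
  shows "foldr partial js (fejer_sum N (fourier_coeff (dist_of \<psi>))) = fejer_sum N (fourier_coeff (dist_of (foldr partial js \<psi>)))"
proof -
  have coeff: "fourier_coeff (dist_of (foldr partial js \<psi>)) m = (\<Prod>j\<leftarrow>js. \<i> * of_int (m $ j)) * fourier_coeff (dist_of \<psi>) m" for m
    by (induction js) (simp_all add: fourier_coeff_partial foldr_partial_test_funs \<psi>)
  show ?thesis
    unfolding fejer_sum_def case_prod_beta
    by (subst foldr_partial_sum, simp, rule test_funs_cmult, simp)
      (simp only: foldr_partial_cmult[OF char_fun_test_funs] foldr_partial_char_fun coeff, simp add: mult_ac)
qed

lemma distribution_add:
  "u \<in> distributions \<Longrightarrow> \<phi> \<in> test_funs \<Longrightarrow> \<psi> \<in> test_funs \<Longrightarrow> u (\<lambda>x. \<phi> x + \<psi> x) = u \<phi> + u \<psi>"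
  by (simp add: distributions_def)

lemma distribution_cmult:
  "u \<in> distributions \<Longrightarrow> \<phi> \<in> test_funs \<Longrightarrow> u (\<lambda>x. c * \<phi> x) = c * u \<phi>"
  by (simp add: distributions_def)

lemma distribution_sum:
  assumes u: "u \<in> distributions" and "finite I" "\<And>i. i \<in> I \<Longrightarrow> \<phi> i \<in> test_funs"
  shows "u (\<lambda>x. \<Sum>i\<in>I. c i * \<phi> i x) = (\<Sum>i\<in>I. c i * u (\<phi> i))"
  using assms(2,3)
proof (induction rule: finite_induct)
  case empty
  show ?case
    using distribution_cmult[OF u char_fun_test_funs[of 0], of 0] by simp
next
  case (insert i I)
  have "u (\<lambda>x. c i * \<phi> i x + (\<Sum>i\<in>I. c i * \<phi> i x)) = u (\<lambda>x. c i * \<phi> i x) + u (\<lambda>x. \<Sum>i\<in>I. c i * \<phi> i x)"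
    by (intro distribution_add u test_funs_cmult test_funs_sum insert) auto
  moreover have "u (\<lambda>x. c i * \<phi> i x) = c i * u (\<phi> i)"
    by (intro distribution_cmult u insert) auto
  ultimately show ?case
    using insert by simp
qed

text \<open>Both functionals agree on characters, hence on the Fejer means of a test function. These
  converge uniformly together with all derivatives up to the order \<open>R\<close> of
  \<open>u\<close>, so continuity of \<open>u\<close> and integrability of \<open>g\<close> carry
  the equality to the limit.\<close>

lemma distribution_eqI:
  fixes u :: "(real ^ 'n \<Rightarrow> complex) \<Rightarrow> complex"
  assumes u: "u \<in> distributions" and g: "integrable torus g"
    and coeff: "\<And>m. fourier_coeff u m = fourier_coeff (dist_of g) m"
  shows "u = dist_of g"
proof
  fix \<phi> :: "real ^ 'n \<Rightarrow> complex"
  show "u \<phi> = dist_of g \<phi>"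
  proof (cases "\<phi> \<in> test_funs")
    case False
    thus ?thesis
      using u by (simp add: distributions_def extensional_def dist_of_def)
  next
    case \<phi>: True
    obtain R B where RB: "\<And>\<phi>. \<phi> \<in> test_funs \<Longrightarrow> norm (u \<phi>) \<le> B * (\<Sum>js | length js \<le> R. SUP x. norm (foldr partial js \<phi> x))"
      using u unfolding distributions_def by blast
    let ?J = "{js :: 'n list. length js \<le> R}"
    have J: "finite ?J"
      using finite_lists_length_le[of "UNIV :: 'n set" R] by simp
    define p where "p N = fejer_sum N (fourier_coeff (dist_of \<phi>))" for N
    have p: "p N \<in> test_funs" for N
      unfolding p_def by (rule fejer_sum_test_funs)
    have u_char: "u (char_fun m) = (\<integral>x. g x * char_fun m x \<partial>torus)" for m
      using coeff[of "- m"] by (simp add: fourier_coeff_def dist_of_char_fun)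
    have up: "u (p N) = (\<integral>x. g x * p N x \<partial>torus)" for N
    proof -
      let ?I = "cube N \<times> cube N :: ((int ^ 'n) \<times> (int ^ 'n)) set"
      define c where "c q = fourier_coeff (dist_of \<phi>) (fst q - snd q) / of_nat N ^ CARD('n)" for q
      have p_eq: "p N = (\<lambda>x. \<Sum>q\<in>?I. c q * char_fun (fst q - snd q) x)"
        by (simp add: p_def fejer_sum_def c_def case_prod_beta fun_eq_iff)
      have "u (p N) = (\<Sum>q\<in>?I. c q * (\<integral>x. g x * char_fun (fst q - snd q) x \<partial>torus))"
        unfolding p_eq u_char[symmetric] by (rule distribution_sum[OF u]) auto
      also have "\<dots> = (\<Sum>q\<in>?I. \<integral>x. c q * (g x * char_fun (fst q - snd q) x) \<partial>torus)"
        by simp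
      also have "\<dots> = (\<integral>x. (\<Sum>q\<in>?I. c q * (g x * char_fun (fst q - snd q) x)) \<partial>torus)"
        by (intro Bochner_Integration.integral_sum[symmetric] integrable_mult_right integrable_mult_char_fun g)
      also have "\<dots> = (\<integral>x. g x * p N x \<partial>torus)"
        by (simp add: p_eq sum_distrib_left mult_ac)
      finally show ?thesis .
    qed
    define C where "C = \<bar>B\<bar> * card ?J + L1_norm g"
    have bound: "norm (u \<phi> - dist_of g \<phi>) \<le> \<epsilon> * C" if \<epsilon>: "\<epsilon> > 0" for \<epsilon>
    proof -
      have "\<forall>\<^sub>F N in sequentially. \<forall>js\<in>?J. \<forall>x. norm (foldr partial js \<phi> x - fejer_sum N (fourier_coeff (dist_of (foldr partial js \<phi>))) x) \<le> \<epsilon>"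
        by (intro eventually_ball_finite J ballI fejer_sum_uniform \<epsilon> test_funs_continuous test_funs_periodic foldr_partial_test_funs \<phi>)
      then obtain N where N: "\<And>js x. js \<in> ?J \<Longrightarrow> norm (foldr partial js \<phi> x - foldr partial js (p N) x) \<le> \<epsilon>"
        unfolding p_def foldr_partial_fejer_sum[OF \<phi>] eventually_sequentially by blast
      define \<rho> where "\<rho> x = \<phi> x + (- 1) * p N x" for x
      have mp: "(\<lambda>x. (- 1) * p N x) \<in> test_funs"
        by (rule test_funs_cmult[OF p])
      have \<rho>: "\<rho> \<in> test_funs"
        unfolding \<rho>_def by (rule test_funs_add[OF \<phi> mp])
      have \<rho>_le: "norm (foldr partial js \<rho> x) \<le> \<epsilon>" if "js \<in> ?J" for js x
        unfolding \<rho>_def foldr_partial_add[OF \<phi> mp] foldr_partial_cmult[OF p]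
        using N[OF that, of x] by simp
      \<comment> \<open>Nonnegativity is needed to replace \<open>B\<close> by its absolute value:
        the definition of \<open>distributions\<close> leaves the sign of \<open>B\<close>
        open.\<close>
      have sup: "0 \<le> (SUP x. norm (foldr partial js \<rho> x))" "(SUP x. norm (foldr partial js \<rho> x)) \<le> \<epsilon>" if "js \<in> ?J" for js
      proof -
        have "bdd_above (range (\<lambda>x. norm (foldr partial js \<rho> x)))"
          using \<rho>_le[OF that] by (auto simp: bdd_above_def)
        from cSUP_upper[OF UNIV_I this, of 0] show "0 \<le> (SUP x. norm (foldr partial js \<rho> x))"
          by (rule order_trans[OF norm_ge_zero])
        show "(SUP x. norm (foldr partial js \<rho> x)) \<le> \<epsilon>"
          using \<rho>_le[OF that] by (intro cSUP_least) auto
      qed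
      have "norm (u \<rho>) \<le> B * (\<Sum>js\<in>?J. SUP x. norm (foldr partial js \<rho> x))"
        by (rule RB[OF \<rho>])
      also have "\<dots> \<le> \<bar>B\<bar> * (\<Sum>js\<in>?J. SUP x. norm (foldr partial js \<rho> x))"
        by (intro mult_right_mono sum_nonneg sup) auto
      also have "\<dots> \<le> \<bar>B\<bar> * (\<Sum>js\<in>?J. \<epsilon>)"
        by (intro mult_left_mono sum_mono sup) auto
      finally have 1: "norm (u \<rho>) \<le> \<epsilon> * (\<bar>B\<bar> * card ?J)"
        by (simp add: mult_ac)
      have u\<rho>: "u \<rho> = u \<phi> - u (p N)"
      proof -
        have "u \<rho> = u \<phi> + u (\<lambda>x. (- 1) * p N x)"
          unfolding \<rho>_def by (rule distribution_add[OF u \<phi> mp])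
        also have "u (\<lambda>x. (- 1) * p N x) = (- 1) * u (p N)"
          by (rule distribution_cmult[OF u p])
        finally show ?thesis by simp
      qed
      have cont\<rho>: "continuous_on UNIV \<rho>" by (rule test_funs_continuous[OF \<rho>])
      have 0: "norm (\<rho> x) \<le> \<epsilon>" for x
        using \<rho>_le[of "[]"] by simp
      have int: "integrable torus (\<lambda>x. g x * \<rho> x)" "integrable torus (\<lambda>x. g x * p N x)"
      proof -
        show "integrable torus (\<lambda>x. g x * \<rho> x)"
          by (rule integrable_mult_continuous[OF g cont\<rho> 0])
        have "(\<lambda>x. g x * p N x) = (\<lambda>x. \<Sum>q\<in>cube N \<times> cube N. fourier_coeff (dist_of \<phi>) (fst q - snd q) / of_nat N ^ CARD('n) * (g x * char_fun (fst q - snd q) x))"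
          by (simp add: p_def fejer_sum_def case_prod_beta sum_distrib_left mult_ac)
        thus "integrable torus (\<lambda>x. g x * p N x)"
          by (simp only:) (intro Bochner_Integration.integrable_sum integrable_mult_right integrable_mult_char_fun g)
      qed
      have "dist_of g \<phi> = (\<integral>x. g x * \<rho> x + g x * p N x \<partial>torus)"
        using \<phi> by (simp add: dist_of_def \<rho>_def algebra_simps)
      also have "\<dots> = (\<integral>x. g x * \<rho> x \<partial>torus) + u (p N)"
        unfolding up by (rule Bochner_Integration.integral_add[OF int])
      finally have "u \<phi> - dist_of g \<phi> = u \<rho> - (\<integral>x. g x * \<rho> x \<partial>torus)"
        by (simp add: u\<rho>)
      also have "norm \<dots> \<le> norm (u \<rho>) + norm (\<integral>x. g x * \<rho> x \<partial>torus)"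
        by (rule norm_triangle_ineq4)
      also have "\<dots> \<le> \<epsilon> * (\<bar>B\<bar> * card ?J) + \<epsilon> * L1_norm g"
        unfolding L1_norm_def by (intro add_mono 1 norm_integral_mult_le[OF g cont\<rho> 0])
      finally show ?thesis by (simp add: C_def algebra_simps)
    qed
    have C: "C \<ge> 0"
      by (simp add: C_def L1_norm_def)
    have "norm (u \<phi> - dist_of g \<phi>) \<le> 0"
    proof (rule field_le_epsilon)
      fix e :: real assume e: "e > 0"
      have "norm (u \<phi> - dist_of g \<phi>) \<le> e / (C + 1) * C"
        using bound[of "e / (C + 1)"] e C by simp
      also have "\<dots> \<le> 0 + e"
        using e C by (simp add: field_simps)
      finally show "norm (u \<phi> - dist_of g \<phi>) \<le> 0 + e" .
    qed
    thus ?thesis by simp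
  qed
qed

subsection \<open>The a priori estimate\<close>

text \<open>The weight is split as \<open>sqrt (\<omega> m) * sqrt (\<omega> m)\<close>, one root
  for each sequence.\<close>

lemma weighted_cauchy_schwarz:
  fixes c p q :: "'a \<Rightarrow> complex"
  assumes c: "\<And>m. m \<in> E \<Longrightarrow> norm (c m) \<le> \<omega> m"
  shows "norm (\<Sum>m\<in>E. c m * p m * cnj (q m))
    \<le> L2_set (\<lambda>m. sqrt (\<omega> m) * norm (p m)) E * L2_set (\<lambda>m. sqrt (\<omega> m) * norm (q m)) E"
proof -
  have "norm (\<Sum>m\<in>E. c m * p m * cnj (q m)) \<le> (\<Sum>m\<in>E. \<bar>sqrt (\<omega> m) * norm (p m)\<bar> * \<bar>sqrt (\<omega> m) * norm (q m)\<bar>)"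
  proof (intro order_trans[OF norm_sum] sum_mono)
    fix m assume m: "m \<in> E"
    have \<omega>: "\<omega> m \<ge> 0" using order_trans[OF norm_ge_zero c[OF m]] .
    have "norm (c m) * (norm (p m) * norm (q m)) \<le> \<omega> m * (norm (p m) * norm (q m))"
      by (intro mult_right_mono c m) simp
    also have "\<omega> m = sqrt (\<omega> m) * sqrt (\<omega> m)"
      using \<omega> by simp
    also have "\<dots> * (norm (p m) * norm (q m)) = (sqrt (\<omega> m) * norm (p m)) * (sqrt (\<omega> m) * norm (q m))"
      by (simp only: mult_ac)
    also have "\<dots> = \<bar>sqrt (\<omega> m) * norm (p m)\<bar> * \<bar>sqrt (\<omega> m) * norm (q m)\<bar>"
      using \<omega> by simp
    finally show "norm (c m * p m * cnj (q m)) \<le> \<bar>sqrt (\<omega> m) * norm (p m)\<bar> * \<bar>sqrt (\<omega> m) * norm (q m)\<bar>"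
      by (simp only: norm_mult complex_mod_cnj mult.assoc)
  qed
  also have "\<dots> \<le> L2_set (\<lambda>m. sqrt (\<omega> m) * norm (p m)) E * L2_set (\<lambda>m. sqrt (\<omega> m) * norm (q m)) E"
    by (rule L2_set_mult_ineq)
  finally show ?thesis .
qed

text \<open>Bessel's inequality for the underlying \<open>L^2\<close> function makes the series in
  \<open>H_neg_norm\<close> summable. This must be known before partial sums can be compared with
  it, since \<open>infsum\<close> of a non-summable family is zero.\<close>

lemma H_neg_coeff_bound:
  fixes f :: "(real ^ 'n \<Rightarrow> complex) \<Rightarrow> complex"
  assumes "f \<in> H_neg" and E: "finite E" "0 \<notin> E"
  shows "(\<Sum>m\<in>E. (norm (fourier_coeff f m))\<^sup>2 / norm (freq m) ^ CARD('n)) \<le> (H_neg_norm f)\<^sup>2"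
proof -
  obtain g where g: "g \<in> L2_funs" and f: "f = frac_laplacian (dist_of g)"
    using assms(1) by (auto simp: H_neg_def)
  define T where "T m = norm (freq m) powr (- real CARD('n)) * (norm (fourier_coeff f m))\<^sup>2" for m
  have T_eq: "T m = (norm (fourier_coeff f m))\<^sup>2 / norm (freq m) ^ CARD('n)" if "m \<noteq> 0" for m
    using that by (simp add: T_def powr_minus powr_realpow divide_inverse mult.commute)
  have T_le: "T m \<le> (norm (fourier_coeff (dist_of g) m))\<^sup>2" for m
  proof (cases "m = 0")
    case False
    have "(norm (freq m) powr (real CARD('n) / 2))\<^sup>2 = norm (freq m) ^ CARD('n)"
      using False by (simp add: powr_power powr_realpow)
    thus ?thesis
      using False unfolding T_eq[OF False] f frac_laplacian_def fourier_coeff_multiplier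
      by (simp add: norm_mult power_mult_distrib)
  qed (simp add: T_def)
  have T0: "T m \<ge> 0" for m by (simp add: T_def)
  have summable: "T summable_on - {0}"
  proof (rule nonneg_bdd_above_summable_on)
    have "(\<Sum>m\<in>F. T m) \<le> (\<integral>x. (norm (g x))\<^sup>2 \<partial>torus) / (2 * pi) ^ CARD('n)" if "finite F" for F
    proof -
      have "(\<Sum>m\<in>F. T m) \<le> (\<Sum>m\<in>F. (norm (fourier_coeff (dist_of g) m))\<^sup>2)"
        by (rule sum_mono) (rule T_le)
      also have "\<dots> \<le> (\<integral>x. (norm (g x))\<^sup>2 \<partial>torus) / (2 * pi) ^ CARD('n)"
        using bessel_inequality[OF g that] by (subst pos_le_divide_eq) (simp_all add: mult.commute)
      finally show ?thesis .
    qed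
    thus "bdd_above (sum T ` {F. F \<subseteq> - {0} \<and> finite F})"
      by (auto simp: bdd_above_def)
  qed (rule T0)
  have "(\<Sum>m\<in>E. (norm (fourier_coeff f m))\<^sup>2 / norm (freq m) ^ CARD('n)) = (\<Sum>m\<in>E. T m)"
    using E by (intro sum.cong refl T_eq[symmetric]) auto
  also have "\<dots> \<le> (\<Sum>\<^sub>\<infinity>m\<in>- {0}. T m)"
    using E by (intro finite_sum_le_infsum summable T0) auto
  also have "\<dots> = (H_neg_norm f)\<^sup>2"
    unfolding H_neg_norm_def T_def[symmetric] by (simp add: infsum_nonneg T0)
  finally show ?thesis .
qed

lemma H_neg_norm_nonneg: "H_neg_norm f \<ge> 0"
  unfolding H_neg_norm_def by (intro real_sqrt_ge_zero infsum_nonneg) simp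

text \<open>Stated for arbitrary decompositions and finite sets of frequencies, with one constant
  for all: infima and infinite sums are left for later. With \<open>M\<close> the total size of the
  decompositions, the weighted energy \<open>X ^ 2\<close> is bounded by a multiple of
  \<open>M ^ 2\<close> plus a multiple of \<open>M * X\<close>, which controls
  \<open>X\<close>.\<close>

lemma main_estimate:
  "\<exists>C>0. \<forall>(v :: (real ^ 'n \<Rightarrow> complex) \<Rightarrow> complex) g0 f0 g f F.
     g0 \<in> L1_funs \<longrightarrow> f0 \<in> H_neg \<longrightarrow> (\<forall>j. g j \<in> L1_funs) \<longrightarrow> (\<forall>j. f j \<in> H_neg) \<longrightarrow>
     v = dist_add (dist_of g0) f0 \<longrightarrow> (\<forall>j. riesz j v = dist_add (dist_of (g j)) (f j)) \<longrightarrow>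
     finite F \<longrightarrow> 0 \<notin> F \<longrightarrow>
     (\<Sum>m\<in>F. (norm (fourier_coeff v m))\<^sup>2 / norm (freq m) ^ CARD('n))
       \<le> (C * (L1_norm g0 + H_neg_norm f0 + (\<Sum>j\<in>UNIV. L1_norm (g j) + H_neg_norm (f j))))\<^sup>2"
proof -
  let ?n = "CARD('n)"
  obtain B where B: "B \<ge> 0" "\<And>(j :: 'n) K. \<exists>L0. \<forall>L\<ge>L0. \<forall>z.
     norm (\<Sum>m\<in>fbox L. of_real (of_int (m $ j) * dyadic_weight K m) * char_fun m (z :: real ^ 'n)) \<le> B"
    using kernel_bounded[where 'n = 'n] by blast
  define c1 :: real where "c1 = 6 * fact (?n + 2)"
  define c0 :: real where "c0 = 1 / (2 * (4 * ?n) ^ (?n + 1))"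
  have c01: "c0 > 0" "c1 > 0" by (simp_all add: c0_def c1_def)
  define s where "s = sqrt c1"
  have s: "s > 0" using c01 by (simp add: s_def)
  \<comment> \<open>Obtained from
    \<open>X ^ 2 \<le> (B + s ^ 2) * M ^ 2 + (1 + n) * s * M * X\<close>: the last product is at
    most half the sum of two squares, and \<open>X ^ 2 / 2\<close> moves to the left.\<close>
  define C1 where "C1 = 2 * (B + s\<^sup>2) + ((1 + ?n) * s)\<^sup>2"
  have C1: "C1 > 0" using s B unfolding C1_def by (intro add_pos_nonneg mult_pos_pos add_nonneg_pos) auto
  show ?thesis
  proof (intro exI[of _ "sqrt (C1 / c0)"] conjI allI impI)
    show "sqrt (C1 / c0) > 0" using C1 c01 by simp
    fix v :: "(real ^ 'n \<Rightarrow> complex) \<Rightarrow> complex" and g0 f0 g f and F :: "(int ^ 'n) set"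
    assume L1: "g0 \<in> L1_funs" "\<forall>j. g j \<in> L1_funs" and H: "f0 \<in> H_neg" "\<forall>j. f j \<in> H_neg"
      and v: "v = dist_add (dist_of g0) f0" "\<forall>j. riesz j v = dist_add (dist_of (g j)) (f j)"
      and F: "finite F" "0 \<notin> F"
    define a where "a = fourier_coeff v"
    define \<phi>0 where "\<phi>0 = fourier_coeff f0"
    define \<phi> where "\<phi> j = fourier_coeff (f j)" for j
    define h0 where "h0 = H_neg_norm f0"
    define h where "h j = H_neg_norm (f j)" for j
    have g0: "integrable torus g0" and g: "integrable torus (g j)" for j
      using L1 by (simp_all add: L1_funs_def)
    have h0: "h0 \<ge> 0" and h: "h j \<ge> 0" for j
      by (simp_all add: h0_def h_def H_neg_norm_nonneg)
    have a: "a m = fourier_coeff (dist_of g0) m + \<phi>0 m" for m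
      unfolding a_def \<phi>0_def v(1) by (rule fourier_coeff_dist_add)
    have b: "\<i> * of_real (of_int (m $ j) / norm (freq m)) * a m = fourier_coeff (dist_of (g j)) m + \<phi> j m" for j m
    proof -
      have "fourier_coeff (riesz j v) m = \<i> * of_real (of_int (m $ j) / norm (freq m)) * a m"
        unfolding riesz_def fourier_coeff_multiplier a_def by simp
      thus ?thesis
        by (simp add: v(2) fourier_coeff_dist_add \<phi>_def)
    qed
    have \<phi>0: "(\<Sum>m\<in>E. (norm (\<phi>0 m))\<^sup>2 / norm (freq m) ^ ?n) \<le> h0\<^sup>2" if "finite E" "0 \<notin> E" for E
      unfolding \<phi>0_def h0_def using H that by (intro H_neg_coeff_bound)
    have \<phi>: "(\<Sum>m\<in>E. (norm (\<phi> j m))\<^sup>2 / norm (freq m) ^ ?n) \<le> (h j)\<^sup>2" if "finite E" "0 \<notin> E" for j E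
      unfolding \<phi>_def h_def using H that by (intro H_neg_coeff_bound) auto
    define G0 where "G0 = L1_norm g0"
    define G where "G j = L1_norm (g j)" for j
    have G: "G0 \<ge> 0" "\<And>j. G j \<ge> 0" by (simp_all add: G0_def G_def L1_norm_def)
    define M where "M = G0 + h0 + (\<Sum>j\<in>UNIV. G j + h j)"
    have sums: "(\<Sum>j\<in>UNIV. G j) \<ge> 0" "(\<Sum>j\<in>UNIV. h j) \<ge> 0"
      using G h by (auto intro: sum_nonneg)
    have M: "G0 \<le> M" "h0 \<le> M" "(\<Sum>j\<in>UNIV. G j) \<le> M" "(\<Sum>j\<in>UNIV. h j) \<le> M" "0 \<le> M"
      "G0 + h0 \<le> M" "(\<Sum>j\<in>UNIV. G j) + (\<Sum>j\<in>UNIV. h j) \<le> M"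
      using G h0 sums by (auto simp: M_def sum.distrib)
    \<comment> \<open>Makes \<open>K \<ge> 4 * norm1 m\<close> for every \<open>m\<close> in
      \<open>F\<close>, as the lower bound for the weight demands.\<close>
    define K where "K = 4 * (\<Sum>m\<in>F. norm1 m)"
    obtain l where l: "F \<subseteq> fbox l" using finite_subset_fbox[OF F(1)] .
    have "\<exists>L0. \<forall>j :: 'n. \<forall>L\<ge>L0. \<forall>z. norm (\<Sum>m\<in>fbox L. of_real (of_int (m $ j) * dyadic_weight K m) * char_fun m (z :: real ^ 'n)) \<le> B"
    proof -
      obtain L0 where L0: "\<And>(j :: 'n) L z. L \<ge> L0 j \<Longrightarrow> norm (\<Sum>m\<in>fbox L. of_real (of_int (m $ j) * dyadic_weight K m) * char_fun m (z :: real ^ 'n)) \<le> B"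
        using B(2)[of _ K] by metis
      have "L0 j \<le> Max (range L0)" for j by (rule Max_ge) auto
      thus ?thesis using L0 by (intro exI[of _ "Max (range L0)"]) (meson order_trans)
    qed
    then obtain L0 where L0: "\<And>(j :: 'n) L z. L \<ge> L0 \<Longrightarrow> norm (\<Sum>m\<in>fbox L. of_real (of_int (m $ j) * dyadic_weight K m) * char_fun m (z :: real ^ 'n)) \<le> B"
      by blast
    \<comment> \<open>The box is fixed after \<open>K\<close>: it must contain \<open>F\<close> and
      be large enough for the kernel bound at this truncation, simultaneously for all
      \<open>j\<close>.\<close>
    define E :: "(int ^ 'n) set" where "E = fbox (max L0 l)"
    have E: "finite E" "F \<subseteq> E" using l fbox_mono[of l "max L0 l"] by (auto simp: E_def)
    define \<kappa> :: "'n \<Rightarrow> int ^ 'n \<Rightarrow> complex" where "\<kappa> j m = of_real (of_int (m $ j) * dyadic_weight K m)" for j m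
    have kernel: "norm (\<Sum>m\<in>E. \<kappa> j m * char_fun m z) \<le> B" for j z
      unfolding E_def \<kappa>_def by (rule L0) simp
    define \<omega> where "\<omega> m = norm (freq m) * dyadic_weight K m" for m :: "int ^ 'n"
    have \<omega>0: "\<omega> m \<ge> 0" for m by (simp add: \<omega>_def dyadic_weight_nonneg)
    have \<kappa>\<omega>: "norm (\<kappa> j m) \<le> \<omega> m" for j m
      using component_le_norm_cart[of "freq m" j] dyadic_weight_nonneg[of K m]
      unfolding \<kappa>_def \<omega>_def by (simp add: abs_mult norm_mult mult_right_mono)
    have \<omega>_upper: "\<omega> m \<le> c1 / norm (freq m) ^ ?n" if "m \<noteq> 0" for m
      using dyadic_weight_upper[OF that, of K] that by (simp add: \<omega>_def c1_def field_simps)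
    have \<omega>_lower: "c0 / norm (freq m) ^ ?n \<le> \<omega> m" if "m \<in> F" for m
    proof -
      have m0: "m \<noteq> 0" using that F by auto
      have "norm1 m \<le> (\<Sum>m\<in>F. norm1 m)" by (rule member_le_sum) (use that F in auto)
      hence "K \<ge> 4 * norm1 m" by (simp add: K_def)
      from dyadic_weight_lower[OF m0 this] show ?thesis
        using m0 by (simp add: \<omega>_def c0_def field_simps)
    qed
    define W where "W p = L2_set (\<lambda>m. sqrt (\<omega> m) * norm (p m)) E" for p :: "int ^ 'n \<Rightarrow> complex"
    have W0: "W p \<ge> 0" for p by (simp add: W_def)
    have W_sq: "(W p)\<^sup>2 = (\<Sum>m\<in>E. \<omega> m * (norm (p m))\<^sup>2)" for p
      unfolding W_def L2_set_def by (simp add: sum_nonneg \<omega>0 power_mult_distrib)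
    have W_le: "W p \<le> s * k" if k: "k \<ge> 0" and p: "\<And>E. finite E \<Longrightarrow> 0 \<notin> E \<Longrightarrow> (\<Sum>m\<in>E. (norm (p m))\<^sup>2 / norm (freq m) ^ ?n) \<le> k\<^sup>2" for p k
    proof (rule power2_le_imp_le)
      \<comment> \<open>Frequency zero has weight zero, so the Sobolev bounds, which exclude it,
        suffice.\<close>
      have "(W p)\<^sup>2 = (\<Sum>m\<in>E - {0}. \<omega> m * (norm (p m))\<^sup>2)"
        unfolding W_sq by (rule sum.mono_neutral_right) (auto simp: E \<omega>_def)
      also have "\<dots> \<le> (\<Sum>m\<in>E - {0}. c1 * ((norm (p m))\<^sup>2 / norm (freq m) ^ ?n))"
      proof (rule sum_mono)
        fix m assume "m \<in> E - {0}"
        hence "\<omega> m * (norm (p m))\<^sup>2 \<le> c1 / norm (freq m) ^ ?n * (norm (p m))\<^sup>2"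
          by (intro mult_right_mono \<omega>_upper) auto
        thus "\<omega> m * (norm (p m))\<^sup>2 \<le> c1 * ((norm (p m))\<^sup>2 / norm (freq m) ^ ?n)" by simp
      qed
      also have "\<dots> \<le> c1 * k\<^sup>2"
        unfolding sum_distrib_left[symmetric] using c01 E by (intro mult_left_mono p) auto
      finally show "(W p)\<^sup>2 \<le> (s * k)\<^sup>2"
        using c01 by (simp add: s_def power_mult_distrib)
    qed (use s k in simp)
    define X where "X = W a"
    define bb where "bb j m = \<i> * of_real (of_int (m $ j) / norm (freq m)) * a m" for j m
    have X0: "X \<ge> 0" by (simp add: X_def W0)
    have Wb: "W (bb j) \<le> X" for j
      unfolding W_def X_def
    proof (rule L2_set_mono)
      fix m
      have "\<bar>of_int (m $ j) / norm (freq m)\<bar> \<le> 1"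
        using component_le_norm_cart[of "freq m" j] by (cases "m = 0") (simp_all add: abs_divide)
      hence "\<bar>of_int (m $ j) / norm (freq m)\<bar> * norm (a m) \<le> 1 * norm (a m)"
        by (rule mult_right_mono) simp
      hence "norm (bb j m) \<le> norm (a m)"
        unfolding bb_def norm_mult norm_of_real by simp
      thus "sqrt (\<omega> m) * norm (bb j m) \<le> sqrt (\<omega> m) * norm (a m)"
        using \<omega>0 by (intro mult_left_mono) auto
    qed (use \<omega>0 in simp)
    have W\<phi>0: "W \<phi>0 \<le> s * h0" by (rule W_le[OF h0 \<phi>0])
    have W\<phi>: "W (\<phi> j) \<le> s * h j" for j by (rule W_le[OF h \<phi>])
    define I where "I j = (\<Sum>m\<in>E. \<kappa> j m * a m * cnj (bb j m))" for j
    have CS: "norm (\<Sum>m\<in>E. \<kappa> j m * p m * cnj (q m)) \<le> W p * W q" for j p q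
      unfolding W_def by (rule weighted_cauchy_schwarz) (rule \<kappa>\<omega>)
    \<comment> \<open>Conjugating \<open>bb j m\<close> produces \<open>- \<i>\<close>, cancelled by
      the factor \<open>\<i>\<close>. What remains is the square of \<open>m $ j\<close> over
      \<open>norm (freq m)\<close>, and summing over \<open>j\<close> restores
      \<open>\<omega> m\<close>; at \<open>m = 0\<close> both sides vanish.\<close>
    have identity: "complex_of_real (X\<^sup>2) = (\<Sum>j\<in>UNIV. \<i> * I j)"
    proof -
      have "(\<Sum>j\<in>UNIV. \<i> * (\<kappa> j m * a m * cnj (bb j m))) = complex_of_real (\<omega> m * (norm (a m))\<^sup>2)" for m
      proof -
        have "\<i> * (\<kappa> j m * a m * cnj (bb j m)) = complex_of_real ((of_int (m $ j))\<^sup>2 * (dyadic_weight K m / norm (freq m) * (norm (a m))\<^sup>2))" for j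
          unfolding \<kappa>_def bb_def of_real_mult complex_norm_square by (simp add: power2_eq_square mult_ac)
        hence "(\<Sum>j\<in>UNIV. \<i> * (\<kappa> j m * a m * cnj (bb j m)))
            = complex_of_real ((\<Sum>j\<in>UNIV. (of_int (m $ j))\<^sup>2) * (dyadic_weight K m / norm (freq m) * (norm (a m))\<^sup>2))"
          by (simp only: sum_distrib_right of_real_sum)
        also have "(\<Sum>j\<in>UNIV. (of_int (m $ j))\<^sup>2) = norm (freq m) ^ 2"
          by (simp add: norm_vec_def L2_set_def sum_nonneg)
        finally show ?thesis
          by (simp add: \<omega>_def power2_eq_square)
      qed
      hence "complex_of_real (X\<^sup>2) = (\<Sum>m\<in>E. \<Sum>j\<in>UNIV. \<i> * (\<kappa> j m * a m * cnj (bb j m)))"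
        unfolding X_def W_sq by (simp only: of_real_sum)
      also have "\<dots> = (\<Sum>j\<in>UNIV. \<i> * I j)"
        unfolding I_def sum_distrib_left by (rule sum.swap)
      finally show ?thesis .
    qed
    have I_le: "norm (I j) \<le> B * (G0 * G j) + X * (s * h j) + (s * h0) * (s * h j) + (s * h0) * X" for j
    proof -
      define \<gamma>0 where "\<gamma>0 = fourier_coeff (dist_of g0)"
      define \<gamma> where "\<gamma> = fourier_coeff (dist_of (g j))"
      \<comment> \<open>Products of an \<open>L^1\<close> part with a Sobolev part are avoided: the
        mixed terms contain the full \<open>a\<close> or \<open>bb j\<close>, whose weighted norms
        are at most \<open>X\<close> and can be absorbed.\<close>
      have "\<kappa> j m * a m * cnj (bb j m) = \<kappa> j m * \<gamma>0 m * cnj (\<gamma> m) + \<kappa> j m * a m * cnj (\<phi> j m)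
          - \<kappa> j m * \<phi>0 m * cnj (\<phi> j m) + \<kappa> j m * \<phi>0 m * cnj (bb j m)" for m
      proof -
        have 1: "\<gamma>0 m = a m - \<phi>0 m" using a[of m] by (simp add: \<gamma>0_def)
        have 2: "\<gamma> m = bb j m - \<phi> j m" using b[of m j] by (simp add: bb_def \<gamma>_def)
        show ?thesis unfolding 1 2 complex_cnj_diff by (simp add: algebra_simps)
      qed
      hence I: "I j = (\<Sum>m\<in>E. \<kappa> j m * \<gamma>0 m * cnj (\<gamma> m)) + (\<Sum>m\<in>E. \<kappa> j m * a m * cnj (\<phi> j m))
          - (\<Sum>m\<in>E. \<kappa> j m * \<phi>0 m * cnj (\<phi> j m)) + (\<Sum>m\<in>E. \<kappa> j m * \<phi>0 m * cnj (bb j m))"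
        unfolding I_def by (simp only: sum.distrib sum_subtractf)
      have tri: "norm (x + y - z + w) \<le> norm x + norm y + norm z + norm w" for x y z w :: complex
        using norm_triangle_ineq[of "x + y - z" w] norm_triangle_ineq4[of "x + y" z] norm_triangle_ineq[of x y]
        by linarith
      have sh: "s * h0 \<ge> 0" "s * h j \<ge> 0" using s h0 h by simp_all
      show ?thesis
        unfolding I
      proof (rule order_trans[OF tri], intro add_mono)
        show "norm (\<Sum>m\<in>E. \<kappa> j m * \<gamma>0 m * cnj (\<gamma> m)) \<le> B * (G0 * G j)"
          unfolding \<gamma>0_def \<gamma>_def G0_def G_def by (rule norm_bilinear_fourier_le[OF g0 g E(1) kernel])
        show "norm (\<Sum>m\<in>E. \<kappa> j m * a m * cnj (\<phi> j m)) \<le> X * (s * h j)"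
          unfolding X_def by (rule order_trans[OF CS mult_left_mono[OF W\<phi> W0]])
        show "norm (\<Sum>m\<in>E. \<kappa> j m * \<phi>0 m * cnj (\<phi> j m)) \<le> (s * h0) * (s * h j)"
          by (rule order_trans[OF CS mult_mono[OF W\<phi>0 W\<phi> sh(1) W0]])
        show "norm (\<Sum>m\<in>E. \<kappa> j m * \<phi>0 m * cnj (bb j m)) \<le> (s * h0) * X"
          by (rule order_trans[OF CS mult_mono[OF W\<phi>0 Wb sh(1) W0]])
      qed
    qed
    have "X\<^sup>2 = norm (complex_of_real (X\<^sup>2))"
      by (simp only: norm_of_real abs_power2)
    also have "\<dots> \<le> (\<Sum>j\<in>UNIV. norm (\<i> * I j))"
      unfolding identity by (rule norm_sum)
    also have "\<dots> \<le> (\<Sum>j\<in>UNIV. B * (G0 * G j) + X * (s * h j) + (s * h0) * (s * h j) + (s * h0) * X)"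
      using I_le by (intro sum_mono) (simp add: norm_mult)
    also have "\<dots> = B * (G0 * (\<Sum>j\<in>UNIV. G j)) + X * (s * (\<Sum>j\<in>UNIV. h j)) + s\<^sup>2 * (h0 * (\<Sum>j\<in>UNIV. h j)) + ?n * (s * h0 * X)"
      by (simp add: sum.distrib sum_distrib_left power2_eq_square mult_ac)
    also have "\<dots> \<le> B * (M * M) + X * (s * M) + s\<^sup>2 * (M * M) + ?n * (s * M * X)"
      using M B X0 s h0 sums G by (intro add_mono mult_left_mono mult_mono mult_nonneg_nonneg) auto
    also have "\<dots> = (B + s\<^sup>2) * M\<^sup>2 + ((1 + ?n) * s * M) * X"
      by (simp add: power2_eq_square algebra_simps)
    also have "((1 + ?n) * s * M) * X \<le> (((1 + ?n) * s * M)\<^sup>2 + X\<^sup>2) / 2"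
      using sum_squares_bound[of "(1 + ?n) * s * M" X] by simp
    also have "((1 + ?n) * s * M)\<^sup>2 = ((1 + ?n) * s)\<^sup>2 * M\<^sup>2"
      by (rule power_mult_distrib)
    finally have "X\<^sup>2 \<le> (B + s\<^sup>2) * M\<^sup>2 + (((1 + ?n) * s)\<^sup>2 * M\<^sup>2 + X\<^sup>2) / 2"
      by simp
    \<comment> \<open>The absorption: \<open>X ^ 2\<close> appears on both sides and is a real
      number because \<open>E\<close> is finite.\<close>
    moreover have "x \<le> 2 * y + z" if "x \<le> y + (z + x) / 2" for x y z :: real
      using that by (simp add: field_simps)
    ultimately have "X\<^sup>2 \<le> 2 * ((B + s\<^sup>2) * M\<^sup>2) + ((1 + ?n) * s)\<^sup>2 * M\<^sup>2"
      by blast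
    hence "X\<^sup>2 \<le> C1 * M\<^sup>2"
      by (simp only: C1_def distrib_right mult.assoc)
    \<comment> \<open>The lower bound for the weight is available on \<open>F\<close>; the remaining
      frequencies of \<open>E\<close> are discarded by nonnegativity.\<close>
    have "c0 * (\<Sum>m\<in>F. (norm (a m))\<^sup>2 / norm (freq m) ^ ?n) \<le> (\<Sum>m\<in>F. \<omega> m * (norm (a m))\<^sup>2)"
      unfolding sum_distrib_left
    proof (rule sum_mono)
      fix m assume "m \<in> F"
      from mult_right_mono[OF \<omega>_lower[OF this], of "(norm (a m))\<^sup>2"]
      show "c0 * ((norm (a m))\<^sup>2 / norm (freq m) ^ ?n) \<le> \<omega> m * (norm (a m))\<^sup>2" by simp
    qed
    also have "\<dots> \<le> X\<^sup>2"
      unfolding X_def W_sq using E \<omega>0 by (intro sum_mono2) auto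
    also have "\<dots> \<le> C1 * M\<^sup>2" by fact
    finally have "(\<Sum>m\<in>F. (norm (a m))\<^sup>2 / norm (freq m) ^ ?n) \<le> C1 / c0 * M\<^sup>2"
      using c01 by (simp add: field_simps)
    also have "\<dots> = (sqrt (C1 / c0) * M)\<^sup>2"
      using C1 c01 by (simp add: power_mult_distrib)
    finally show "(\<Sum>m\<in>F. (norm (fourier_coeff v m))\<^sup>2 / norm (freq m) ^ ?n)
        \<le> (sqrt (C1 / c0) * (L1_norm g0 + H_neg_norm f0 + (\<Sum>j\<in>UNIV. L1_norm (g j) + H_neg_norm (f j))))\<^sup>2"
      by (simp add: M_def G0_def G_def a_def h0_def h_def)
  qed
qed

section \<open>Passage to the infimum norms and reconstruction of the distribution\<close>

lemma L1_plus_H_decompose: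
  assumes "v \<in> L1_plus_H" and "\<epsilon> > 0"
  obtains g f where "g \<in> L1_funs" "f \<in> H_neg" "v = dist_add (dist_of g) f"
    "L1_norm g + H_neg_norm f < L1_plus_H_norm v + \<epsilon>"
proof -
  let ?S = "{L1_norm g + H_neg_norm f | g f. g \<in> L1_funs \<and> f \<in> H_neg \<and> v = dist_add (dist_of g) f}"
  have "?S \<noteq> {}"
    using assms(1) by (auto simp: L1_plus_H_def)
  moreover have "Inf ?S < L1_plus_H_norm v + \<epsilon>"
    using assms(2) by (simp add: L1_plus_H_norm_def)
  ultimately have "\<exists>t\<in>?S. t < L1_plus_H_norm v + \<epsilon>"
    by (rule cInf_lessD)
  thus ?thesis using that by blast
qed

theorem theorem4:
  assumes "CARD('n::finite) \<ge> 2"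
  shows "\<exists>C>0. \<forall>u \<in> (distributions :: ((real ^ 'n \<Rightarrow> complex) \<Rightarrow> complex) set).
           frac_laplacian u \<in> L1_plus_H \<longrightarrow>
           (\<forall>j. riesz j (frac_laplacian u) \<in> L1_plus_H) \<longrightarrow>
           (\<exists>w \<in> L2_mean_zero.
              dist_diff u (dist_of (\<lambda>_. dist_mean u)) = dist_of w \<and>
              L2_norm w \<le> C * (L1_plus_H_norm (frac_laplacian u)
                               + (\<Sum>j\<in>UNIV. L1_plus_H_norm (riesz j (frac_laplacian u)))))"
proof -
  let ?V = "(2 * pi) ^ CARD('n) :: real"
  obtain C where C: "C > 0"
    and est: "\<forall>(v :: (real ^ 'n \<Rightarrow> complex) \<Rightarrow> complex) g0 f0 g f F.
     g0 \<in> L1_funs \<longrightarrow> f0 \<in> H_neg \<longrightarrow> (\<forall>j. g j \<in> L1_funs) \<longrightarrow> (\<forall>j. f j \<in> H_neg) \<longrightarrow>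
     v = dist_add (dist_of g0) f0 \<longrightarrow> (\<forall>j. riesz j v = dist_add (dist_of (g j)) (f j)) \<longrightarrow>
     finite F \<longrightarrow> 0 \<notin> F \<longrightarrow>
     (\<Sum>m\<in>F. (norm (fourier_coeff v m))\<^sup>2 / norm (freq m) ^ CARD('n))
       \<le> (C * (L1_norm g0 + H_neg_norm f0 + (\<Sum>j\<in>UNIV. L1_norm (g j) + H_neg_norm (f j))))\<^sup>2"
    using main_estimate[where 'n = 'n] by (elim exE conjE)
  show ?thesis
  \<comment> \<open>The factor \<open>sqrt ?V\<close> converts the \<open>l^2\<close> norm of the
    coefficients into the \<open>L^2\<close> norm over the cube.\<close>
  proof (intro exI[of _ "sqrt ?V * C"] conjI ballI impI)
    show "sqrt ?V * C > 0" using C by simp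
    fix u :: "(real ^ 'n \<Rightarrow> complex) \<Rightarrow> complex"
    assume u: "u \<in> distributions" and v0: "frac_laplacian u \<in> L1_plus_H"
      and v: "\<forall>j. riesz j (frac_laplacian u) \<in> L1_plus_H"
    define a where "a = fourier_coeff (frac_laplacian u)"
    define N where "N = L1_plus_H_norm (frac_laplacian u) + (\<Sum>j\<in>UNIV. L1_plus_H_norm (riesz j (frac_laplacian u)))"
    \<comment> \<open>The multiplier of \<open>frac_laplacian\<close> vanishes at zero, so nothing
      controls that coefficient; setting it to zero gives \<open>w\<close> mean zero.\<close>
    define c where "c m = (if m = 0 then 0 else fourier_coeff u m)" for m
    have a_sq: "(norm (a m))\<^sup>2 / norm (freq m) ^ CARD('n) = (norm (c m))\<^sup>2" if "m \<noteq> 0" for m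
    proof -
      have "(norm (freq m) powr (real CARD('n) / 2))\<^sup>2 = norm (freq m) ^ CARD('n)"
        using that by (simp add: powr_power powr_realpow)
      thus ?thesis
        using that unfolding a_def frac_laplacian_def fourier_coeff_multiplier c_def
        by (simp add: norm_mult power_mult_distrib)
    qed
    have approx: "(\<Sum>m\<in>F. (norm (c m))\<^sup>2) \<le> (C * (N + \<epsilon>))\<^sup>2" if F: "finite F" and \<epsilon>: "\<epsilon> > 0" for F \<epsilon>
    proof -
      \<comment> \<open>There are \<open>1 + CARD('n)\<close> infima, each approximated up to
        \<open>\<delta>\<close>, for a total loss of \<open>\<epsilon>\<close>.\<close>
      define \<delta> where "\<delta> = \<epsilon> / (1 + real CARD('n))"
      have \<delta>: "\<delta> > 0" using \<epsilon> by (simp add: \<delta>_def)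
      obtain g0 f0 where 0: "g0 \<in> L1_funs" "f0 \<in> H_neg" "frac_laplacian u = dist_add (dist_of g0) f0"
        "L1_norm g0 + H_neg_norm f0 < L1_plus_H_norm (frac_laplacian u) + \<delta>"
        using L1_plus_H_decompose[OF v0 \<delta>] .
      have "\<exists>g f. g \<in> L1_funs \<and> f \<in> H_neg \<and> riesz j (frac_laplacian u) = dist_add (dist_of g) f \<and>
        L1_norm g + H_neg_norm f < L1_plus_H_norm (riesz j (frac_laplacian u)) + \<delta>" for j
        using L1_plus_H_decompose[OF v[rule_format, of j] \<delta>] by blast
      then obtain g f where j: "\<And>j. g j \<in> L1_funs" "\<And>j. f j \<in> H_neg"
        "\<And>j. riesz j (frac_laplacian u) = dist_add (dist_of (g j)) (f j)"
        "\<And>j. L1_norm (g j) + H_neg_norm (f j) < L1_plus_H_norm (riesz j (frac_laplacian u)) + \<delta>"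
        by metis
      define S where "S = L1_norm g0 + H_neg_norm f0 + (\<Sum>j\<in>UNIV. L1_norm (g j) + H_neg_norm (f j))"
      have "(\<Sum>m\<in>F - {0}. (norm (a m))\<^sup>2 / norm (freq m) ^ CARD('n)) \<le> (C * S)\<^sup>2"
        unfolding S_def a_def using F 0 j by (intro est[rule_format]) auto
      also have "(\<Sum>m\<in>F - {0}. (norm (a m))\<^sup>2 / norm (freq m) ^ CARD('n)) = (\<Sum>m\<in>F - {0}. (norm (c m))\<^sup>2)"
        by (intro sum.cong) (auto simp: a_sq)
      also have "\<dots> = (\<Sum>m\<in>F. (norm (c m))\<^sup>2)"
        using F by (intro sum.mono_neutral_left) (auto simp: c_def)
      also have "(C * S)\<^sup>2 \<le> (C * (N + \<epsilon>))\<^sup>2"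
      proof (intro power_mono mult_left_mono)
        have "(\<Sum>j\<in>UNIV. L1_norm (g j) + H_neg_norm (f j)) \<le> (\<Sum>j\<in>UNIV. L1_plus_H_norm (riesz j (frac_laplacian u)) + \<delta>)"
          by (intro sum_mono less_imp_le j)
        hence "S \<le> N + (\<delta> + CARD('n) * \<delta>)"
          using 0(4) by (simp add: S_def N_def sum.distrib)
        also have "\<delta> + CARD('n) * \<delta> = \<epsilon>"
        proof -
          have "1 + real CARD('n) \<noteq> 0" by linarith
          hence "(1 + real CARD('n)) * \<delta> = \<epsilon>" unfolding \<delta>_def times_divide_eq_right by (rule nonzero_mult_div_cancel_left)
          thus ?thesis by (simp only: distrib_right mult_1_left)
        qed
        finally show "S \<le> N + \<epsilon>" .
        show "0 \<le> C * S"
          unfolding S_def using C H_neg_norm_nonneg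
          by (intro mult_nonneg_nonneg add_nonneg_nonneg sum_nonneg) (auto simp: L1_norm_def)
      qed (use C in simp)
      finally show ?thesis .
    qed
    \<comment> \<open>The infima need not be attained; since the left side of \<open>approx\<close>
      does not involve \<open>\<epsilon>\<close>, the slack can be sent to zero.\<close>
    have "((\<lambda>\<epsilon>. (C * (N + \<epsilon>))\<^sup>2) \<longlongrightarrow> (C * (N + 0))\<^sup>2) (at_right 0)"
      by (intro tendsto_intros)
    hence bound: "(\<Sum>m\<in>F. (norm (c m))\<^sup>2) \<le> (C * N)\<^sup>2" if "finite F" for F
      using approx[OF that] by (intro tendsto_lowerbound[of "\<lambda>\<epsilon>. (C * (N + \<epsilon>))\<^sup>2" _ "at_right 0"])
        (auto simp: eventually_at_right_less eventually_at_filter)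
    obtain w where w: "w \<in> L2_funs" "\<And>m. fourier_coeff (dist_of w) m = c m"
      "L2_norm w \<le> sqrt (?V * (C * N)\<^sup>2)"
      by (rule riesz_fischer[OF bound]) (assumption, rule that, simp_all)
    \<comment> \<open>Needed to simplify \<open>sqrt ((C * N) ^ 2)\<close> to
      \<open>C * N\<close>.\<close>
    have N0: "N \<ge> 0"
    proof -
      have "L1_plus_H_norm v \<ge> 0" if v: "v \<in> L1_plus_H" for v :: "(real ^ 'n \<Rightarrow> complex) \<Rightarrow> complex"
      proof (rule field_le_epsilon)
        fix e :: real assume e: "e > 0"
        obtain g f where "g \<in> L1_funs" "f \<in> H_neg" "v = dist_add (dist_of g) f"
          and *: "L1_norm g + H_neg_norm f < L1_plus_H_norm v + e"
          using L1_plus_H_decompose[OF v e] .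
        have "L1_norm g \<ge> 0" by (simp add: L1_norm_def)
        thus "0 \<le> L1_plus_H_norm v + e"
          using * H_neg_norm_nonneg[of f] by linarith
      qed
      thus ?thesis unfolding N_def using v0 v by (intro add_nonneg_nonneg sum_nonneg) auto
    qed
    have wi: "integrable torus w" by (rule L2_funs_integrable[OF w(1)])
    interpret finite_measure "torus :: (real ^ 'n) measure" by (rule finite_measure_torus)
    \<comment> \<open>The mean is put back, so that all coefficients including the one at zero agree
      and uniqueness applies to \<open>u\<close> itself.\<close>
    have u_eq: "u = dist_of (\<lambda>x. dist_mean u + w x)"
    proof (rule distribution_eqI[OF u])
      show "integrable torus (\<lambda>x. dist_mean u + w x)" using wi by simp
      fix m
      have "fourier_coeff (dist_of (\<lambda>x. dist_mean u + w x)) m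
          = ((\<integral>x. dist_mean u * char_fun (- m) x \<partial>torus) + (\<integral>x. w x * char_fun (- m) x \<partial>torus)) / ?V"
        unfolding fourier_coeff_dist_of distrib_right
        by (subst Bochner_Integration.integral_add[OF integrable_mult_char_fun integrable_mult_char_fun[OF wi]]) simp_all
      also have "\<dots> = (if m = 0 then dist_mean u else 0) + c m"
        by (simp add: add_divide_distrib integral_char_fun w(2)[symmetric] fourier_coeff_dist_of)
      also have "\<dots> = fourier_coeff u m"
        by (simp add: c_def dist_mean_def)
      finally show "fourier_coeff u m = fourier_coeff (dist_of (\<lambda>x. dist_mean u + w x)) m" ..
    qed
    have "dist_diff u (dist_of (\<lambda>_. dist_mean u)) \<phi> = dist_of w \<phi>" for \<phi>
    proof (cases "\<phi> \<in> test_funs")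
      case True
      note \<phi> = test_funs_continuous[OF True]
      obtain B where B: "\<And>x. norm (\<phi> x) \<le> B"
        using periodic_bounded[OF \<phi> test_funs_periodic[OF True]] by blast
      have "u \<phi> = (\<integral>x. dist_mean u * \<phi> x + w x * \<phi> x \<partial>torus)"
        using True by (subst u_eq) (simp add: dist_of_def distrib_right)
      also have "\<dots> = (\<integral>x. dist_mean u * \<phi> x \<partial>torus) + (\<integral>x. w x * \<phi> x \<partial>torus)"
        by (intro Bochner_Integration.integral_add integrable_mult_continuous[OF wi \<phi> B]
            torus_integrable_continuous continuous_intros \<phi>)
      finally show ?thesis
        using True by (simp add: dist_diff_def dist_of_def)
    qed (simp add: dist_diff_def dist_of_def)
    hence diff: "dist_diff u (dist_of (\<lambda>_. dist_mean u)) = dist_of w" by blast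
    have "w \<in> L2_mean_zero"
      using w(1) w(2)[of 0] by (simp add: L2_mean_zero_def fourier_coeff_dist_of c_def)
    moreover have "L2_norm w \<le> sqrt ?V * C * N"
      using w(3) C N0 by (simp add: real_sqrt_mult)
    ultimately show "\<exists>w \<in> L2_mean_zero.
        dist_diff u (dist_of (\<lambda>_. dist_mean u)) = dist_of w \<and>
        L2_norm w \<le> sqrt ?V * C * (L1_plus_H_norm (frac_laplacian u)
                               + (\<Sum>j\<in>UNIV. L1_plus_H_norm (riesz j (frac_laplacian u))))"
      using diff unfolding N_def by blast
  qed
qed

end
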